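(* For $0<|q|<1$, let $S(a,b,c)=\chi_5(q^{4a},q^{-4a},q^{4b},q^{-4b},q^{4c};q^4)$. Then $$S(0,0,0)=4q^2\frac{J_8^6J_{8,28}J_{12,56}}{J_2J_4^5J_8J_{56}}-2q\frac{J_4J_8J_{6,28}J_{16,56}}{J_2^3J_{56}}+\frac12\frac{J_2^7J_{6,28}J_{16,56}}{J_1^4J_4J_8^3J_{56}}+\frac12\frac{J_2^5J_{28}^2J_{12,56}J_{16,56}}{J_4^5J_8J_{56}^2J_{6,28}},$$ $$S(1,1,\tfrac12)=4\frac{J_8^7J_{8,28}J_{12,56}}{J_4^8J_{56}}-2q^{-1}\frac{J_8^3J_{6,28}J_{16,56}}{J_2^2J_4^2J_{56}}+\frac12q^{-2}\frac{J_2^8J_{6,28}J_{16,56}}{J_1^4J_4^4J_8J_{56}}-\frac12q^{-2}\frac{J_2^6J_8J_{28}^2J_{12,56}J_{16,56}}{J_{4}^8J_{56}^2J_{6,28}},$$ $$S(-1,-1,0)=4q^2\frac{J_8^5J_{12,28}J_{4,56}}{J_2J_4^5J_{56}}-2q^{-1}\frac{J_4J_8J_{2,28}J_{24,56}}{J_2^3J_{56}}+\frac12q^{-2}\frac{J_2^7J_{2,28}J_{24,56}}{J_1^4J_4J_8^3J_{56}}-\frac12q^{-2}\frac{J_2^5J_{28}^2J_{4,56}J_{24,56}}{J_4^5J_8J_{56}^2J_{2,28}},$$ $$S(0,0,\tfrac12)=4q^4\frac{J_8^7J_{12,28}J_{4,56}}{J_4^8J_{56}}-2q\frac{J_8^3J_{2,28}J_{24,56}}{J_2^2J_4^2J_{56}}+\frac12\frac{J_2^8J_{2,28}J_{24,56}}{J_1^4J_4^4J_8J_{56}}+\frac12\frac{J_2^6J_8J_{28}^2J_{4,56}J_{24,56}}{J_4^8J_{56}^2J_{2,28}},$$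 $$S(0,-1,0)=4\frac{J_8^5J_{4,28}J_{20,56}}{J_2J_4^5J_{56}}-2q\frac{J_4J_8J_{10,28}J_{8,56}}{J_2^3J_{56}}+\frac12\frac{J_2^7J_{10,28}J_{8,56}}{J_1^4J_4J_8^3J_{56}}-\frac12\frac{J_2^5J_{28}^2J_{8,56}J_{20,56}}{J_4^5J_8J_{56}^2J_{10,28}},$$ $$S(1,0,\tfrac12)=4\frac{J_8^7J_{4,28}J_{20,56}}{J_4^8J_{56}}-2q\frac{J_8^3J_{10,28}J_{8,56}}{J_2^2J_4^2J_{56}}+\frac12\frac{J_2^8J_{10,28}J_{8,56}}{J_1^4J_4^4J_8J_{56}}+\frac12\frac{J_2^6J_{8}J_{28}^2J_{8,56}J_{20,56}}{J_4^8J_{56}^2J_{10,28}},$$ $$S(-1,-1,-\tfrac12)=2S(1,1,\tfrac12),\qquad S(-2,-2,-\tfrac12)=2q^{-8}S(0,0,\tfrac12),\qquad S(-1,-2,-\tfrac12)=2q^{-4}S(1,0,\tfrac12).$$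
   Context: $(a;q)_n=\prod_{k=0}^{n-1}(1-aq^k)$, $(a;q)_\infty=\prod_{k=0}^\infty(1-aq^k)$ for $|q|<1$, and $(a_1,\dots,a_m;q)_\infty=(a_1;q)_\infty\cdots(a_m;q)_\infty$. Notation: $J_m=(q^m;q^m)_\infty$ and $J_{a,m}=(q^a,q^{m-a},q^m;q^m)_\infty$. The tadpole Cartan matrix $T_r=(a_{ij})_{r\times r}$ has $a_{rr}=1$, $a_{ii}=2$ for $i<r$, $a_{ij}=-1$ for $|i-j|=1$, and $a_{ij}=0$ otherwise. The generalized tadpole Nahm sum is $$\chi_r(x_1,\dots,x_r;q)=\sum_{n=(n_1,\dots,n_r)^{\mathrm T}\in(\mathbb{Z}_{\ge0})^r}\frac{q^{\frac12 n^{\mathrm T}T_r n}x_1^{n_1}\cdots x_r^{n_r}}{(q;q)_{n_1}\cdots (q;q)_{n_r}}.$$ Thus $\chi_5(x_1,\dots,x_5;q^4)=\sum_{n\in(\mathbb{Z}_{\ge 0})^5} q^{2n^{\mathrm T}T_5n}x_1^{n_1}\cdots x_5^{n_5}/\big((q^4;q^4)_{n_1}\cdots(q^4;q^4)_{n_5}\big)$. *)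

theory Defs
  imports "HOL-Analysis.Analysis"
begin

definition qpoch :: "complex \<Rightarrow> complex \<Rightarrow> nat \<Rightarrow> complex" where
  "qpoch a q n = (\<Prod>k<n. 1 - a * q ^ k)"

definition qpoch_inf :: "complex \<Rightarrow> complex \<Rightarrow> complex" where
  "qpoch_inf a q = (\<Prod>k. 1 - a * q ^ k)"

definition J :: "complex \<Rightarrow> nat \<Rightarrow> complex" where
  "J q m = qpoch_inf (q ^ m) (q ^ m)"

text \<open>Only meant for \<open>a \<le> m\<close>, because of the truncated subtraction.\<close>

definition JJ :: "complex \<Rightarrow> nat \<Rightarrow> nat \<Rightarrow> complex" where
  "JJ q a m = qpoch_inf (q ^ a) (q ^ m) * qpoch_inf (q ^ (m - a)) (q ^ m) * qpoch_inf (q ^ m) (q ^ m)"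

text \<open>Rows and columns are indexed by \<open>0, \<dots>, r - 1\<close>, so the exceptional diagonal entry sits at
  \<open>i = j = r - 1\<close>.\<close>

definition tadpole :: "nat \<Rightarrow> nat \<Rightarrow> nat \<Rightarrow> int" where
  "tadpole r i j =
    (if i = j then (if Suc i = r then 1 else 2)
     else if i = Suc j \<or> j = Suc i then -1 else 0)"

definition tadpole_form :: "nat \<Rightarrow> (nat \<Rightarrow> nat) \<Rightarrow> int" where
  "tadpole_form r n = (\<Sum>i<r. \<Sum>j<r. int (n i) * tadpole r i j * int (n j))"

text \<open>The summand of \<open>\<chi>\<^sub>r(x;q)\<close> contains \<open>q\<close> to the power \<open>tadpole_form r n / 2\<close>, which need not
  be an integer. The last argument is therefore a chosen square root \<open>h\<close> of the base:
  \<open>tadpole_nahm r x h\<close> is \<open>\<chi>\<^sub>r(x; h\<^sup>2)\<close>. The variables are \<open>x 0, \<dots>, x (r - 1)\<close>, and \<open>n\<close> ranges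
  over the \<open>r\<close>-tuples of natural numbers.\<close>

definition tadpole_nahm :: "nat \<Rightarrow> (nat \<Rightarrow> complex) \<Rightarrow> complex \<Rightarrow> complex" where
  "tadpole_nahm r x h =
    (\<Sum>\<^sub>\<infinity>n\<in>{..<r} \<rightarrow>\<^sub>E UNIV.
      h powi tadpole_form r n * (\<Prod>i<r. x i ^ n i) / (\<Prod>i<r. qpoch (h\<^sup>2) (h\<^sup>2) (n i)))"

text \<open>The base \<open>q\<^sup>4\<close> is given through its square root \<open>q\<^sup>2\<close>. The parameters are real so that \<open>c\<close> can
  be a half-integer; when \<open>4 * a\<close>, \<open>4 * b\<close> and \<open>4 * c\<close> are integers and \<open>q \<noteq> 0\<close>, the powers of
  \<open>q\<close> below are the ordinary integer powers and do not depend on a branch of the logarithm.\<close>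

definition S :: "complex \<Rightarrow> real \<Rightarrow> real \<Rightarrow> real \<Rightarrow> complex" where
  "S q a b c = tadpole_nahm 5
    ((!) [q powr of_real (4 * a), q powr of_real (- 4 * a),
          q powr of_real (4 * b), q powr of_real (- 4 * b),
          q powr of_real (4 * c)]) (q\<^sup>2)"

end

theory Submission
  imports Defs
begin

text \<open>Put \<open>Q = q\<^sup>4\<close> and \<open>p = q\<^sup>2\<close>, and write \<open>(a)\<^sub>n\<close> for the \<open>q\<close>-shifted factorial in base \<open>Q\<close>. Three ideas carry the proof.

  Rank reduction. The exponent of \<open>Q\<close> in the summand of \<open>S(a, b, c)\<close> is half of
  \<open>n\<^sub>1\<^sup>2 + (n\<^sub>1 - n\<^sub>2)\<^sup>2 + (n\<^sub>2 - n\<^sub>3)\<^sup>2 + (n\<^sub>3 - n\<^sub>4)\<^sup>2 + (n\<^sub>4 - n\<^sub>5)\<^sup>2\<close> plus the linear terms \<open>a (n\<^sub>1 - n\<^sub>2)\<close>,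
  \<open>b (n\<^sub>3 - n\<^sub>4)\<close> and \<open>c n\<^sub>5\<close>. Durfee's identity \<open>rqfact_durfee\<close>, applied to the pairs \<open>(n\<^sub>2, n\<^sub>3)\<close> and
  \<open>(n\<^sub>4, n\<^sub>5)\<close>, introduces two new indices \<open>i\<close>, \<open>j\<close> and turns the couplings \<open>(n\<^sub>2 - n\<^sub>3)\<^sup>2\<close> and \<open>(n\<^sub>4 - n\<^sub>5)\<^sup>2\<close>
  into the sums of squares \<open>(n\<^sub>2 - i)\<^sup>2 + (n\<^sub>3 - i)\<^sup>2\<close> and \<open>(n\<^sub>4 - j)\<^sup>2 + (n\<^sub>5 - j)\<^sup>2\<close>. Now \<open>n\<^sub>5 - j\<close> is free and is summed by
  Euler's product, and \<open>n\<^sub>1\<close>, \<open>n\<^sub>2 - i\<close> (likewise \<open>n\<^sub>3 - i\<close>, \<open>n\<^sub>4 - j\<close>) are coupled to the rest only through their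
  difference, so that Cauchy's identity \<open>rqfact_cauchy\<close> sums them for each value of the difference.
  The sums over the two differences are theta series. The outcome (\<open>rank_reduction\<close>) is
  \<open>S(a, b, c) = (-q\<^bsup>2+4c\<^esup>)\<^sub>\<infinity> / (Q)\<^sub>\<infinity>\<^sup>2 q\<^bsup>-a\<^sup>2-b\<^sup>2\<^esup> \<Sum>\<^sub>i\<^sub>,\<^sub>j q\<^bsup>i\<^sup>2-2ai+(j-i)\<^sup>2-2b(j-i)+4cj\<^esup> \<theta>(i-a) \<theta>(j-i-b) / ((Q)\<^sub>i (Q)\<^sub>j)\<close>,
  where \<open>\<theta>(t) = \<Sum>\<^sub>d q\<^bsup>(2d-t)\<^sup>2\<^esup>\<close> depends on the parity of \<open>t\<close> only. The nine parameter triples of the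
  theorem fall into the families \<open>(a, a, a/2)\<close>, \<open>(a, a, (a+1)/2)\<close> and \<open>(a, a-1, a/2)\<close>, and within a
  family the double sum depends on the parity of \<open>a\<close> only. This gives the last three identities at once.

  Parity dissection. For one parity of \<open>j\<close> the two theta factors are \<open>\<theta>(0) \<theta>(1)\<close>; for the other they are
  \<open>\<theta>(0)\<^sup>2\<close> or \<open>\<theta>(1)\<^sup>2\<close> according to the parity of \<open>i\<close>, and this parity is detected by the substitution
  \<open>p \<mapsto> -p\<close>. For each \<open>j\<close> the sum over \<open>i\<close> is an Euler product. The coefficients that arise are
  \<open>\<theta>(0) \<theta>(1)\<close> and \<open>\<theta>(0)\<^sup>2 \<plusminus> \<theta>(1)\<^sup>2\<close>. As \<open>\<theta>(0) \<plusminus> \<theta>(1) = \<Sum>\<^sub>n (\<plusminus>1)\<^sup>n q\<^bsup>n\<^sup>2\<^esup>\<close>, the triple product makes all of them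
  products except \<open>\<theta>(0)\<^sup>2 + \<theta>(1)\<^sup>2 = (\<theta>(0) + \<theta>(1))\<^sup>2 - 2 \<theta>(0) \<theta>(1)\<close>, which is a difference of two; hence
  the four terms in each of the first six formulas.

  Single sums. Six single sums of Rogers--Ramanujan--Slater type remain, with summands such as
  \<open>p\<^bsup>n\<^sup>2\<^esup> (-p; p\<^sup>2)\<^sub>n / (p\<^sup>2; p\<^sup>2)\<^sub>2\<^sub>n\<close>. They follow from Bailey's method: the finite identities \<open>bailey_pair_even\<close> and
  \<open>bailey_pair_odd\<close>, from which the other four Bailey pairs are deduced by elementary recurrences, are
  inserted into the conjugate Bailey pair \<open>has_sum_conjugate_bailey\<close>, a case of the \<open>\<^sub>1\<phi>\<^sub>1\<close> summation.
  This leaves theta series with exponents \<open>21 n\<^sup>2 + \<dots>\<close> which the quintuple product identity evaluates.\<close>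

section \<open>Infinite products and reciprocal factorials\<close>

lemma convergent_prod_qpoch:
  fixes a q :: complex
  assumes "norm q < 1"
  shows "convergent_prod (\<lambda>k. 1 - a * q ^ k)"
proof -
  have "summable (\<lambda>k. norm a * norm q ^ k)"
    using assms by (intro summable_mult summable_geometric) auto
  hence "summable (\<lambda>k. norm ((1 - a * q ^ k) - 1))"
    by (rule summable_cong[THEN iffD1, rotated]) (simp add: norm_mult norm_power)
  thus ?thesis
    by (intro abs_convergent_prod_imp_convergent_prod summable_imp_abs_convergent_prod)
qed

lemma qpoch_Suc: "qpoch a q (Suc n) = qpoch a q n * (1 - a * q ^ n)"
  by (simp add: qpoch_def)

lemma qpoch_0 [simp]: "qpoch a q 0 = 1"
  by (simp add: qpoch_def)

lemma tendsto_qpoch: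
  assumes "norm q < 1"
  shows "qpoch a q \<longlonglongrightarrow> qpoch_inf a q"
proof -
  have "(\<lambda>n. \<Prod>k\<le>n. 1 - a * q ^ k) \<longlonglongrightarrow> qpoch_inf a q"
    unfolding qpoch_inf_def using convergent_prod_LIMSEQ[OF convergent_prod_qpoch[OF assms]] .
  hence "(\<lambda>n. qpoch a q (Suc n)) \<longlonglongrightarrow> qpoch_inf a q"
    by (simp add: qpoch_def lessThan_Suc_atMost)
  thus ?thesis
    by (simp add: filterlim_sequentially_Suc)
qed

lemma qpoch_inf_eqI:
  assumes "norm q < 1" "qpoch a q \<longlonglongrightarrow> L"
  shows "qpoch_inf a q = L"
  using LIMSEQ_unique tendsto_qpoch[OF assms(1)] assms(2) by blast

lemma qpoch_add: "qpoch a q (m + n) = qpoch a q m * qpoch (a * q ^ m) q n"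
  by (induction n) (simp_all add: qpoch_Suc power_add mult_ac)

lemma qpoch_inf_shift:
  assumes "norm q < 1"
  shows "qpoch_inf a q = qpoch a q n * qpoch_inf (a * q ^ n) q"
proof (rule qpoch_inf_eqI[OF assms])
  have "(\<lambda>m. qpoch a q n * qpoch (a * q ^ n) q m) \<longlonglongrightarrow> qpoch a q n * qpoch_inf (a * q ^ n) q"
    by (intro tendsto_intros tendsto_qpoch assms)
  hence "(\<lambda>m. qpoch a q (m + n)) \<longlonglongrightarrow> qpoch a q n * qpoch_inf (a * q ^ n) q"
    by (simp add: qpoch_add[symmetric] add.commute)
  thus "qpoch a q \<longlonglongrightarrow> qpoch a q n * qpoch_inf (a * q ^ n) q"
    by (rule LIMSEQ_offset)
qed

lemma qpoch_inf_rec: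
  assumes "norm q < 1"
  shows "qpoch_inf a q = (1 - a) * qpoch_inf (a * q) q"
  using qpoch_inf_shift[OF assms, of a 1] by (simp add: qpoch_Suc)

lemma qpoch_inf_0 [simp]: "qpoch_inf 0 q = 1"
  by (simp add: qpoch_inf_def)

lemma mult_power_ne_1:
  fixes a q :: complex
  assumes "norm q < 1" "norm a < 1"
  shows "a * q ^ k \<noteq> 1"
proof
  assume "a * q ^ k = 1"
  hence "norm a * norm q ^ k = 1"
    by (metis norm_mult norm_one norm_power)
  moreover have "norm a * norm q ^ k \<le> norm a * 1"
    using assms by (intro mult_left_mono power_le_one) auto
  ultimately show False using assms by simp
qed

lemma qpoch_inf_nonzero:
  assumes "norm q < 1" "norm a < 1"
  shows "qpoch_inf a q \<noteq> 0"
  unfolding qpoch_inf_def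
  by (rule prodinf_nonzero[OF convergent_prod_qpoch[OF assms(1)]])
     (use mult_power_ne_1[OF assms] in \<open>metis eq_iff_diff_eq_0\<close>)

lemma qpoch_nonzero:
  assumes "norm q < 1" "norm a < 1"
  shows "qpoch a q n \<noteq> 0"
  using mult_power_ne_1[OF assms] by (auto simp: qpoch_def)

lemma norm_square_less_1: "norm (q :: complex) < 1 \<Longrightarrow> norm (q ^ 2) < 1"
  by (simp add: norm_power power_less_one_iff abs_square_less_1)

lemma qpoch_inf_split:
  assumes "norm q < 1"
  shows "qpoch_inf a q = qpoch_inf a (q\<^sup>2) * qpoch_inf (a * q) (q\<^sup>2)"
proof -
  have "qpoch a q (2 * n) = qpoch a (q\<^sup>2) n * qpoch (a * q) (q\<^sup>2) n" for n
    by (induction n) (simp_all add: qpoch_Suc power_mult[symmetric] mult_ac)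
  moreover have "(\<lambda>n. qpoch a q (2 * n)) \<longlonglongrightarrow> qpoch_inf a q"
    by (rule filterlim_compose[OF tendsto_qpoch[OF assms]])
       (auto intro!: filterlim_subseq simp: strict_mono_def)
  moreover have "(\<lambda>n. qpoch a (q\<^sup>2) n * qpoch (a * q) (q\<^sup>2) n)
      \<longlonglongrightarrow> qpoch_inf a (q\<^sup>2) * qpoch_inf (a * q) (q\<^sup>2)"
    by (intro tendsto_intros tendsto_qpoch norm_square_less_1 assms)
  ultimately show ?thesis
    using LIMSEQ_unique by auto
qed

lemma qpoch_inf_plus_minus:
  assumes "norm q < 1"
  shows "qpoch_inf a q * qpoch_inf (- a) q = qpoch_inf (a\<^sup>2) (q\<^sup>2)"
proof -
  have "qpoch (a\<^sup>2) (q\<^sup>2) n = qpoch a q n * qpoch (- a) q n" for n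
    by (induction n) (simp_all add: qpoch_Suc power2_eq_square power_mult_distrib algebra_simps)
  moreover have "(\<lambda>n. qpoch a q n * qpoch (- a) q n) \<longlonglongrightarrow> qpoch_inf a q * qpoch_inf (- a) q"
    by (intro tendsto_intros tendsto_qpoch assms)
  ultimately show ?thesis
    using qpoch_inf_eqI[OF norm_square_less_1[OF assms], of "a\<^sup>2"] by presburger
qed

lemma qpoch_bounded:
  assumes "norm q < 1"
  obtains C where "C > 0" "\<And>n. norm (qpoch a q n) \<le> C"
  using Bseq_def convergent_imp_Bseq[OF convergentI[OF tendsto_qpoch[OF assms, of a]]]
  unfolding Bseq_def by auto

text \<open>The reciprocal of \<open>(Q; Q)\<^sub>k\<close>, set to \<open>0\<close> for negative \<open>k\<close>. With this convention the recurrence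
  \<open>rqfact_rec\<close> holds for all integers, and sums with natural boundaries become sums over \<open>\<int>\<close>
  that can be shifted and reflected freely.\<close>

definition rqfact :: "complex \<Rightarrow> int \<Rightarrow> complex" where
  "rqfact Q k = (if k < 0 then 0 else inverse (qpoch Q Q (nat k)))"

lemma rqfact_neg [simp]: "k < 0 \<Longrightarrow> rqfact Q k = 0"
  by (simp add: rqfact_def)

lemma rqfact_0 [simp]: "rqfact Q 0 = 1"
  by (simp add: rqfact_def)

lemma rqfact_of_nat: "rqfact Q (int n) = inverse (qpoch Q Q n)"
  by (simp add: rqfact_def)

lemma rqfact_rec:
  assumes "norm Q < 1"
  shows "rqfact Q (k - 1) = (1 - Q powi k) * rqfact Q k"
proof (cases "k \<le> 0")
  case True
  thus ?thesis by (cases "k = 0") auto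
next
  case False
  then obtain n where n: "k = int (Suc n)"
    by (metis gr0_conv_Suc not_le zero_less_imp_eq_int)
  have "qpoch Q Q (Suc n) \<noteq> 0"
    by (intro qpoch_nonzero assms)
  hence "1 - Q * Q ^ n \<noteq> 0" "qpoch Q Q n \<noteq> 0"
    by (auto simp: qpoch_Suc)
  moreover have "Q powi k = Q * Q ^ n" "rqfact Q k = inverse (qpoch Q Q (Suc n))"
    "rqfact Q (k - 1) = inverse (qpoch Q Q n)"
    unfolding n power_int_of_nat rqfact_of_nat by (simp_all add: rqfact_of_nat[symmetric])
  ultimately show ?thesis
    by (simp add: qpoch_Suc)
qed

lemma tendsto_rqfact:
  assumes "norm Q < 1"
  shows "(\<lambda>n. rqfact Q (int n)) \<longlonglongrightarrow> inverse (qpoch_inf Q Q)"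
  unfolding rqfact_of_nat
  by (intro tendsto_inverse tendsto_qpoch qpoch_inf_nonzero assms)

lemma rqfact_bounded:
  assumes "norm Q < 1"
  obtains C where "C > 0" "\<And>k. norm (rqfact Q k) \<le> C"
proof -
  obtain C where "C > 0" "\<And>n. norm (rqfact Q (int n)) \<le> C"
    using convergent_imp_Bseq[OF convergentI[OF tendsto_rqfact[OF assms]]]
    unfolding Bseq_def by auto
  moreover from this have "norm (rqfact Q k) \<le> C" for k
    by (cases k) (auto simp: less_imp_le)
  ultimately show ?thesis using that by blast
qed

section \<open>Interchange of sums and Gaussian series\<close>

text \<open>Together with \<open>has_sum_exchange\<close> below, this is the form in which Fubini's theorem is used: every multiple
  sum is dominated by a product of one-dimensional absolutely convergent sums.\<close>

lemma abs_summable_product: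
  fixes f :: "'a \<Rightarrow> complex" and g :: "'b \<Rightarrow> complex"
  assumes "(\<lambda>x. norm (f x)) summable_on A" "(\<lambda>y. norm (g y)) summable_on B"
  shows "(\<lambda>(x, y). norm (f x * g y)) summable_on A \<times> B"
proof -
  have "(\<lambda>xy. norm (case xy of (x, y) \<Rightarrow> f x * g y)) summable_on A \<times> B"
  proof (rule Infinite_Sum.abs_summable_on_Sigma_iff[THEN iffD2, OF conjI])
    show "\<forall>x\<in>A. (\<lambda>y. norm (case (x, y) of (x, y) \<Rightarrow> f x * g y)) summable_on B"
      using assms(2) by (auto simp: norm_mult intro: summable_on_cmult_right)
    have "(\<lambda>x. norm (f x) * (\<Sum>\<^sub>\<infinity>y\<in>B. norm (g y))) summable_on A"
      by (intro summable_on_cmult_left assms)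
    thus "(\<lambda>x. norm (\<Sum>\<^sub>\<infinity>y\<in>B. norm (case (x, y) of (x, y) \<Rightarrow> f x * g y))) summable_on A"
      by (simp add: norm_mult infsum_cmult_right' abs_mult infsum_nonneg)
  qed
  thus ?thesis by (simp add: case_prod_unfold)
qed

lemma has_sum_int_from_nat:
  fixes f :: "int \<Rightarrow> 'a :: {comm_monoid_add, topological_space}"
  assumes "((\<lambda>n. f (int n)) has_sum T) UNIV" "\<And>k. k < 0 \<Longrightarrow> f k = 0"
  shows "(f has_sum T) UNIV"
proof -
  have "bij_betw int UNIV {0..}"
    by (rule bij_betwI[of _ _ _ nat]) auto
  hence "(f has_sum T) {0..}"
    using assms(1) has_sum_reindex_bij_betw by blast
  also have "?this \<longleftrightarrow> ?thesis"
    by (rule has_sum_cong_neutral) (auto simp: assms(2))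
  finally show ?thesis .
qed

lemma summable_gaussian_nat:
  fixes t y :: real
  assumes "0 < t" "t < 1" "0 < y"
  shows "summable (\<lambda>n. t ^ (n\<^sup>2) * y ^ n)"
proof (rule summable_comparison_test_ev)
  have "(\<lambda>n. t ^ n * y) \<longlonglongrightarrow> 0 * y"
    using assms by (intro tendsto_intros LIMSEQ_realpow_zero) auto
  hence "eventually (\<lambda>n. t ^ n * y < 1/2) sequentially"
    by (intro order_tendstoD) auto
  thus "eventually (\<lambda>n. norm (t ^ (n\<^sup>2) * y ^ n) \<le> (1/2) ^ n) sequentially"
  proof eventually_elim
    case (elim n)
    have "t ^ (n\<^sup>2) * y ^ n = (t ^ n * y) ^ n"
      by (simp add: power_mult_distrib power_mult[symmetric] power2_eq_square)
    also have "\<dots> \<le> (1/2) ^ n"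
      using elim assms by (intro power_mono) auto
    finally show ?case using assms by simp
  qed
qed auto

lemma summable_on_gaussian:
  fixes t y :: real
  assumes "0 < t" "t < 1" "0 < y"
  shows "(\<lambda>n::int. t powi (n\<^sup>2) * y powi n) summable_on UNIV"
proof -
  have half: "(\<lambda>n::int. t powi (n\<^sup>2) * z powi n) summable_on {0..}" if "z > 0" for z
  proof -
    have "(\<lambda>n. t ^ (n\<^sup>2) * z ^ n) summable_on UNIV"
      using summable_gaussian_nat[OF assms(1,2) that] assms that
      by (intro norm_summable_imp_summable_on) auto
    also have "(\<lambda>n. t ^ (n\<^sup>2) * z ^ n) = (\<lambda>n. t powi ((int n)\<^sup>2) * z powi (int n))"
      by (metis of_nat_power power_int_of_nat)
    also have "\<dots> summable_on UNIV \<longleftrightarrow> ?thesis"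
      by (rule summable_on_reindex_bij_betw[of int UNIV "{0..}" "\<lambda>n. t powi (n\<^sup>2) * z powi n"])
         (rule bij_betwI[of _ _ _ nat], auto)
    finally show ?thesis .
  qed
  have "(\<lambda>n::int. t powi (n\<^sup>2) * y powi n) summable_on {..0} \<longleftrightarrow>
        (\<lambda>n::int. t powi (n\<^sup>2) * (1/y) powi n) summable_on {0..}"
    by (rule summable_on_reindex_bij_witness[of _ uminus uminus])
       (auto simp: power_int_minus power_int_one_over field_simps)
  hence "(\<lambda>n::int. t powi (n\<^sup>2) * y powi n) summable_on ({0..} \<union> {..0})"
    using half[of y] half[of "1/y"] assms by (intro summable_on_union) auto
  also have "({0..} \<union> {..0}) = (UNIV :: int set)" by auto
  finally show ?thesis .
qed

lemma abs_summable_gaussian: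
  fixes x z :: complex
  assumes "0 < norm x" "norm x < 1" "z \<noteq> 0"
  shows "(\<lambda>n::int. norm (x powi (n\<^sup>2) * z powi n)) summable_on UNIV"
  using summable_on_gaussian[of "norm x" "norm z"] assms
  by (simp add: norm_mult norm_power_int)

lemma has_sum_exchange:
  fixes f :: "'a \<Rightarrow> 'b \<Rightarrow> complex"
  assumes "(\<lambda>(x, y). norm (f x y)) summable_on A \<times> B"
    and "\<And>x. x \<in> A \<Longrightarrow> (f x has_sum g x) B"
    and "\<And>y. y \<in> B \<Longrightarrow> ((\<lambda>x. f x y) has_sum h y) A"
    and "(h has_sum T) B"
  shows "(g has_sum T) A"
proof -
  have s: "(\<lambda>(x, y). f x y) summable_on A \<times> B"
    by (rule abs_summable_summable) (use assms(1) in \<open>simp add: case_prod_unfold\<close>)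
  hence s': "(\<lambda>(y, x). f x y) summable_on B \<times> A"
    by (subst summable_on_swap) (simp add: case_prod_unfold)
  have "((\<lambda>(y, x). f x y) has_sum T) (B \<times> A)"
    by (rule has_sum_SigmaI[OF _ assms(4) s']) (use assms(3) in simp)
  hence "((\<lambda>(x, y). f x y) has_sum T) (A \<times> B)"
    by (subst has_sum_swap) (simp add: case_prod_unfold)
  thus ?thesis
    by (rule has_sum_SigmaD) (use assms(2) in simp)
qed

lemma has_sum_product:
  fixes f :: "'a \<Rightarrow> complex" and g :: "'b \<Rightarrow> complex"
  assumes "(\<lambda>x. norm (f x)) summable_on A" "(\<lambda>y. norm (g y)) summable_on B"
    and "(f has_sum a) A" "(g has_sum b) B"
  shows "((\<lambda>(x, y). f x * g y) has_sum (a * b)) (A \<times> B)"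
proof (rule has_sum_SigmaI)
  show "((\<lambda>y. case (x, y) of (x, y) \<Rightarrow> f x * g y) has_sum (f x * b)) B" for x
    using has_sum_cmult_right[OF assms(4)] by simp
  show "((\<lambda>x. f x * b) has_sum (a * b)) A"
    by (rule has_sum_cmult_left[OF assms(3)])
  show "(\<lambda>(x, y). f x * g y) summable_on A \<times> B"
    by (rule abs_summable_summable)
       (use abs_summable_product[OF assms(1,2)] in \<open>simp add: case_prod_unfold\<close>)
qed

section \<open>The \<open>q\<close>-binomial theorem and the \<open>\<^sub>1\<phi>\<^sub>1\<close> summation\<close>

text \<open>Both the \<open>q\<close>-binomial theorem (\<open>b = 1\<close>) and Euler's product (\<open>b = 0\<close>) are power series whose coefficients obey
  this first-order recurrence. The recurrence says that the sum \<open>F\<close> satisfies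
  \<open>(1 - b z) F(z) = (1 - a z) F(q z)\<close>; iterating and using \<open>F(q\<^sup>n z) \<longlonglongrightarrow> F(0) = 1\<close> gives the quotient of products.\<close>

lemma q_difference_series:
  fixes c :: "nat \<Rightarrow> complex"
  assumes q: "norm q < 1" and c0: "c 0 = 1"
    and c: "\<And>n. (1 - q ^ Suc n) * c (Suc n) = (b - a * q ^ n) * c n"
    and z: "norm (b * z) < 1"
  shows "summable (\<lambda>n. norm (c n * z ^ n))"
    and "(\<lambda>n. c n * z ^ n) sums (qpoch_inf (a * z) q / qpoch_inf (b * z) q)"
proof -
  have nz: "1 - q ^ Suc n \<noteq> 0" for n
    using mult_power_ne_1[OF q q, of n] by (metis eq_iff_diff_eq_0 power_Suc)
  have step: "c (Suc n) * z ^ Suc n = (b - a * q ^ n) * z / (1 - q ^ Suc n) * (c n * z ^ n)" for n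
  proof -
    have "c (Suc n) = (b - a * q ^ n) * c n / (1 - q ^ Suc n)"
      using c[of n] nz[of n] by (simp add: nonzero_eq_divide_eq mult.commute)
    thus ?thesis by (simp only: power_Suc) (simp add: mult_ac)
  qed
  have "(\<lambda>n. (b - a * q ^ n) * z / (1 - q ^ Suc n)) \<longlonglongrightarrow> (b - a * 0) * z / (1 - 0)"
    using q by (intro tendsto_intros LIMSEQ_power_zero LIMSEQ_Suc[OF LIMSEQ_power_zero]) auto
  hence lim: "(\<lambda>n. norm ((b - a * q ^ n) * z / (1 - q ^ Suc n))) \<longlonglongrightarrow> norm (b * z)"
    using tendsto_norm by fastforce
  obtain r where r: "norm (b * z) < r" "r < 1"
    using z dense by blast
  obtain N where N: "\<And>n. n \<ge> N \<Longrightarrow> norm ((b - a * q ^ n) * z / (1 - q ^ Suc n)) < r"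
    using order_tendstoD(2)[OF lim r(1)] by (auto simp: eventually_at_top_linorder)
  show sm: "summable (\<lambda>n. norm (c n * z ^ n))"
  proof (rule summable_ratio_test[OF r(2)])
    fix n assume "n \<ge> N"
    have "norm (c (Suc n) * z ^ Suc n) \<le> r * norm (c n * z ^ n)"
      unfolding step norm_mult[of "_ / _"]
      using N[OF \<open>n \<ge> N\<close>] by (intro mult_right_mono) auto
    thus "norm (norm (c (Suc n) * z ^ Suc n)) \<le> r * norm (norm (c n * z ^ n))"
      by simp
  qed
  define F where "F = (\<lambda>x. \<Sum>n. c n * x ^ n)"
  have sm': "summable (\<lambda>n. c n * (z * w) ^ n)" if "norm w \<le> 1" for w
  proof (rule summable_norm_cancel, rule summable_comparison_test[OF _ sm])
    have "norm (c n * (z * w) ^ n) \<le> norm (c n * z ^ n)" for n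
    proof -
      have "norm (c n * (z * w) ^ n) = norm (c n * z ^ n) * norm w ^ n"
        by (simp add: norm_mult norm_power power_mult_distrib)
      also have "\<dots> \<le> norm (c n * z ^ n) * 1"
        using that by (intro mult_left_mono power_le_one) auto
      finally show ?thesis by simp
    qed
    thus "\<exists>N. \<forall>n\<ge>N. norm (norm (c n * (z * w) ^ n)) \<le> norm (c n * z ^ n)"
      by simp
  qed
  have feq: "(1 - b * (z * w)) * F (z * w) = (1 - a * (z * w)) * F (z * w * q)" if "norm w \<le> 1" for w
  proof -
    have w': "norm (w * q) \<le> 1"
      using that q by (simp add: norm_mult mult_le_one)
    define x where "x = z * w"
    have s1: "(\<lambda>n. c n * x ^ n) sums F x"
      unfolding F_def x_def using sm'[OF that] by (rule summable_sums)
    have s2: "(\<lambda>n. c n * (x * q) ^ n) sums F (x * q)"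
      unfolding F_def x_def using sm'[OF w'] by (simp add: mult.assoc summable_sums)
    have "(\<lambda>n. c n * x ^ n - c n * (x * q) ^ n) sums (F x - F (x * q))"
      by (intro sums_diff s1 s2)
    hence "(\<lambda>n. c (Suc n) * x ^ Suc n - c (Suc n) * (x * q) ^ Suc n) sums (F x - F (x * q))"
      by (subst sums_Suc_iff) simp
    moreover have "c (Suc n) * x ^ Suc n - c (Suc n) * (x * q) ^ Suc n
        = b * x * (c n * x ^ n) - a * x * (c n * (x * q) ^ n)" for n
    proof -
      have "c (Suc n) * x ^ Suc n - c (Suc n) * (x * q) ^ Suc n = ((1 - q ^ Suc n) * c (Suc n)) * x ^ Suc n"
        by (simp add: algebra_simps power_mult_distrib)
      thus ?thesis unfolding c by (simp add: algebra_simps power_mult_distrib)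
    qed
    ultimately have "(\<lambda>n. b * x * (c n * x ^ n) - a * x * (c n * (x * q) ^ n)) sums (F x - F (x * q))"
      by simp
    moreover have "(\<lambda>n. b * x * (c n * x ^ n) - a * x * (c n * (x * q) ^ n))
        sums (b * x * F x - a * x * F (x * q))"
      by (intro sums_diff sums_mult s1 s2)
    ultimately have "F x - F (x * q) = b * x * F x - a * x * F (x * q)"
      by (rule sums_unique2)
    thus ?thesis
      unfolding x_def by (simp add: algebra_simps)
  qed
  have iter: "qpoch (b * z) q n * F z = qpoch (a * z) q n * F (z * q ^ n)" for n
  proof (induction n)
    case (Suc n)
    have "norm (q ^ n) \<le> 1"
      using q by (simp add: norm_power power_le_one)
    from feq[OF this] have "(1 - b * z * q ^ n) * F (z * q ^ n) = (1 - a * z * q ^ n) * F (z * q ^ Suc n)"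
      by (simp add: mult_ac)
    hence *: "qpoch (a * z) q n * ((1 - b * z * q ^ n) * F (z * q ^ n))
        = qpoch (a * z) q n * ((1 - a * z * q ^ n) * F (z * q ^ Suc n))"
      by simp
    have "qpoch (b * z) q (Suc n) * F z = (1 - b * z * q ^ n) * (qpoch (b * z) q n * F z)"
      by (simp only: qpoch_Suc mult_ac)
    also have "\<dots> = qpoch (a * z) q n * ((1 - b * z * q ^ n) * F (z * q ^ n))"
      unfolding Suc.IH by (simp only: mult_ac)
    also have "\<dots> = qpoch (a * z) q (Suc n) * F (z * q ^ Suc n)"
      unfolding * by (simp only: qpoch_Suc mult_ac)
    finally show ?case .
  qed simp
  have F0: "F 0 = 1"
    unfolding F_def by (simp add: c0)
  have "(\<lambda>n. F (z * q ^ n)) \<longlonglongrightarrow> F 0"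
  proof (cases "z = 0")
    case False
    have "isCont F 0"
      unfolding F_def using sm'[of 1] False by (intro isCont_powser[of _ z]) auto
    moreover have "(\<lambda>n. z * q ^ n) \<longlonglongrightarrow> z * 0"
      using q by (intro tendsto_intros LIMSEQ_power_zero)
    ultimately show ?thesis
      using isCont_tendsto_compose by fastforce
  qed simp
  hence "(\<lambda>n. qpoch (a * z) q n * F (z * q ^ n)) \<longlonglongrightarrow> qpoch_inf (a * z) q * 1"
    unfolding F0 by (intro tendsto_intros tendsto_qpoch q)
  moreover have "(\<lambda>n. qpoch (b * z) q n * F z) \<longlonglongrightarrow> qpoch_inf (b * z) q * F z"
    by (intro tendsto_intros tendsto_qpoch q)
  ultimately have "qpoch_inf (b * z) q * F z = qpoch_inf (a * z) q"
    unfolding iter using LIMSEQ_unique by fastforce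
  hence "F z = qpoch_inf (a * z) q / qpoch_inf (b * z) q"
    using qpoch_inf_nonzero[OF q z] by (simp add: field_simps)
  moreover have "(\<lambda>n. c n * z ^ n) sums F z"
    unfolding F_def using sm'[of 1] by (simp add: summable_sums)
  ultimately show "(\<lambda>n. c n * z ^ n) sums (qpoch_inf (a * z) q / qpoch_inf (b * z) q)"
    by simp
qed

lemma rqfact_Suc:
  assumes "norm Q < 1"
  shows "(1 - Q ^ Suc n) * rqfact Q (int (Suc n)) = rqfact Q (int n)"
  using rqfact_rec[OF assms, of "int (Suc n)"] by (simp only: power_int_of_nat) simp

lemma q_binomial:
  assumes "norm q < 1" "norm z < 1"
  shows "summable (\<lambda>n. norm (qpoch a q n * rqfact q (int n) * z ^ n))"
    and "(\<lambda>n. qpoch a q n * rqfact q (int n) * z ^ n) sums (qpoch_inf (a * z) q / qpoch_inf z q)"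
proof -
  have "(1 - q ^ Suc n) * (qpoch a q (Suc n) * rqfact q (int (Suc n)))
      = (1 - a * q ^ n) * (qpoch a q n * rqfact q (int n))" for n
  proof -
    have "(1 - q ^ Suc n) * (qpoch a q (Suc n) * rqfact q (int (Suc n)))
        = (1 - a * q ^ n) * qpoch a q n * ((1 - q ^ Suc n) * rqfact q (int (Suc n)))"
      by (simp add: qpoch_Suc mult_ac del: of_nat_Suc power_Suc)
    thus ?thesis unfolding rqfact_Suc[OF assms(1)] by (simp add: mult_ac)
  qed
  from q_difference_series[OF assms(1) _ this, of z] assms(2)
  show "summable (\<lambda>n. norm (qpoch a q n * rqfact q (int n) * z ^ n))"
    and "(\<lambda>n. qpoch a q n * rqfact q (int n) * z ^ n) sums (qpoch_inf (a * z) q / qpoch_inf z q)"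
    by simp_all
qed

lemma euler_product_series:
  assumes "norm p < 1"
  shows "summable (\<lambda>n. norm (p ^ (n\<^sup>2) * z ^ n * rqfact (p\<^sup>2) (int n)))"
    and "(\<lambda>n. p ^ (n\<^sup>2) * z ^ n * rqfact (p\<^sup>2) (int n)) sums qpoch_inf (- p * z) (p\<^sup>2)"
proof -
  have Q: "norm (p\<^sup>2) < 1"
    by (rule norm_square_less_1[OF assms])
  have "(1 - (p\<^sup>2) ^ Suc n) * (p ^ ((Suc n)\<^sup>2) * rqfact (p\<^sup>2) (int (Suc n)))
      = (0 - (- p) * (p\<^sup>2) ^ n) * (p ^ (n\<^sup>2) * rqfact (p\<^sup>2) (int n))" for n
  proof -
    have "p ^ ((Suc n)\<^sup>2) = p * (p\<^sup>2) ^ n * p ^ (n\<^sup>2)"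
      by (simp add: power2_eq_square power_add power_mult_distrib mult_ac flip: power_mult)
    hence "(1 - (p\<^sup>2) ^ Suc n) * (p ^ ((Suc n)\<^sup>2) * rqfact (p\<^sup>2) (int (Suc n)))
        = p * (p\<^sup>2) ^ n * p ^ (n\<^sup>2) * ((1 - (p\<^sup>2) ^ Suc n) * rqfact (p\<^sup>2) (int (Suc n)))"
      by (simp add: mult_ac del: of_nat_Suc power_Suc)
    thus ?thesis
      unfolding rqfact_Suc[OF Q] by (simp add: mult_ac)
  qed
  from q_difference_series[OF Q _ this, of z]
  show "summable (\<lambda>n. norm (p ^ (n\<^sup>2) * z ^ n * rqfact (p\<^sup>2) (int n)))"
    and "(\<lambda>n. p ^ (n\<^sup>2) * z ^ n * rqfact (p\<^sup>2) (int n)) sums qpoch_inf (- p * z) (p\<^sup>2)"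
    by (simp_all add: mult_ac)
qed

lemma has_sum_euler:
  assumes "norm p < 1"
  shows "((\<lambda>n. p ^ (n\<^sup>2) * z ^ n * rqfact (p\<^sup>2) (int n)) has_sum qpoch_inf (- p * z) (p\<^sup>2)) UNIV"
  using euler_product_series[OF assms] by (rule norm_summable_imp_has_sum)

text \<open>The \<open>\<^sub>1\<phi>\<^sub>1\<close> summation, with base \<open>p\<^sup>2\<close> so that all powers of \<open>p\<close> are integral. With \<open>b = -p x\<close> the quotient
  \<open>(a)\<^sub>u / (a b)\<^sub>u\<close> is \<open>(a)\<^sub>\<infinity> / (a b)\<^sub>\<infinity>\<close> times \<open>(a b Q\<^sup>u)\<^sub>\<infinity> / (a Q\<^sup>u)\<^sub>\<infinity>\<close>, which the \<open>q\<close>-binomial theorem expands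
  in powers of \<open>a Q\<^sup>u\<close>. After exchanging the sums, the sum over \<open>u\<close> is an Euler product, and the
  remaining sum is again binomial.\<close>

lemma one_phi_one:
  assumes p: "0 < norm p" "norm p < 1" and a: "norm a < 1" and ab: "norm (a * p * x) < 1"
  shows "((\<lambda>u. p ^ (u\<^sup>2) * x ^ u * rqfact (p\<^sup>2) (int u) * (qpoch a (p\<^sup>2) u / qpoch (- a * p * x) (p\<^sup>2) u))
           has_sum (qpoch_inf (- p * x) (p\<^sup>2) / qpoch_inf (- a * p * x) (p\<^sup>2))) UNIV"
proof -
  define Q where "Q = p\<^sup>2"
  define b where "b = - p * x"
  have Q: "norm Q < 1"
    unfolding Q_def by (rule norm_square_less_1[OF p(2)])
  have ab': "norm (a * b) < 1"
    using ab by (simp add: b_def norm_mult mult_ac)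
  have nz: "qpoch a Q u \<noteq> 0" "qpoch (a * b) Q u \<noteq> 0" "qpoch_inf a Q \<noteq> 0" "qpoch_inf (a * b) Q \<noteq> 0" for u
    by (intro qpoch_nonzero qpoch_inf_nonzero Q a ab')+
  define f where "f = (\<lambda>u k. (p ^ (u\<^sup>2) * x ^ u * rqfact Q (int u)) * (qpoch b Q k * rqfact Q (int k) * a ^ k) * Q ^ (u * k))"
  have sum1: "summable (\<lambda>u. norm (p ^ (u\<^sup>2) * x ^ u * rqfact Q (int u)))"
    unfolding Q_def by (rule euler_product_series[OF p(2)])
  have sum2: "summable (\<lambda>k. norm (qpoch b Q k * rqfact Q (int k) * a ^ k))"
    by (rule q_binomial[OF Q a])
  have "(\<lambda>u. qpoch_inf a Q / qpoch_inf (a * b) Q *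
      (qpoch_inf (a * b * Q ^ u) Q / qpoch_inf (a * Q ^ u) Q * (p ^ (u\<^sup>2) * x ^ u * rqfact Q (int u)))) =
      (\<lambda>u. p ^ (u\<^sup>2) * x ^ u * rqfact Q (int u) * (qpoch a Q u / qpoch (a * b) Q u))"
    (is "(\<lambda>u. _ * (?L u * _)) = _")
  proof
    fix u
    have "norm (a * Q ^ u) < 1" "norm (a * b * Q ^ u) < 1"
    proof -
      have "norm (Q ^ u) \<le> 1" using Q by (simp add: norm_power power_le_one)
      thus "norm (a * Q ^ u) < 1" "norm (a * b * Q ^ u) < 1"
        using a ab' unfolding norm_mult[of _ "Q ^ u"]
        by (meson mult_left_le norm_ge_zero order_le_less_trans)+
    qed
    hence "qpoch_inf (a * Q ^ u) Q \<noteq> 0" "qpoch_inf (a * b * Q ^ u) Q \<noteq> 0"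
      by (intro qpoch_inf_nonzero Q; simp)+
    thus "qpoch_inf a Q / qpoch_inf (a * b) Q * (?L u * (p ^ (u\<^sup>2) * x ^ u * rqfact Q (int u))) =
        p ^ (u\<^sup>2) * x ^ u * rqfact Q (int u) * (qpoch a Q u / qpoch (a * b) Q u)"
      using nz qpoch_inf_shift[OF Q, of a u] qpoch_inf_shift[OF Q, of "a * b" u]
      by (simp add: field_simps)
  qed
  moreover have "((\<lambda>u. ?L u * (p ^ (u\<^sup>2) * x ^ u * rqfact Q (int u))) has_sum (qpoch_inf b Q / qpoch_inf a Q)) UNIV"
  proof (rule has_sum_exchange[where f = f and B = UNIV and h = "\<lambda>k. qpoch_inf b Q * (rqfact Q (int k) * a ^ k)"])
    have "(\<lambda>(u, k). norm ((p ^ (u\<^sup>2) * x ^ u * rqfact Q (int u)) * (qpoch b Q k * rqfact Q (int k) * a ^ k)))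
        summable_on UNIV \<times> UNIV"
      using sum1 sum2 by (intro abs_summable_product norm_summable_imp_summable_on) simp_all
    moreover have "norm (f u k) \<le> norm ((p ^ (u\<^sup>2) * x ^ u * rqfact Q (int u)) * (qpoch b Q k * rqfact Q (int k) * a ^ k))" for u k
    proof -
      have "norm (Q ^ (u * k)) \<le> 1" using Q by (simp add: norm_power power_le_one)
      thus ?thesis unfolding f_def norm_mult[of _ "Q ^ (u * k)"] by (simp add: mult_left_le)
    qed
    ultimately show "(\<lambda>(u, k). norm (f u k)) summable_on UNIV \<times> UNIV"
      by - (erule summable_on_comparison_test, auto)
  next
    fix u
    have n: "norm (a * Q ^ u) < 1"
      using mult_left_le[of "norm Q ^ u" "norm a"] a Q
      by (simp add: norm_mult norm_power power_le_one)
    have "((\<lambda>k. qpoch b Q k * rqfact Q (int k) * (a * Q ^ u) ^ k) has_sum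
        (qpoch_inf (b * (a * Q ^ u)) Q / qpoch_inf (a * Q ^ u) Q)) UNIV"
      using q_binomial[OF Q n] by (rule norm_summable_imp_has_sum)
    from has_sum_cmult_left[OF this, of "p ^ (u\<^sup>2) * x ^ u * rqfact Q (int u)"]
    show "(f u has_sum (?L u * (p ^ (u\<^sup>2) * x ^ u * rqfact Q (int u)))) UNIV"
      by (simp add: f_def power_mult_distrib power_mult mult_ac)
  next
    fix k
    have "((\<lambda>u. p ^ (u\<^sup>2) * (x * Q ^ k) ^ u * rqfact Q (int u)) has_sum qpoch_inf (- p * (x * Q ^ k)) Q) UNIV"
      unfolding Q_def by (rule has_sum_euler[OF p(2)])
    from has_sum_cmult_left[OF this, of "qpoch b Q k * rqfact Q (int k) * a ^ k"]
    have "((\<lambda>u. f u k) has_sum (qpoch b Q k * qpoch_inf (b * Q ^ k) Q * (rqfact Q (int k) * a ^ k))) UNIV"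
      by (simp add: f_def power_mult_distrib power_mult[symmetric] mult_ac b_def)
    thus "((\<lambda>u. f u k) has_sum (qpoch_inf b Q * (rqfact Q (int k) * a ^ k))) UNIV"
      using qpoch_inf_shift[OF Q, of b k] by simp
  next
    have "((\<lambda>k. qpoch 0 Q k * rqfact Q (int k) * a ^ k) has_sum (qpoch_inf (0 * a) Q / qpoch_inf a Q)) UNIV"
      using q_binomial[OF Q a] by (rule norm_summable_imp_has_sum)
    from has_sum_cmult_right[OF this, of "qpoch_inf b Q"]
    show "((\<lambda>k. qpoch_inf b Q * (rqfact Q (int k) * a ^ k)) has_sum (qpoch_inf b Q / qpoch_inf a Q)) UNIV"
      by (simp add: qpoch_def)
  qed
  note has_sum_cmult_right[OF this, of "qpoch_inf a Q / qpoch_inf (a * b) Q"]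
  ultimately show ?thesis
    using nz by (simp add: b_def Q_def mult_ac)
qed

section \<open>Durfee rectangles, triple and quintuple products\<close>

lemma powi_mult_eq:
  fixes y :: "'a :: field"
  shows "y \<noteq> 0 \<Longrightarrow> a + b = c \<Longrightarrow> y powi a * y powi b = y powi c"
  by (auto simp: power_int_add)

lemma has_sum_shift_int:
  fixes f :: "int \<Rightarrow> 'a :: {comm_monoid_add, topological_space}"
  shows "((\<lambda>n. f (n + k)) has_sum T) UNIV \<longleftrightarrow> (f has_sum T) UNIV"
  by (rule has_sum_reindex_bij_witness[of _ "\<lambda>n. n - k" "\<lambda>n. n + k"]) auto

lemma has_sum_reflect_int:
  fixes f :: "int \<Rightarrow> 'a :: {comm_monoid_add, topological_space}"
  shows "((\<lambda>n. f (k - n)) has_sum T) UNIV \<longleftrightarrow> (f has_sum T) UNIV"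
  by (rule has_sum_reindex_bij_witness[of _ "\<lambda>n. k - n" "\<lambda>n. k - n"]) auto

text \<open>Durfee's rectangle dissection of \<open>1 / ((Q)\<^sub>A (Q)\<^sub>B)\<close>, proved by induction on \<open>A\<close>: writing
  \<open>1 - Q\<^sup>A = (1 - Q\<^bsup>A-i\<^esup>) + Q\<^bsup>A-i\<^esup> (1 - Q\<^sup>i)\<close> and shifting \<open>i\<close> in the second part leads from \<open>A\<close> to \<open>A - 1\<close>.\<close>

lemma rqfact_durfee:
  assumes Q: "Q \<noteq> 0" "norm Q < 1"
  shows "((\<lambda>i. rqfact Q i * rqfact Q (A - i) * rqfact Q (B - i) * Q powi ((A - i) * (B - i)))
           has_sum rqfact Q A * rqfact Q B) UNIV"
proof -
  define t where "t = (\<lambda>A i. rqfact Q i * rqfact Q (A - i) * rqfact Q (B - i) * Q powi ((A - i) * (B - i)))"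
  have main: "(t (int A) has_sum rqfact Q (int A) * rqfact Q B) UNIV" for A
  proof (induction A)
    case 0
    show ?case
    proof (rule has_sum_finite_neutralI[of "{0}"])
      show "t (int 0) i = 0" if "i \<in> UNIV - {0}" for i
        using that by (cases "i < 0") (auto simp: t_def)
    qed (auto simp: t_def)
  next
    case (Suc A)
    let ?a = "int A + 1"
    have nz: "1 - Q powi ?a \<noteq> 0"
      using mult_power_ne_1[OF Q(2) Q(2), of A]
      by (metis eq_iff_diff_eq_0 of_nat_Suc power_Suc power_int_of_nat add.commute)
    have summ: "g summable_on UNIV" if "\<And>i. i \<notin> {0..?a} \<Longrightarrow> g i = 0" for g :: "int \<Rightarrow> complex"
      by (rule finite_nonzero_values_imp_summable_on) (rule finite_subset[of _ "{0..?a}"], use that in blast, simp)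
    define u where "u = (\<lambda>i. rqfact Q i * rqfact Q (int A - i) * rqfact Q (B - i) * Q powi ((?a - i) * (B - i)))"
    define v where "v = (\<lambda>i. rqfact Q (i - 1) * rqfact Q (?a - i) * rqfact Q (B - i) * Q powi ((?a - i) * (B - i) + (?a - i)))"
    have "u i = 0" "v i = 0" if "i \<notin> {0..?a}" for i
      using that by (auto simp: u_def v_def not_le)
    hence "u summable_on UNIV" "v summable_on UNIV"
      by (blast intro: summ)+
    then obtain U V where U: "(u has_sum U) UNIV" and V: "(v has_sum V) UNIV"
      unfolding summable_on_def by blast
    have uv: "u i + v i = (1 - Q powi ?a) * t ?a i" for i
    proof -
      have "Q powi ?a = Q powi (?a - i) * Q powi i"
        using Q by (simp add: powi_mult_eq)
      moreover have "Q powi ((?a - i) * (B - i) + (?a - i)) = Q powi ((?a - i) * (B - i)) * Q powi (?a - i)"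
        using Q by (simp add: power_int_add)
      moreover have "rqfact Q (int A - i) = (1 - Q powi (?a - i)) * rqfact Q (?a - i)"
        using rqfact_rec[OF Q(2), of "?a - i"] by (simp add: algebra_simps)
      moreover have "rqfact Q (i - 1) = (1 - Q powi i) * rqfact Q i"
        by (rule rqfact_rec[OF Q(2)])
      ultimately show ?thesis
        unfolding u_def v_def t_def by algebra
    qed
    have uv': "u i + v (i + 1) = t (int A) i" for i
    proof -
      have e1: "Q powi ((?a - i) * (B - i)) = Q powi ((int A - i) * (B - i)) * Q powi (B - i)"
        using Q(1) by (rule powi_mult_eq[symmetric]) (simp add: algebra_simps)
      have e2: "(?a - (i + 1)) * (B - (i + 1)) + (?a - (i + 1)) = (int A - i) * (B - i)"
        by (simp add: algebra_simps)
      have e3: "rqfact Q (B - (i + 1)) = (1 - Q powi (B - i)) * rqfact Q (B - i)"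
        using rqfact_rec[OF Q(2), of "B - i"] by (simp add: algebra_simps)
      show ?thesis
        unfolding u_def v_def t_def e1 e2 e3 by (simp add: algebra_simps)
    qed
    have "((\<lambda>i. v (i + 1)) has_sum V) UNIV"
      using V by (simp add: has_sum_shift_int)
    from has_sum_add[OF U this] have "(t (int A) has_sum U + V) UNIV"
      by (simp add: uv')
    hence UV: "U + V = rqfact Q (int A) * rqfact Q B"
      using Suc has_sum_unique by blast
    have "((\<lambda>i. (1 - Q powi ?a) * t ?a i) has_sum U + V) UNIV"
      using has_sum_add[OF U V] by (simp add: uv)
    hence "(t ?a has_sum (U + V) / (1 - Q powi ?a)) UNIV"
      using nz by (subst (asm) has_sum_cmult_right_iff) auto
    moreover have "rqfact Q (int A) = (1 - Q powi ?a) * rqfact Q ?a"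
      using rqfact_rec[OF Q(2), of ?a] by simp
    ultimately show ?case
      using nz by (simp add: UV add.commute)
  qed
  show ?thesis
  proof (cases "A < 0")
    case True
    have "rqfact Q i * rqfact Q (A - i) = 0" for i
      using True by (cases "i < 0") auto
    hence "rqfact Q i * rqfact Q (A - i) * rqfact Q (B - i) * Q powi ((A - i) * (B - i)) = 0" for i
      by simp
    thus ?thesis using True by (simp only: has_sum_0_simp rqfact_neg mult_zero_left)
  next
    case False
    thus ?thesis using main[of "nat A"] by (simp add: t_def)
  qed
qed

text \<open>The limit \<open>A \<longlonglongrightarrow> \<infinity>\<close> of \<open>rqfact_durfee\<close> with \<open>B = A + d\<close>, after the substitution \<open>i = A - j\<close>; Tannery's theorem
  justifies taking the limit inside the sum.\<close>

lemma rqfact_cauchy: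
  assumes Q: "Q \<noteq> 0" "norm Q < 1"
  shows "((\<lambda>j. rqfact Q j * rqfact Q (j + d) * Q powi (j * (j + d))) has_sum inverse (qpoch_inf Q Q)) UNIV"
proof -
  obtain C where C: "C > 0" "\<And>k. norm (rqfact Q k) \<le> C"
    using rqfact_bounded[OF Q(2)] by blast
  define g where "g = (\<lambda>j::nat. rqfact Q (int j) * rqfact Q (int j + d) * Q powi (int j * (int j + d)))"
  define M where "M = (\<lambda>j::nat. C ^ 2 * (norm Q ^ (j\<^sup>2) * (norm Q powi d) ^ j))"
  have sM: "summable M" "summable (\<lambda>j. C * M j)"
    unfolding M_def using Q by (intro summable_mult summable_gaussian_nat; simp)+
  have gM: "norm (g j) \<le> M j" for j
  proof -
    have "norm (Q powi (int j * (int j + d))) = norm Q ^ (j\<^sup>2) * (norm Q powi d) ^ j"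
    proof -
      have "norm Q powi (int j * (int j + d)) = norm Q powi (int (j\<^sup>2)) * norm Q powi (d * int j)"
        using Q(1) by (subst powi_mult_eq) (auto simp: power2_eq_square algebra_simps)
      thus ?thesis by (simp only: norm_power_int power_int_of_nat power_int_power')
    qed
    moreover have "norm (rqfact Q (int j)) * norm (rqfact Q (int j + d)) \<le> C * C"
      using C by (intro mult_mono) auto
    ultimately show ?thesis
      unfolding g_def M_def norm_mult power2_eq_square[of C] using Q by (simp add: mult_right_mono)
  qed
  have "((\<lambda>A. \<Sum>j. rqfact Q (int A - int j) * g j) \<longlonglongrightarrow> (\<Sum>j. inverse (qpoch_inf Q Q) * g j))"
  proof (rule tannerys_theorem[THEN conjunct2, THEN conjunct2])
    fix j :: nat
    have "(\<lambda>A. rqfact Q (int (A + j) - int j)) \<longlonglongrightarrow> inverse (qpoch_inf Q Q)"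
      using tendsto_rqfact[OF Q(2)] by simp
    hence "(\<lambda>A. rqfact Q (int A - int j)) \<longlonglongrightarrow> inverse (qpoch_inf Q Q)"
      by (rule LIMSEQ_offset)
    thus "(\<lambda>A. rqfact Q (int A - int j) * g j) \<longlonglongrightarrow> inverse (qpoch_inf Q Q) * g j"
      by (intro tendsto_intros)
  next
    show "\<forall>\<^sub>F (k, n) in at_top \<times>\<^sub>F sequentially. norm (rqfact Q (int n - int k) * g k) \<le> C * M k"
      using C gM by (intro always_eventually) (auto simp: norm_mult intro!: mult_mono)
  qed (use sM in auto)
  moreover have "(\<Sum>j. rqfact Q (int A - int j) * g j) = rqfact Q (int A) * rqfact Q (int A + d)" for A
  proof -
    have "((\<lambda>i. rqfact Q i * rqfact Q (int A - i) * rqfact Q (int A + d - i) * Q powi ((int A - i) * (int A + d - i)))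
            has_sum rqfact Q (int A) * rqfact Q (int A + d)) UNIV"
      by (rule rqfact_durfee[OF Q])
    hence *: "((\<lambda>j. rqfact Q (int A - j) * (rqfact Q j * rqfact Q (j + d) * Q powi (j * (j + d))))
            has_sum rqfact Q (int A) * rqfact Q (int A + d)) UNIV"
      by (subst (asm) has_sum_reflect_int[of _ "int A", symmetric]) (simp add: algebra_simps)
    have "((\<lambda>j. rqfact Q (int A - int j) * g j) has_sum rqfact Q (int A) * rqfact Q (int A + d)) UNIV
       \<longleftrightarrow> ((\<lambda>j. rqfact Q (int A - j) * (rqfact Q j * rqfact Q (j + d) * Q powi (j * (j + d))))
            has_sum rqfact Q (int A) * rqfact Q (int A + d)) {0..}"
      unfolding g_def
      by (rule has_sum_reindex_bij_witness[of _ nat int]) auto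
    also have "\<dots> \<longleftrightarrow> ((\<lambda>j. rqfact Q (int A - j) * (rqfact Q j * rqfact Q (j + d) * Q powi (j * (j + d))))
            has_sum rqfact Q (int A) * rqfact Q (int A + d)) UNIV"
      by (rule has_sum_cong_neutral) auto
    finally show ?thesis
      using * has_sum_imp_sums sums_unique by metis
  qed
  moreover have "(\<lambda>A. rqfact Q (int A) * rqfact Q (int A + d)) \<longlonglongrightarrow> inverse (qpoch_inf Q Q) * inverse (qpoch_inf Q Q)"
  proof (intro tendsto_mult tendsto_rqfact Q)
    have "(\<lambda>A. rqfact Q (int (A + nat (-d)) + d)) \<longlonglongrightarrow> inverse (qpoch_inf Q Q)"
    proof (cases "d \<ge> 0")
      case True
      have "(\<lambda>A. rqfact Q (int (A + nat d))) \<longlonglongrightarrow> inverse (qpoch_inf Q Q)"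
        using tendsto_rqfact[OF Q(2)] by (rule LIMSEQ_ignore_initial_segment)
      thus ?thesis using True by simp
    next
      case False
      thus ?thesis using tendsto_rqfact[OF Q(2)] by simp
    qed
    thus "(\<lambda>A. rqfact Q (int A + d)) \<longlonglongrightarrow> inverse (qpoch_inf Q Q)"
      by (rule LIMSEQ_offset)
  qed
  ultimately have *: "(\<Sum>j. inverse (qpoch_inf Q Q) * g j) = inverse (qpoch_inf Q Q) * inverse (qpoch_inf Q Q)"
    using LIMSEQ_unique by auto
  have sg: "summable (\<lambda>j. norm (g j))"
    by (rule summable_comparison_test[OF _ sM(1)]) (use gM in auto)
  have "suminf g = inverse (qpoch_inf Q Q)"
    using * qpoch_inf_nonzero[OF Q(2) Q(2)] suminf_mult[OF summable_norm_cancel[OF sg]] by simp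
  hence "(g has_sum inverse (qpoch_inf Q Q)) UNIV"
    using norm_summable_imp_has_sum[OF sg] summable_sums[OF summable_norm_cancel[OF sg]] by simp
  thus ?thesis
    unfolding g_def by (rule has_sum_int_from_nat) auto
qed

lemma has_sum_euler_int:
  assumes "norm p < 1" "p \<noteq> 0"
  shows "((\<lambda>n. p powi (n\<^sup>2) * z powi n * rqfact (p\<^sup>2) n) has_sum qpoch_inf (- p * z) (p\<^sup>2)) UNIV"
    and "(\<lambda>n. norm (p powi (n\<^sup>2) * z powi n * rqfact (p\<^sup>2) n)) summable_on UNIV"
proof -
  have "((\<lambda>n. p powi ((int n)\<^sup>2) * z powi (int n) * rqfact (p\<^sup>2) (int n)) has_sum qpoch_inf (- p * z) (p\<^sup>2)) UNIV"
    using has_sum_euler[OF assms(1), of z] by (simp flip: of_nat_power)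
  thus "((\<lambda>n. p powi (n\<^sup>2) * z powi n * rqfact (p\<^sup>2) n) has_sum qpoch_inf (- p * z) (p\<^sup>2)) UNIV"
    by (rule has_sum_int_from_nat) auto
  have "((\<lambda>n. norm (p powi ((int n)\<^sup>2) * z powi (int n) * rqfact (p\<^sup>2) (int n))) has_sum
      (\<Sum>n. norm (p ^ (n\<^sup>2) * z ^ n * rqfact (p\<^sup>2) (int n)))) UNIV"
    using euler_product_series(1)[OF assms(1), of z]
    by (intro norm_summable_imp_has_sum) (auto simp flip: of_nat_power simp: summable_sums)
  from has_sum_int_from_nat[OF this]
  show "(\<lambda>n. norm (p powi (n\<^sup>2) * z powi n * rqfact (p\<^sup>2) n)) summable_on UNIV"
    by (auto simp: summable_on_def)
qed

text \<open>Euler's series for \<open>(-y z; y\<^sup>2)\<^sub>\<infinity>\<close> and \<open>(-y / z; y\<^sup>2)\<^sub>\<infinity>\<close> are multiplied, and the terms with the same power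
  \<open>z\<^sup>d\<close> are collected by Cauchy's identity.\<close>

theorem jacobi_triple_product:
  assumes y: "0 < norm y" "norm y < 1" and z: "z \<noteq> 0"
  shows "((\<lambda>n::int. y powi (n\<^sup>2) * z powi n) has_sum
           (qpoch_inf (- y * z) (y\<^sup>2) * qpoch_inf (- y / z) (y\<^sup>2) * qpoch_inf (y\<^sup>2) (y\<^sup>2))) UNIV"
proof -
  have y0: "y \<noteq> 0" using y by auto
  have Q: "y\<^sup>2 \<noteq> 0" "norm (y\<^sup>2) < 1"
    using y norm_square_less_1 by auto
  let ?P = "qpoch_inf (- y * z) (y\<^sup>2) * qpoch_inf (- y / z) (y\<^sup>2)"
  define f where "f = (\<lambda>z n. y powi (n\<^sup>2) * z powi n * rqfact (y\<^sup>2) n)"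
  have "((\<lambda>(i, j). f z i * f (1 / z) j) has_sum ?P) (UNIV \<times> UNIV)"
    using has_sum_euler_int[OF y(2) y0, of z] has_sum_euler_int[OF y(2) y0, of "1 / z"]
    unfolding f_def by (intro has_sum_product) auto
  also have "?this \<longleftrightarrow> ((\<lambda>(d, j). f z (j + d) * f (1 / z) j) has_sum ?P) (UNIV \<times> UNIV)"
    by (rule has_sum_reindex_bij_witness[of _ "\<lambda>(d, j). (j + d, j)" "\<lambda>(i, j). (i - j, j)"]) auto
  finally have *: "((\<lambda>(d, j). f z (j + d) * f (1 / z) j) has_sum ?P) (UNIV \<times> UNIV)" .
  have "((\<lambda>d. y powi (d\<^sup>2) * z powi d * inverse (qpoch_inf (y\<^sup>2) (y\<^sup>2))) has_sum ?P) UNIV"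
  proof (rule has_sum_SigmaD[OF *])
    fix d :: int
    have "f z (j + d) * f (1 / z) j =
       y powi (d\<^sup>2) * z powi d * (rqfact (y\<^sup>2) j * rqfact (y\<^sup>2) (j + d) * (y\<^sup>2) powi (j * (j + d)))" for j
    proof -
      have "y powi ((j + d)\<^sup>2) * y powi (j\<^sup>2) = y powi (d\<^sup>2) * (y\<^sup>2) powi (j * (j + d))"
        unfolding power_int_power using y0
        by (subst (1 2) powi_mult_eq) (auto simp: power2_eq_square algebra_simps)
      moreover have "z powi (j + d) * (1 / z) powi j = z powi d"
        using z by (simp add: power_int_add power_int_one_over)
      ultimately show ?thesis
        unfolding f_def by algebra
    qed
    thus "((\<lambda>j. case (d, j) of (d, j) \<Rightarrow> f z (j + d) * f (1 / z) j) has_sum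
       y powi (d\<^sup>2) * z powi d * inverse (qpoch_inf (y\<^sup>2) (y\<^sup>2))) UNIV"
      using has_sum_cmult_right[OF rqfact_cauchy[OF Q]] by simp
  qed
  from has_sum_cmult_left[OF this, of "qpoch_inf (y\<^sup>2) (y\<^sup>2)"] show ?thesis
    using qpoch_inf_nonzero[OF Q(2) Q(2)] by (simp add: mult.assoc)
qed

lemma minus_one_powi: "(-1 :: 'a :: field) powi n = (if even n then 1 else -1)"
  by (cases n rule: int_cases4) (auto simp: power_int_minus)

lemma minus_powi: "(- x :: 'a :: field) powi n = (-1) powi n * x powi n"
  by (metis mult_minus1 power_int_mult_distrib)

lemma qpoch_inf_split3:
  assumes "norm q < 1"
  shows "qpoch_inf a q = qpoch_inf a (q ^ 3) * qpoch_inf (a * q) (q ^ 3) * qpoch_inf (a * q\<^sup>2) (q ^ 3)"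
proof -
  have q3: "norm (q ^ 3) < 1"
    using assms by (simp add: norm_power power_less_one_iff)
  have "qpoch a q (3 * n) = qpoch a (q ^ 3) n * qpoch (a * q) (q ^ 3) n * qpoch (a * q\<^sup>2) (q ^ 3) n" for n
  proof (induction n)
    case (Suc n)
    have "3 * Suc n = Suc (Suc (Suc (3 * n)))" by simp
    thus ?case
      by (simp only: qpoch_Suc Suc) (simp add: power_mult[symmetric] power2_eq_square mult_ac)
  qed simp
  moreover have "(\<lambda>n. qpoch a q (3 * n)) \<longlonglongrightarrow> qpoch_inf a q"
    by (rule filterlim_compose[OF tendsto_qpoch[OF assms]])
       (auto intro!: filterlim_subseq simp: strict_mono_def)
  moreover have "(\<lambda>n. qpoch a (q ^ 3) n * qpoch (a * q) (q ^ 3) n * qpoch (a * q\<^sup>2) (q ^ 3) n)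
      \<longlonglongrightarrow> qpoch_inf a (q ^ 3) * qpoch_inf (a * q) (q ^ 3) * qpoch_inf (a * q\<^sup>2) (q ^ 3)"
    by (intro tendsto_intros tendsto_qpoch q3)
  ultimately show ?thesis
    using LIMSEQ_unique by auto
qed

text \<open>Euler's pentagonal number theorem in base \<open>y\<^sup>4\<close>; the base is the one in which it enters the proof of the
  quintuple product identity.\<close>

lemma pentagonal_number_series:
  assumes y: "0 < norm y" "norm y < 1"
  shows "((\<lambda>m::int. (-1) powi m * y powi (6 * m\<^sup>2 - 2 * m)) has_sum qpoch_inf (y ^ 4) (y ^ 4)) UNIV"
proof -
  have y0: "y \<noteq> 0" using y by auto
  have n: "0 < norm (y ^ 6)" "norm (y ^ 6) < 1" "- (y powi (-2)) \<noteq> 0" "norm (y ^ 4) < 1"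
    using y by (auto simp: norm_power power_less_one_iff)
  have "((\<lambda>m::int. (y ^ 6) powi (m\<^sup>2) * (- (y powi (-2))) powi m) has_sum
           (qpoch_inf (y ^ 4) (y ^ 12) * qpoch_inf (y ^ 8) (y ^ 12) * qpoch_inf (y ^ 12) (y ^ 12))) UNIV"
  proof -
    have "y ^ 6 * y powi (-2) = y ^ 4" "y ^ 6 / (y powi (-2)) = y ^ 8"
      using y0 by (simp_all add: power_int_minus field_simps flip: power_add)
    thus ?thesis
      using jacobi_triple_product[OF n(1,2,3)] by (simp add: flip: power_mult)
  qed
  also have "qpoch_inf (y ^ 4) (y ^ 12) * qpoch_inf (y ^ 8) (y ^ 12) * qpoch_inf (y ^ 12) (y ^ 12)
      = qpoch_inf (y ^ 4) (y ^ 4)"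
    using qpoch_inf_split3[OF n(4), of "y ^ 4"] by (simp flip: power_mult power_add)
  also have "(\<lambda>m::int. (y ^ 6) powi (m\<^sup>2) * (- (y powi (-2))) powi m) =
      (\<lambda>m::int. (-1) powi m * y powi (6 * m\<^sup>2 - 2 * m))"
  proof
    fix m :: int
    have "y powi (6 * m\<^sup>2 - 2 * m) = (y ^ 6) powi (m\<^sup>2) * (y powi (-2)) powi m"
      using y0 by (simp add: power_int_power power_int_add power_int_diff power_int_minus
          power_int_inverse field_simps)
    thus "(y ^ 6) powi (m\<^sup>2) * (- (y powi (-2))) powi m = (-1) powi m * y powi (6 * m\<^sup>2 - 2 * m)"
      by (simp add: minus_powi[of "y powi (-2)"])
  qed
  finally show ?thesis .
qed

text \<open>The third residue class is enumerated as \<open>-3 t - 1\<close> because its terms then pair with those at \<open>3 t\<close> in the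
  quintuple product.\<close>

lemma has_sum_int_mod_3:
  fixes g :: "int \<Rightarrow> complex"
  assumes "(g has_sum T) UNIV"
  shows "((\<lambda>t. g (3 * t) + g (3 * t + 1) + g (- 3 * t - 1)) has_sum T) UNIV"
proof -
  define e where "e = (\<lambda>(t, b::nat). if b = 0 then 3 * t else if b = 1 then 3 * t + 1 else - 3 * t - 1 :: int)"
  have "bij_betw e (UNIV \<times> {..<3}) UNIV"
  proof (rule bij_betwI')
    show "e x = e y \<longleftrightarrow> x = y" if "x \<in> UNIV \<times> {..<3}" "y \<in> UNIV \<times> {..<3}" for x y
      using that by (auto simp: e_def split: if_splits) presburger+
    show "\<exists>x\<in>UNIV \<times> {..<3}. N = e x" for N
    proof -
      consider "N mod 3 = 0" | "N mod 3 = 1" | "N mod 3 = 2" by linarith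
      thus ?thesis
      proof cases
        case 1
        thus ?thesis by (intro bexI[of _ "(N div 3, 0)"]) (auto simp: e_def)
      next
        case 2
        thus ?thesis by (intro bexI[of _ "(N div 3, 1)"]) (auto simp: e_def, presburger)
      next
        case 3
        thus ?thesis by (intro bexI[of _ "(- (N div 3) - 1, 2)"]) (auto simp: e_def, presburger)
      qed
    qed
  qed auto
  from has_sum_reindex_bij_betw[OF this, of g T] assms
  have "((\<lambda>x. g (e x)) has_sum T) (UNIV \<times> {..<3})" by simp
  thus ?thesis
  proof (rule has_sum_SigmaD)
    fix t
    show "((\<lambda>b. g (e (t, b))) has_sum g (3 * t) + g (3 * t + 1) + g (- 3 * t - 1)) {..<3}"
      by (rule has_sum_finiteI) (auto simp: e_def eval_nat_numeral lessThan_Suc)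
  qed
qed

text \<open>Multiply the triple product series for the first three factors by the one for the last two (completed by
  \<open>(y\<^sup>4; y\<^sup>4)\<^sub>\<infinity>\<close>), and collect the coefficient \<open>G N\<close> of \<open>z\<^bsup>-N\<^esup>\<close>. Completing the square in the inner sum shows that for
  \<open>N = 3 t\<close> and \<open>N = -3 t - 1\<close> it is, up to sign, \<open>y\<^bsup>3t\<^sup>2+t\<^esup>\<close> times the pentagonal number series, and for \<open>N = 3 t + 1\<close>
  a reflection changes the sign of every term, so that \<open>G N = 0\<close>. Finally cancel \<open>(y\<^sup>4; y\<^sup>4)\<^sub>\<infinity>\<close>.\<close>

theorem quintuple_product:
  assumes y: "0 < norm y" "norm y < 1" and z: "z \<noteq> 0"
  shows "((\<lambda>n::int. y powi (3 * n\<^sup>2 + n) * (z powi (- 3 * n) - z powi (3 * n + 1))) has_sum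
           (qpoch_inf z (y\<^sup>2) * qpoch_inf (y\<^sup>2 / z) (y\<^sup>2) * qpoch_inf (y\<^sup>2) (y\<^sup>2)
            * (qpoch_inf (y\<^sup>2 * z\<^sup>2) (y ^ 4) * qpoch_inf (y\<^sup>2 / z\<^sup>2) (y ^ 4)))) UNIV"
    (is "(?q has_sum ?P1 * ?P2) UNIV")
proof -
  have y0: "y \<noteq> 0" using y by auto
  have n: "0 < norm (y\<^sup>2)" "norm (y\<^sup>2) < 1" "norm (y ^ 4) < 1"
    using y by (auto simp: norm_power power_less_one_iff)
  define f1 where "f1 = (\<lambda>n::int. y powi (n\<^sup>2) * (- y / z) powi n)"
  define f2 where "f2 = (\<lambda>m::int. (y\<^sup>2) powi (m\<^sup>2) * (- 1 / z\<^sup>2) powi m)"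
  define E where "E = qpoch_inf (y ^ 4) (y ^ 4)"
  have E: "E \<noteq> 0"
    unfolding E_def by (intro qpoch_inf_nonzero n)
  have f1: "(f1 has_sum ?P1) UNIV" "(\<lambda>n. norm (f1 n)) summable_on UNIV"
  proof -
    have nz: "- y / z \<noteq> 0" using y0 z by simp
    have "- y * (- y / z) = y\<^sup>2 / z" "- y / (- y / z) = z"
      using y0 z by (simp_all add: power2_eq_square)
    thus "(f1 has_sum ?P1) UNIV"
      unfolding f1_def using jacobi_triple_product[OF y nz] by (simp only: mult_ac)
    show "(\<lambda>n. norm (f1 n)) summable_on UNIV"
      unfolding f1_def by (rule abs_summable_gaussian[OF y nz])
  qed
  have f2: "(f2 has_sum ?P2 * E) UNIV" "(\<lambda>n. norm (f2 n)) summable_on UNIV"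
  proof -
    have nz: "- 1 / z\<^sup>2 \<noteq> 0" using z by simp
    have "- (y\<^sup>2) * (- 1 / z\<^sup>2) = y\<^sup>2 / z\<^sup>2" "- (y\<^sup>2) / (- 1 / z\<^sup>2) = y\<^sup>2 * z\<^sup>2" "(y\<^sup>2)\<^sup>2 = y ^ 4"
      using y0 z by (simp_all flip: power_mult)
    thus "(f2 has_sum ?P2 * E) UNIV"
      unfolding f2_def E_def using jacobi_triple_product[OF n(1,2) nz] by (simp add: mult_ac)
    show "(\<lambda>n. norm (f2 n)) summable_on UNIV"
      unfolding f2_def by (rule abs_summable_gaussian[OF n(1,2) nz])
  qed
  have "((\<lambda>(n, m). f1 n * f2 m) has_sum (?P1 * (?P2 * E))) (UNIV \<times> UNIV)"
    by (intro has_sum_product f1 f2)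
  also have "?this \<longleftrightarrow> ((\<lambda>(N, m). f1 (N - 2 * m) * f2 m) has_sum (?P1 * (?P2 * E))) (UNIV \<times> UNIV)"
    by (rule has_sum_reindex_bij_witness[of _ "\<lambda>(N, m). (N - 2 * m, m)" "\<lambda>(n, m). (n + 2 * m, m)"]) auto
  finally have *: "((\<lambda>(N, m). f1 (N - 2 * m) * f2 m) has_sum (?P1 * (?P2 * E))) (UNIV \<times> UNIV)" .
  define I where "I = (\<lambda>N m::int. (-1) powi (N + m) * y powi (6 * m\<^sup>2 - (4 * N + 2) * m + N\<^sup>2 + N) :: complex)"
  have f12: "f1 (N - 2 * m) * f2 m = z powi (- N) * I N m" for N m
  proof -
    have "y powi (6 * m\<^sup>2 - (4 * N + 2) * m + N\<^sup>2 + N) = y powi ((N - 2 * m)\<^sup>2) * y powi (N - 2 * m) * y powi (2 * m\<^sup>2)"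
      using y0 by (simp add: power_int_add[symmetric]) (simp add: power2_eq_square algebra_simps)
    moreover have "(- y / z) powi (N - 2 * m) = (-1) powi N * y powi (N - 2 * m) * z powi (- N) * z powi (2 * m)"
      using z by (simp add: minus_powi[of "y / z", simplified] power_int_divide_distrib power_int_diff
          power_int_minus minus_one_powi field_simps)
    moreover have "(- 1 / z\<^sup>2) powi m = (-1) powi m / z powi (2 * m)"
      using minus_powi[of "1 / z\<^sup>2" m] by (simp add: power_int_divide_distrib power_int_power)
    moreover have "(-1 :: complex) powi (N + m) = (-1) powi N * (-1) powi m"
      by (simp add: power_int_add)
    moreover have "(y\<^sup>2) powi (m\<^sup>2) = y powi (2 * m\<^sup>2)"
      by (simp add: power_int_power)
    ultimately show ?thesis
      unfolding f1_def f2_def I_def using z by (simp add: field_simps)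
  qed
  have I: "\<exists>T. (I N has_sum T) UNIV" for N
  proof -
    have "(\<lambda>(N, m). f1 (N - 2 * m) * f2 m) summable_on (UNIV \<times> UNIV)"
      using * by (auto simp: summable_on_def)
    hence "(\<lambda>m. z powi (- N) * I N m) summable_on UNIV"
      using summable_on_SigmaD1[of "\<lambda>N m. f1 (N - 2 * m) * f2 m" UNIV "\<lambda>_. UNIV" N] by (simp add: f12)
    thus ?thesis
      using z by (subst (asm) summable_on_cmult_right') (auto simp: summable_on_def)
  qed
  define G where "G = (\<lambda>N. infsum (I N) UNIV)"
  have G: "(I N has_sum G N) UNIV" for N
    using I[of N] unfolding G_def by (auto simp: has_sum_infsum summable_on_def)
  have "((\<lambda>N. z powi (- N) * G N) has_sum (?P1 * (?P2 * E))) UNIV"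
    by (rule has_sum_SigmaD[OF *]) (use has_sum_cmult_right[OF G] in \<open>simp add: f12\<close>)
  from has_sum_int_mod_3[OF this]
  have "((\<lambda>t. z powi (- (3 * t)) * G (3 * t) + z powi (- (3 * t + 1)) * G (3 * t + 1)
           + z powi (- (- 3 * t - 1)) * G (- 3 * t - 1)) has_sum (?P1 * (?P2 * E))) UNIV"
    by simp
  moreover have "G (3 * t) = y powi (3 * t\<^sup>2 + t) * E" for t
  proof -
    have "I (3 * t) (m + t) = y powi (3 * t\<^sup>2 + t) * ((-1) powi m * y powi (6 * m\<^sup>2 - 2 * m))" for m
    proof -
      have "y powi (3 * t\<^sup>2 + t) * y powi (6 * m\<^sup>2 - 2 * m)
          = y powi (6 * (m + t)\<^sup>2 - (4 * (3 * t) + 2) * (m + t) + (3 * t)\<^sup>2 + 3 * t)"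
        using y0 by (rule powi_mult_eq) (simp add: power2_eq_square algebra_simps)
      thus ?thesis
        unfolding I_def by (simp add: minus_one_powi)
    qed
    hence "((\<lambda>m. I (3 * t) (m + t)) has_sum y powi (3 * t\<^sup>2 + t) * E) UNIV"
      unfolding E_def using has_sum_cmult_right[OF pentagonal_number_series[OF y]] by simp
    thus ?thesis
      using has_sum_unique[OF G] has_sum_shift_int[of "I (3 * t)" t] by simp
  qed
  moreover have "G (- 3 * t - 1) = - (y powi (3 * t\<^sup>2 + t) * E)" for t
  proof -
    have "I (- 3 * t - 1) (- t - m) = - (y powi (3 * t\<^sup>2 + t)) * ((-1) powi m * y powi (6 * m\<^sup>2 - 2 * m))" for m
    proof -
      have "y powi (3 * t\<^sup>2 + t) * y powi (6 * m\<^sup>2 - 2 * m)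
          = y powi (6 * (- t - m)\<^sup>2 - (4 * (- 3 * t - 1) + 2) * (- t - m) + (- 3 * t - 1)\<^sup>2 + (- 3 * t - 1))"
        using y0 by (rule powi_mult_eq) (simp add: power2_eq_square algebra_simps)
      thus ?thesis
        unfolding I_def by (simp add: minus_one_powi)
    qed
    hence "((\<lambda>m. I (- 3 * t - 1) (- t - m)) has_sum - (y powi (3 * t\<^sup>2 + t)) * E) UNIV"
      unfolding E_def by (simp only:) (rule has_sum_cmult_right[OF pentagonal_number_series[OF y]])
    thus ?thesis
      using has_sum_unique[OF G] has_sum_reflect_int[of "I (- 3 * t - 1)" "- t"] by simp
  qed
  moreover have "G (3 * t + 1) = 0" for t
  proof -
    have "I (3 * t + 1) (2 * t + 1 - m) = - I (3 * t + 1) m" for m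
    proof -
      have "6 * (2 * t + 1 - m)\<^sup>2 - (4 * (3 * t + 1) + 2) * (2 * t + 1 - m) = 6 * m\<^sup>2 - (4 * (3 * t + 1) + 2) * m"
        by (simp add: power2_eq_square algebra_simps)
      thus ?thesis
        unfolding I_def by (simp add: minus_one_powi)
    qed
    hence "(I (3 * t + 1) has_sum - G (3 * t + 1)) UNIV"
      using has_sum_uminusI[OF G[of "3 * t + 1"]] has_sum_reflect_int[of "I (3 * t + 1)" "2 * t + 1"] by simp
    thus ?thesis
      using has_sum_unique[OF G[of "3 * t + 1"], of "- G (3 * t + 1)"] by simp
  qed
  ultimately have "((\<lambda>t. ?q t * E) has_sum (?P1 * ?P2 * E)) UNIV"
    by (simp add: algebra_simps)
  thus ?thesis
    using E by (subst (asm) has_sum_cmult_left_iff) auto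
qed

section \<open>Bailey pairs\<close>

text \<open>The conjugate Bailey pair. For \<open>s \<ge> 0\<close> the sum starts at \<open>n = s\<close>; shifting the index turns it into
  \<open>one_phi_one\<close> with \<open>a = -p\<^bsup>1+d+2s\<^esup>\<close> and \<open>x = p\<^bsup>d+2s\<^esup>\<close>. The reflection \<open>s \<mapsto> -s - d\<close> leaves both sides unchanged and
  covers negative \<open>s\<close>. The parameter \<open>d\<close> is the parity of the sum \<open>2 n + d\<close> of the two indices.\<close>

lemma has_sum_conjugate_bailey:
  fixes d :: nat
  assumes p: "0 < norm p" "norm p < 1" and d: "d \<le> 1"
  shows "((\<lambda>n. p ^ (n\<^sup>2 + d * n) * qpoch (- (p ^ (1 + d))) (p\<^sup>2) n
             * (rqfact (p\<^sup>2) (int n - s) * rqfact (p\<^sup>2) (int n + s + int d)))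
          has_sum (p powi (s\<^sup>2 + int d * s) * (qpoch_inf (- (p ^ (1 + d))) (p\<^sup>2) / qpoch_inf (p\<^sup>2) (p\<^sup>2)))) UNIV"
    (is "(?t s has_sum ?v s) UNIV")
proof -
  define Q where "Q = p\<^sup>2"
  have p0: "p \<noteq> 0" using p by auto
  have Q: "norm Q < 1" unfolding Q_def by (rule norm_square_less_1[OF p(2)])
  have small: "norm (p ^ Suc m) < 1" "norm (Q ^ Suc m) < 1" for m
    using p Q by (simp_all only: norm_power power_less_one_iff norm_ge_zero) auto
  have nat_case: "(?t (int k) has_sum ?v (int k)) UNIV" for k
  proof -
    define m where "m = d + 2 * k"
    define x where "x = p ^ m"
    define a where "a = - (p ^ Suc m)"
    have ab: "- a * p * x = Q ^ Suc m" "- p * x = a"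
      by (simp_all add: a_def x_def Q_def power_mult_distrib power2_eq_square flip: power_mult)
    have na: "norm a < 1" "norm (a * p * x) < 1"
    proof -
      show "norm a < 1" using small(1)[of m] by (simp add: a_def)
      have "norm (a * p * x) = norm (Q ^ Suc m)"
        unfolding ab(1)[symmetric] by (simp add: norm_mult)
      thus "norm (a * p * x) < 1" using small(2)[of m] by simp
    qed
    have nz: "qpoch Q Q m \<noteq> 0" "qpoch (Q ^ Suc m) Q u \<noteq> 0" "qpoch_inf (Q ^ Suc m) Q \<noteq> 0" for u
      by (intro qpoch_nonzero qpoch_inf_nonzero Q small)+
    define c where "c = p ^ (k\<^sup>2 + d * k) * qpoch (- (p ^ (1 + d))) Q k * rqfact Q (int m)"
    have "((\<lambda>u. c * (p ^ (u\<^sup>2) * x ^ u * rqfact Q (int u) * (qpoch a Q u / qpoch (Q ^ Suc m) Q u)))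
        has_sum (c * (qpoch_inf a Q / qpoch_inf (Q ^ Suc m) Q))) UNIV"
      using has_sum_cmult_right[OF one_phi_one[OF p na], of c] unfolding ab by (simp add: Q_def)
    also have "c * (qpoch_inf a Q / qpoch_inf (Q ^ Suc m) Q) = ?v (int k)"
    proof -
      have "qpoch_inf (- (p ^ (1 + d))) Q = qpoch (- (p ^ (1 + d))) Q k * qpoch_inf a Q"
        using qpoch_inf_shift[OF Q, of "- (p ^ (1 + d))" k]
        by (simp add: a_def m_def Q_def mult.assoc flip: power_mult power_add)
      moreover have "qpoch_inf Q Q = qpoch Q Q m * qpoch_inf (Q ^ Suc m) Q"
        using qpoch_inf_shift[OF Q, of Q m] by simp
      moreover have "p powi ((int k)\<^sup>2 + int d * int k) = p ^ (k\<^sup>2 + d * k)"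
        by (metis of_nat_add of_nat_mult of_nat_power power_int_of_nat)
      ultimately show ?thesis
        using nz by (simp add: c_def rqfact_of_nat field_simps flip: Q_def)
    qed
    also have "(\<lambda>u. c * (p ^ (u\<^sup>2) * x ^ u * rqfact Q (int u) * (qpoch a Q u / qpoch (Q ^ Suc m) Q u)))
        = (\<lambda>u. ?t (int k) (u + k))"
    proof
      fix u
      have e1: "p ^ ((u + k)\<^sup>2 + d * (u + k)) = p ^ (k\<^sup>2 + d * k) * (p ^ (u\<^sup>2) * x ^ u)"
        unfolding x_def m_def power_mult[symmetric] power_add[symmetric]
        by (rule arg_cong[where f = "power p"]) (simp add: power2_eq_square algebra_simps)
      have e2: "qpoch (- (p ^ (1 + d))) Q (u + k) = qpoch (- (p ^ (1 + d))) Q k * qpoch a Q u"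
        using qpoch_add[of "- (p ^ (1 + d))" Q k u]
        by (simp add: a_def m_def Q_def mult.assoc add.commute flip: power_mult power_add)
      have "int (u + k) + int k + int d = int (m + u)"
        by (simp add: m_def)
      hence e3: "rqfact Q (int (u + k) + int k + int d) = rqfact Q (int m) / qpoch (Q ^ Suc m) Q u"
        using qpoch_add[of Q Q m u] by (simp only: rqfact_of_nat) (simp add: field_simps)
      show "c * (p ^ (u\<^sup>2) * x ^ u * rqfact Q (int u) * (qpoch a Q u / qpoch (Q ^ Suc m) Q u)) = ?t (int k) (u + k)"
        unfolding Q_def[symmetric] e1 e2 e3 c_def by (simp add: mult_ac)
    qed
    finally have "((\<lambda>u. ?t (int k) (u + k)) has_sum ?v (int k)) UNIV" .
    also have "?this \<longleftrightarrow> (?t (int k) has_sum ?v (int k)) {k..}"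
      by (rule has_sum_reindex_bij_witness[of _ "\<lambda>n. n - k" "\<lambda>u. u + k"]) auto
    also have "\<dots> \<longleftrightarrow> (?t (int k) has_sum ?v (int k)) UNIV"
      by (rule has_sum_cong_neutral) auto
    finally show ?thesis .
  qed
  show ?thesis
  proof (cases "s \<ge> 0")
    case True
    thus ?thesis using nat_case[of "nat s"] by simp
  next
    case False
    have s': "- s - int d \<ge> 0" using False d by auto
    have "?t (- s - int d) = ?t s"
      by (rule ext) (simp add: algebra_simps)
    moreover have "(- s - int d)\<^sup>2 + int d * (- s - int d) = s\<^sup>2 + int d * s"
      by (simp add: power2_eq_square algebra_simps)
    ultimately show ?thesis
      using nat_case[of "nat (- s - int d)"] s' by simp
  qed
qed

text \<open>The Bailey pairs below differ from one another by terms of the form \<open>c l - c (k - l)\<close>, which cancel in the sum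
  over \<open>l\<close>. This rule lets such identities be checked term by term.\<close>

lemma has_sum_adjust_reflect:
  fixes X Y :: "int \<Rightarrow> complex"
  assumes "(X has_sum T) UNIV" "c summable_on UNIV"
    and "\<And>l. Y l = X l + c l - c (k - l)"
  shows "(Y has_sum T) UNIV"
proof -
  obtain C where C: "(c has_sum C) UNIV" using assms(2) by (auto simp: summable_on_def)
  hence C': "((\<lambda>l. - c (k - l)) has_sum - C) UNIV"
    by (intro has_sum_uminusI) (simp add: has_sum_reflect_int)
  have "Y = (\<lambda>l. X l + c l + - c (k - l))"
    by (rule ext) (simp add: assms(3))
  thus ?thesis
    using has_sum_add[OF has_sum_add[OF assms(1) C] C'] by simp
qed

lemma summable_on_rqfact_finite:
  fixes Q :: complex
  shows "(\<lambda>l. g l * (rqfact Q (n - 3 * l) * rqfact Q (m + 3 * l))) summable_on UNIV"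
proof (rule finite_nonzero_values_imp_summable_on, rule finite_subset)
  show "{l \<in> UNIV. g l * (rqfact Q (n - 3 * l) * rqfact Q (m + 3 * l)) \<noteq> 0} \<subseteq> {- \<bar>m\<bar>..\<bar>n\<bar>}"
  proof safe
    fix l assume "g l * (rqfact Q (n - 3 * l) * rqfact Q (m + 3 * l)) \<noteq> 0"
    hence "\<not> n - 3 * l < 0" "\<not> m + 3 * l < 0" by auto
    thus "l \<in> {- \<bar>m\<bar>..\<bar>n\<bar>}" by auto
  qed
qed auto

context
  fixes Q :: complex
  assumes Q: "Q \<noteq> 0" "norm Q < 1"
begin

lemma rqfact_pascal_left:
  "(1 - Q powi (u + v)) * (rqfact Q u * rqfact Q v) = rqfact Q (u - 1) * rqfact Q v + Q powi u * (rqfact Q u * rqfact Q (v - 1))"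
  by (simp add: rqfact_rec[OF Q(2)] power_int_add Q algebra_simps)

lemma rqfact_pascal_right:
  "(1 - Q powi (u + v)) * (rqfact Q u * rqfact Q v) = rqfact Q u * rqfact Q (v - 1) + Q powi v * (rqfact Q (u - 1) * rqfact Q v)"
  by (simp add: rqfact_rec[OF Q(2)] power_int_add Q algebra_simps)

text \<open>Summands of the two basic Bailey pairs. Multiplied by \<open>(Q)\<^sub>2\<^sub>n\<close> and \<open>(Q)\<^sub>2\<^sub>n\<^sub>+\<^sub>1\<close> they are the summands, with the even and
  the odd terms listed separately (and the odd ones reflected if \<open>N\<close> is even), of
  \<open>\<Sum>\<^sub>k (-1)\<^sup>k Q\<^bsup>k(3k+1)/2\<^esup> [N choose \<lfloor>(N - 3 k) / 2\<rfloor>] = 1\<close> for \<open>N = 2 n\<close> and \<open>N = 2 n + 1\<close>, a relative of Schur's finite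
  Rogers--Ramanujan identity.\<close>

definition bailey_even where "bailey_even n l =
  Q powi (6 * l\<^sup>2 + l) * (rqfact Q (n - 3 * l) * rqfact Q (n + 3 * l))
  - Q powi (6 * l\<^sup>2 + 5 * l + 1) * (rqfact Q (n - 1 - 3 * l) * rqfact Q (n + 1 + 3 * l))"
definition bailey_odd where "bailey_odd n l =
  Q powi (6 * l\<^sup>2 + l) * (rqfact Q (n - 3 * l) * rqfact Q (n + 1 + 3 * l))
  - Q powi (6 * l\<^sup>2 + 7 * l + 2) * (rqfact Q (n - 1 - 3 * l) * rqfact Q (n + 2 + 3 * l))"

text \<open>Ring normalisation leaves powers of \<open>Q\<close> scattered between factors \<open>rqfact\<close>. These rules merge them, which decides
  the termwise identities of this part.\<close>

lemma powi_collect: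
  "Q powi a * Q powi b = Q powi (a + b)"
  "Q powi a * (Q powi b * x) = Q powi (a + b) * x"
  "Q powi a * (rqfact Q u * Q powi b) = rqfact Q u * Q powi (a + b)"
  "Q powi a * (rqfact Q u * (Q powi b * x)) = rqfact Q u * (Q powi (a + b) * x)"
  "Q powi a * (rqfact Q u * (rqfact Q v * Q powi b)) = rqfact Q u * (rqfact Q v * Q powi (a + b))"
  "Q powi a * (rqfact Q u * (rqfact Q v * (Q powi b * x))) = rqfact Q u * (rqfact Q v * (Q powi (a + b) * x))"
  using Q by (simp_all add: power_int_add)

text \<open>Passing from \<open>N - 1\<close> to \<open>N\<close> applies one of the two \<open>q\<close>-Pascal rules to each term. The superfluous terms
  cancel, either directly or after a reflection of \<open>l\<close>.\<close>

lemma bailey_odd_step: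
  assumes "(bailey_even n has_sum T) UNIV" "1 - Q powi (2 * n + 1) \<noteq> 0"
  shows "(bailey_odd n has_sum (T / (1 - Q powi (2 * n + 1)))) UNIV"
proof -
  have "((\<lambda>l. (1 - Q powi (2 * n + 1)) * bailey_odd n l) has_sum T) UNIV"
  proof (rule has_sum_adjust_reflect[OF assms(1), where k = "-1"
      and c = "\<lambda>l. Q powi (6 * l\<^sup>2 + 5 * l + 1) * (rqfact Q (n - 1 - 3 * l) * rqfact Q (n + 1 + 3 * l))"])
    fix l
    have e: "n - 3 * l + (n + 1 + 3 * l) = 2 * n + 1" "n - 1 - 3 * l + (n + 2 + 3 * l) = 2 * n + 1"
      by simp_all
    note p1 = rqfact_pascal_right[of "n - 3 * l" "n + 1 + 3 * l", unfolded e]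
    note p2 = rqfact_pascal_left[of "n - 1 - 3 * l" "n + 2 + 3 * l", unfolded e]
    have "(1 - Q powi (2 * n + 1)) * bailey_odd n l =
        Q powi (6 * l\<^sup>2 + l) * ((1 - Q powi (2 * n + 1)) * (rqfact Q (n - 3 * l) * rqfact Q (n + 1 + 3 * l)))
        - Q powi (6 * l\<^sup>2 + 7 * l + 2) * ((1 - Q powi (2 * n + 1)) * (rqfact Q (n - 1 - 3 * l) * rqfact Q (n + 2 + 3 * l)))"
      unfolding bailey_odd_def by (simp add: algebra_simps)
    thus "(1 - Q powi (2 * n + 1)) * bailey_odd n l =
        bailey_even n l + Q powi (6 * l\<^sup>2 + 5 * l + 1) * (rqfact Q (n - 1 - 3 * l) * rqfact Q (n + 1 + 3 * l))
        - Q powi (6 * (-1 - l)\<^sup>2 + 5 * (-1 - l) + 1) * (rqfact Q (n - 1 - 3 * (-1 - l)) * rqfact Q (n + 1 + 3 * (-1 - l)))"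
      unfolding p1 p2 bailey_even_def by (simp add: algebra_simps powi_collect power2_eq_square)
  qed (rule summable_on_rqfact_finite)
  thus ?thesis
    using assms(2) by (subst (asm) has_sum_cmult_right_iff) auto
qed

lemma bailey_even_step:
  assumes "(bailey_odd (n - 1) has_sum T) UNIV" "1 - Q powi (2 * n) \<noteq> 0"
  shows "(bailey_even n has_sum (T / (1 - Q powi (2 * n)))) UNIV"
proof -
  define e where "e = (\<lambda>l. Q powi (6 * l\<^sup>2 + 7 * l + 2) * (rqfact Q (n - 2 - 3 * l) * rqfact Q (n + 1 + 3 * l)))"
  define d where "d = (\<lambda>l. Q powi (6 * l\<^sup>2 - 2 * l + n) * (rqfact Q (n - 3 * l) * rqfact Q (n - 1 + 3 * l)))"
  have s: "e summable_on UNIV" "d summable_on UNIV"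
    unfolding e_def d_def by (rule summable_on_rqfact_finite)+
  have "((\<lambda>l. bailey_odd (n - 1) l + e l - e (-1 - l)) has_sum T) UNIV"
    by (rule has_sum_adjust_reflect[OF assms(1) s(1)]) auto
  hence "((\<lambda>l. (1 - Q powi (2 * n)) * bailey_even n l) has_sum T) UNIV"
  proof (rule has_sum_adjust_reflect[OF _ s(2), where k = 0])
    fix l
    have eq: "n - 3 * l + (n + 3 * l) = 2 * n" "n - 1 - 3 * l + (n + 1 + 3 * l) = 2 * n"
      by simp_all
    note p1 = rqfact_pascal_left[of "n - 3 * l" "n + 3 * l", unfolded eq]
    note p2 = rqfact_pascal_left[of "n - 1 - 3 * l" "n + 1 + 3 * l", unfolded eq]
    have "(1 - Q powi (2 * n)) * bailey_even n l =
        Q powi (6 * l\<^sup>2 + l) * ((1 - Q powi (2 * n)) * (rqfact Q (n - 3 * l) * rqfact Q (n + 3 * l)))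
        - Q powi (6 * l\<^sup>2 + 5 * l + 1) * ((1 - Q powi (2 * n)) * (rqfact Q (n - 1 - 3 * l) * rqfact Q (n + 1 + 3 * l)))"
      unfolding bailey_even_def by (simp add: algebra_simps)
    thus "(1 - Q powi (2 * n)) * bailey_even n l = bailey_odd (n - 1) l + e l - e (-1 - l) + d l - d (0 - l)"
      unfolding p1 p2 bailey_odd_def e_def d_def by (simp add: algebra_simps powi_collect power2_eq_square)
  qed
  thus ?thesis
    using assms(2) by (subst (asm) has_sum_cmult_right_iff) auto
qed

lemma one_minus_powi_nonzero: "k > 0 \<Longrightarrow> 1 - Q powi k \<noteq> 0"
proof -
  assume "k > 0"
  then obtain m where "k = int (Suc m)"
    by (metis gr0_conv_Suc zero_less_imp_eq_int)
  thus ?thesis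
    using mult_power_ne_1[OF Q(2) Q(2), of m] by (simp only: power_int_of_nat) auto
qed

lemma bailey_both_nat: "(bailey_even (int n) has_sum rqfact Q (2 * int n)) UNIV \<and> (bailey_odd (int n) has_sum rqfact Q (2 * int n + 1)) UNIV"
proof (induction n)
  have step: "(bailey_odd (int n) has_sum rqfact Q (2 * int n + 1)) UNIV" if "(bailey_even (int n) has_sum rqfact Q (2 * int n)) UNIV" for n
  proof -
    have nz: "1 - Q powi (2 * int n + 1) \<noteq> 0" by (rule one_minus_powi_nonzero) auto
    have "rqfact Q (2 * int n) / (1 - Q powi (2 * int n + 1)) = rqfact Q (2 * int n + 1)"
      using nz rqfact_rec[OF Q(2), of "2 * int n + 1"] by simp
    thus ?thesis using bailey_odd_step[OF that nz] by simp
  qed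
  {
    case 0
    have "(bailey_even 0 has_sum rqfact Q 0) UNIV"
    proof (rule has_sum_finite_neutralI[of "{0}"])
      show "bailey_even 0 l = 0" if "l \<in> UNIV - {0}" for l
      proof -
        have "- 3 * l < 0 \<or> 3 * l < 0" "- 1 - 3 * l < 0 \<or> 1 + 3 * l < 0"
          using that by auto
        thus ?thesis unfolding bailey_even_def by auto
      qed
    qed (auto simp: bailey_even_def)
    thus ?case using step[of 0] by simp
  next
    case (Suc n)
    have nz: "1 - Q powi (2 * int (Suc n)) \<noteq> 0" by (rule one_minus_powi_nonzero) auto
    have "rqfact Q (2 * int n + 1) / (1 - Q powi (2 * int (Suc n))) = rqfact Q (2 * int (Suc n))"
      using nz rqfact_rec[OF Q(2), of "2 * int (Suc n)"] by (simp add: add.commute)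
    hence "(bailey_even (int (Suc n)) has_sum rqfact Q (2 * int (Suc n))) UNIV"
      using bailey_even_step[of "int (Suc n)" "rqfact Q (2 * int n + 1)", OF _ nz] Suc by simp
    thus ?case using step by blast
  }
qed

lemma bailey_pair_even: "(bailey_even n has_sum rqfact Q (2 * n)) UNIV"
proof (cases "n < 0")
  case True
  have "bailey_even n l = 0" for l
  proof -
    have "n - 3 * l < 0 \<or> n + 3 * l < 0" "n - 1 - 3 * l < 0 \<or> n + 1 + 3 * l < 0"
      using True by auto
    thus ?thesis unfolding bailey_even_def by auto
  qed
  hence "bailey_even n = (\<lambda>_. 0)" by (rule ext)
  thus ?thesis using True by simp
next
  case False
  thus ?thesis using bailey_both_nat[of "nat n"] by simp
qed

lemma bailey_pair_odd: "(bailey_odd n has_sum rqfact Q (2 * n + 1)) UNIV"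
proof (cases "n < 0")
  case True
  have "bailey_odd n l = 0" for l
  proof -
    have "n - 3 * l < 0 \<or> n + 1 + 3 * l < 0" "n - 1 - 3 * l < 0 \<or> n + 2 + 3 * l < 0"
      using True by auto
    thus ?thesis unfolding bailey_odd_def by auto
  qed
  hence "bailey_odd n = (\<lambda>_. 0)" by (rule ext)
  thus ?thesis using True by simp
next
  case False
  thus ?thesis using bailey_both_nat[of "nat n"] by simp
qed

text \<open>The same left-hand side \<open>1 / (Q)\<^sub>2\<^sub>n\<close> as in \<open>bailey_pair_even\<close>, but expanded in products with indices adding up to
  \<open>2 n + 1\<close>: raise one index by \<open>rqfact_rec\<close>; the correction terms cancel.\<close>

lemma bailey_pair_even_shifted:
  "((\<lambda>l. Q powi (6 * l\<^sup>2 - l) * (rqfact Q (n - 3 * l) * rqfact Q (n + 1 + 3 * l))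
       - Q powi (6 * l\<^sup>2 + 5 * l + 1) * (rqfact Q (n - 3 * l) * rqfact Q (n + 1 + 3 * l))) has_sum rqfact Q (2 * n)) UNIV"
proof -
  define c where "c = (\<lambda>l. - (Q powi (6 * l\<^sup>2 + l)) * (rqfact Q (n - 3 * l) * rqfact Q (n + 3 * l)))"
  have "c summable_on UNIV" unfolding c_def by (rule summable_on_rqfact_finite)
  thus ?thesis
  proof (rule has_sum_adjust_reflect[OF bailey_pair_even, where k = 0])
    fix l
    have r1: "rqfact Q (n + 3 * l) = (1 - Q powi (n + 1 + 3 * l)) * rqfact Q (n + 1 + 3 * l)"
      using rqfact_rec[OF Q(2), of "n + 1 + 3 * l"] by (simp add: algebra_simps)
    have r2: "rqfact Q (n - 1 - 3 * l) = (1 - Q powi (n - 3 * l)) * rqfact Q (n - 3 * l)"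
      using rqfact_rec[OF Q(2), of "n - 3 * l"] by (simp add: algebra_simps)
    have "bailey_even n l + c l - c (0 - l) =
       Q powi (6 * l\<^sup>2 - l) * (rqfact Q (n - 3 * l) * rqfact Q (n + 3 * l))
       - Q powi (6 * l\<^sup>2 + 5 * l + 1) * (rqfact Q (n - 1 - 3 * l) * rqfact Q (n + 1 + 3 * l))"
      by (simp add: c_def bailey_even_def mult_ac)
    thus "Q powi (6 * l\<^sup>2 - l) * (rqfact Q (n - 3 * l) * rqfact Q (n + 1 + 3 * l))
       - Q powi (6 * l\<^sup>2 + 5 * l + 1) * (rqfact Q (n - 3 * l) * rqfact Q (n + 1 + 3 * l)) = bailey_even n l + c l - c (0 - l)"
      unfolding r1 r2 by (simp add: algebra_simps powi_collect power2_eq_square)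
  qed
qed

text \<open>Here \<open>rqfact Q (n - 3 l) * rqfact Q (n + 3 l) - rqfact Q (n - 1 - 3 l) * rqfact Q (n + 1 + 3 l)\<close> contains the factor
  \<open>Q\<^sup>n\<close>, and what remains is the summand of \<open>bailey_pair_even_shifted\<close>.\<close>

lemma bailey_pair_even_weighted:
  "((\<lambda>l. Q powi (6 * l\<^sup>2 + 2 * l) * (rqfact Q (n - 3 * l) * rqfact Q (n + 3 * l))
       - Q powi (6 * l\<^sup>2 + 2 * l) * (rqfact Q (n - 1 - 3 * l) * rqfact Q (n + 1 + 3 * l)))
    has_sum Q powi n * rqfact Q (2 * n)) UNIV"
proof -
  have "Q powi n * (Q powi (6 * l\<^sup>2 - l) * (rqfact Q (n - 3 * l) * rqfact Q (n + 1 + 3 * l))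
       - Q powi (6 * l\<^sup>2 + 5 * l + 1) * (rqfact Q (n - 3 * l) * rqfact Q (n + 1 + 3 * l)))
     = Q powi (6 * l\<^sup>2 + 2 * l) * (rqfact Q (n - 3 * l) * rqfact Q (n + 3 * l))
       - Q powi (6 * l\<^sup>2 + 2 * l) * (rqfact Q (n - 1 - 3 * l) * rqfact Q (n + 1 + 3 * l))" for l
  proof -
    have r1: "rqfact Q (n + 3 * l) = (1 - Q powi (n + 1 + 3 * l)) * rqfact Q (n + 1 + 3 * l)"
      using rqfact_rec[OF Q(2), of "n + 1 + 3 * l"] by (simp add: algebra_simps)
    have r2: "rqfact Q (n - 1 - 3 * l) = (1 - Q powi (n - 3 * l)) * rqfact Q (n - 3 * l)"
      using rqfact_rec[OF Q(2), of "n - 3 * l"] by (simp add: algebra_simps)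
    show ?thesis
      unfolding r1 r2 by (simp add: algebra_simps powi_collect power2_eq_square)
  qed
  thus ?thesis
    using has_sum_cmult_right[OF bailey_pair_even_shifted[of n], of "Q powi n"] by simp
qed

lemma bailey_pair_odd_shifted:
  "((\<lambda>l. Q powi (6 * l\<^sup>2 + l) * (rqfact Q (n - 3 * l) * rqfact Q (n + 2 + 3 * l))
       - Q powi (6 * l\<^sup>2 + 5 * l + 1) * (rqfact Q (n - 1 - 3 * l) * rqfact Q (n + 3 + 3 * l)))
    has_sum rqfact Q (2 * n + 1)) UNIV"
proof -
  define h where "h = (\<lambda>l. Q powi (6 * l\<^sup>2 + 7 * l + 2) * (rqfact Q (n - 1 - 3 * l) * rqfact Q (n + 2 + 3 * l)))"
  define w where "w = (\<lambda>l. Q powi (6 * l\<^sup>2 + 4 * l + n + 2) * (rqfact Q (n - 3 * l) * rqfact Q (n + 2 + 3 * l)))"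
  have s: "h summable_on UNIV" "w summable_on UNIV"
    unfolding h_def w_def by (rule summable_on_rqfact_finite)+
  have "((\<lambda>l. bailey_odd n l + h l - h (-1 - l)) has_sum rqfact Q (2 * n + 1)) UNIV"
    by (rule has_sum_adjust_reflect[OF bailey_pair_odd s(1)]) auto
  thus ?thesis
  proof (rule has_sum_adjust_reflect[OF _ s(2), where k = "-1"])
    fix l
    have r1: "rqfact Q (n + 1 + 3 * l) = (1 - Q powi (n + 2 + 3 * l)) * rqfact Q (n + 2 + 3 * l)"
      using rqfact_rec[OF Q(2), of "n + 2 + 3 * l"] by (simp add: algebra_simps)
    have r2: "rqfact Q (n + 2 + 3 * l) = (1 - Q powi (n + 3 + 3 * l)) * rqfact Q (n + 3 + 3 * l)"
      using rqfact_rec[OF Q(2), of "n + 3 + 3 * l"] by (simp add: algebra_simps)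
    have b: "bailey_odd n l + h l - h (-1 - l) = Q powi (6 * l\<^sup>2 + l) * (rqfact Q (n - 3 * l) * rqfact Q (n + 1 + 3 * l))
        - Q powi (6 * l\<^sup>2 + 5 * l + 1) * (rqfact Q (n - 1 - 3 * l) * rqfact Q (n + 2 + 3 * l))"
      unfolding bailey_odd_def h_def by (simp add: algebra_simps power2_eq_square)
    have b': "bailey_odd n l + h l - h (-1 - l) = Q powi (6 * l\<^sup>2 + l) * (rqfact Q (n - 3 * l) * ((1 - Q powi (n + 2 + 3 * l)) * rqfact Q (n + 2 + 3 * l)))
        - Q powi (6 * l\<^sup>2 + 5 * l + 1) * (rqfact Q (n - 1 - 3 * l) * ((1 - Q powi (n + 3 + 3 * l)) * rqfact Q (n + 3 + 3 * l)))"
      unfolding b r1[symmetric] r2[symmetric] ..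
    show "Q powi (6 * l\<^sup>2 + l) * (rqfact Q (n - 3 * l) * rqfact Q (n + 2 + 3 * l))
       - Q powi (6 * l\<^sup>2 + 5 * l + 1) * (rqfact Q (n - 1 - 3 * l) * rqfact Q (n + 3 + 3 * l)) =
       bailey_odd n l + h l - h (-1 - l) + w l - w (-1 - l)"
      unfolding b' w_def by (simp add: algebra_simps powi_collect power2_eq_square)
  qed
qed

text \<open>As in \<open>bailey_pair_even_weighted\<close>, a difference of two neighbouring products contains the factor \<open>Q\<^sup>n\<close>, once the
  second half of each of the two sums has been reflected.\<close>

lemma bailey_pair_odd_weighted:
  "((\<lambda>l. Q powi (6 * l\<^sup>2 + 4 * l) * (rqfact Q (n - 3 * l) * rqfact Q (n + 1 + 3 * l))
       - Q powi (6 * l\<^sup>2 + 8 * l + 2) * (rqfact Q (n - 1 - 3 * l) * rqfact Q (n + 2 + 3 * l)))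
    has_sum Q powi n * rqfact Q (2 * n + 1)) UNIV"
proof -
  \<comment> \<open>\<open>v\<close> and \<open>k\<close> are the second halves of the summands here and in \<open>bailey_pair_odd_shifted\<close>.\<close>
  define v where "v = (\<lambda>l. Q powi (6 * l\<^sup>2 + 8 * l + 2) * (rqfact Q (n - 1 - 3 * l) * rqfact Q (n + 2 + 3 * l)))"
  define k where "k = (\<lambda>l. Q powi (6 * l\<^sup>2 + 5 * l + 1) * (rqfact Q (n - 1 - 3 * l) * rqfact Q (n + 3 + 3 * l)))"
  define C where "C = (\<lambda>l. Q powi (6 * l\<^sup>2 + l) * (rqfact Q (n - 3 * l) * rqfact Q (n + 2 + 3 * l)) - k l)"
  have s: "v summable_on UNIV" "k summable_on UNIV"
    unfolding v_def k_def by (rule summable_on_rqfact_finite)+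
  have "(C has_sum rqfact Q (2 * n + 1)) UNIV"
    unfolding C_def k_def by (rule bailey_pair_odd_shifted)
  hence "((\<lambda>l. C l + k l - k (-1 - l)) has_sum rqfact Q (2 * n + 1)) UNIV"
    by (rule has_sum_adjust_reflect[OF _ s(2)]) auto
  from has_sum_cmult_right[OF this, of "Q powi n"]
  have "((\<lambda>l. Q powi n * (C l + k l - k (-1 - l))) has_sum Q powi n * rqfact Q (2 * n + 1)) UNIV" .
  moreover have "(\<lambda>l. - v l) summable_on UNIV"
    using s(1) by (simp add: summable_on_uminus)
  ultimately show ?thesis
  proof (rule has_sum_adjust_reflect[where k = "-1"])
    fix l
    have r1: "rqfact Q (n + 1 + 3 * l) = (1 - Q powi (n + 2 + 3 * l)) * rqfact Q (n + 2 + 3 * l)"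
      using rqfact_rec[OF Q(2), of "n + 2 + 3 * l"] by (simp add: algebra_simps)
    have r2: "rqfact Q (n - 1 - 3 * l) = (1 - Q powi (n - 3 * l)) * rqfact Q (n - 3 * l)"
      using rqfact_rec[OF Q(2), of "n - 3 * l"] by (simp add: algebra_simps)
    have v': "v (-1 - l) = Q powi (6 * l\<^sup>2 + 4 * l) * (rqfact Q (n - 1 - 3 * l) * rqfact Q (n + 2 + 3 * l))"
      unfolding v_def by (simp add: algebra_simps power2_eq_square)
    have k': "k (-1 - l) = Q powi (6 * l\<^sup>2 + 7 * l + 2) * (rqfact Q (n - 3 * l) * rqfact Q (n + 2 + 3 * l))"
      unfolding k_def by (simp add: algebra_simps power2_eq_square)
    show "Q powi (6 * l\<^sup>2 + 4 * l) * (rqfact Q (n - 3 * l) * rqfact Q (n + 1 + 3 * l))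
       - Q powi (6 * l\<^sup>2 + 8 * l + 2) * (rqfact Q (n - 1 - 3 * l) * rqfact Q (n + 2 + 3 * l)) =
       Q powi n * (C l + k l - k (-1 - l)) + - v l - - v (-1 - l)"
      unfolding v' k' C_def unfolding v_def r1 r2
      by (simp add: algebra_simps powi_collect power2_eq_square)
  qed
qed

end

section \<open>Six single sums\<close>

text \<open>The quintuple product in base \<open>p\<^bsup>14\<^esup>\<close> at \<open>z = p\<^sup>k\<close>; the subtractions are exact for \<open>k \<le> 7\<close>.\<close>

definition quint_prod :: "complex \<Rightarrow> nat \<Rightarrow> complex" where
  "quint_prod p k = qpoch_inf (p ^ k) (p ^ 14) * qpoch_inf (p ^ (14 - k)) (p ^ 14) * qpoch_inf (p ^ 14) (p ^ 14)
     * (qpoch_inf (p ^ (14 + 2 * k)) (p ^ 28) * qpoch_inf (p ^ (14 - 2 * k)) (p ^ 28))"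

lemma has_sum_quint_prod:
  assumes p: "0 < norm p" "norm p < 1" and k: "k \<le> 7"
  shows "((\<lambda>n::int. p powi (21 * n\<^sup>2 + (7 - 3 * int k) * n) - p powi (21 * n\<^sup>2 + (7 + 3 * int k) * n + int k))
           has_sum quint_prod p k) UNIV"
proof -
  have p0: "p \<noteq> 0" using p by auto
  have n: "0 < norm (p ^ 7)" "norm (p ^ 7) < 1" "p ^ k \<noteq> 0"
    using p by (auto simp: norm_power power_less_one_iff)
  have e: "(p ^ 7)\<^sup>2 = p ^ 14" "(p ^ 7) ^ 4 = p ^ 28" "(p ^ k)\<^sup>2 = p ^ (2 * k)"
    by (simp_all flip: power_mult add: mult.commute)
  have d: "p ^ 14 / p ^ k = p ^ (14 - k)" "p ^ 14 * p ^ (2 * k) = p ^ (14 + 2 * k)"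
    "p ^ 14 / p ^ (2 * k) = p ^ (14 - 2 * k)"
    using p0 k by (simp_all add: power_diff power_add)
  have f: "(p ^ 7) powi (3 * n\<^sup>2 + n) * ((p ^ k) powi (- 3 * n) - (p ^ k) powi (3 * n + 1))
     = p powi (21 * n\<^sup>2 + (7 - 3 * int k) * n) - p powi (21 * n\<^sup>2 + (7 + 3 * int k) * n + int k)" for n
    unfolding power_int_power right_diff_distrib
    by (subst (1 2) powi_mult_eq[OF p0 refl]) (simp add: algebra_simps)
  from quintuple_product[OF n] show ?thesis
    unfolding e d f quint_prod_def by simp
qed

text \<open>Bailey's lemma for the conjugate pair above. Each expansion of \<open>\<beta>\<close> has a positive and a negative family of terms,
  with index maps \<open>s\<close> and \<open>s'\<close>. The exchange of summations is justified since \<open>rqfact\<close> and the finite products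
  are bounded.\<close>

lemma bailey_transform:
  fixes d :: nat and \<alpha> \<alpha>' :: "int \<Rightarrow> complex"
  assumes p: "0 < norm p" "norm p < 1" and d: "d \<le> 1"
    and \<alpha>: "(\<lambda>l. norm (\<alpha> l)) summable_on UNIV" "(\<lambda>l. norm (\<alpha>' l)) summable_on UNIV"
    and \<beta>: "\<And>n::nat. ((\<lambda>l. \<alpha> l * (rqfact (p\<^sup>2) (int n - s l) * rqfact (p\<^sup>2) (int n + s l + int d))
               - \<alpha>' l * (rqfact (p\<^sup>2) (int n - s' l) * rqfact (p\<^sup>2) (int n + s' l + int d))) has_sum \<beta> n) UNIV"
    and T: "((\<lambda>l. \<alpha> l * p powi ((s l)\<^sup>2 + int d * s l) - \<alpha>' l * p powi ((s' l)\<^sup>2 + int d * s' l)) has_sum T) UNIV"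
  shows "((\<lambda>n. p ^ (n\<^sup>2 + d * n) * qpoch (- (p ^ (1 + d))) (p\<^sup>2) n * \<beta> n)
           has_sum (qpoch_inf (- (p ^ (1 + d))) (p\<^sup>2) / qpoch_inf (p\<^sup>2) (p\<^sup>2) * T)) UNIV"
proof -
  define g where "g = (\<lambda>n. p ^ (n\<^sup>2 + d * n) * qpoch (- (p ^ (1 + d))) (p\<^sup>2) n)"
  define K where "K = qpoch_inf (- (p ^ (1 + d))) (p\<^sup>2) / qpoch_inf (p\<^sup>2) (p\<^sup>2)"
  define h where "h = (\<lambda>s n. rqfact (p\<^sup>2) (int n - s) * rqfact (p\<^sup>2) (int n + s + int d))"
  have Q: "norm (p\<^sup>2) < 1" by (rule norm_square_less_1[OF p(2)])
  obtain C where C: "C > 0" "\<And>k. norm (rqfact (p\<^sup>2) k) \<le> C"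
    using rqfact_bounded[OF Q] by blast
  obtain D where D: "D > 0" "\<And>n. norm (qpoch (- (p ^ (1 + d))) (p\<^sup>2) n) \<le> D"
    using qpoch_bounded[OF Q] by blast
  have hC: "norm (h s n) \<le> C * C" for s n
    unfolding h_def norm_mult using C by (intro mult_mono) auto
  have sg: "(\<lambda>n. norm (g n)) summable_on UNIV"
  proof (rule Infinite_Sum.abs_summable_on_comparison_test')
    have "summable (\<lambda>n. norm p ^ (n\<^sup>2) * (norm p ^ d) ^ n)"
      using p by (intro summable_gaussian_nat) auto
    hence "(\<lambda>n. norm p ^ (n\<^sup>2) * (norm p ^ d) ^ n) summable_on UNIV"
      by (intro norm_summable_imp_summable_on) simp
    thus "(\<lambda>n. norm p ^ (n\<^sup>2) * (norm p ^ d) ^ n * D) summable_on UNIV"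
      by (rule summable_on_cmult_left)
    fix n show "norm (g n) \<le> norm p ^ (n\<^sup>2) * (norm p ^ d) ^ n * D"
      unfolding g_def norm_mult norm_power power_add power_mult using D by (intro mult_left_mono) auto
  qed
  have s1: "(\<lambda>(n, l). norm (g n * (a l * h (s l) n))) summable_on UNIV \<times> UNIV"
    if "(\<lambda>l. norm (a l)) summable_on UNIV" for a :: "int \<Rightarrow> complex" and s
  proof -
    have "(\<lambda>(n, l). norm (g n * a l)) summable_on UNIV \<times> UNIV"
      by (rule abs_summable_product[OF sg that])
    hence "(\<lambda>x. norm (case x of (n, l) \<Rightarrow> g n * a l) * (C * C)) summable_on UNIV \<times> UNIV"
      by (intro summable_on_cmult_left) (simp add: case_prod_unfold)
    hence "(\<lambda>x. norm (case x of (n, l) \<Rightarrow> g n * (a l * h (s l) n))) summable_on UNIV \<times> UNIV"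
    proof (rule Infinite_Sum.abs_summable_on_comparison_test')
      fix x :: "nat \<times> int" obtain n l where x: "x = (n, l)" by (cases x)
      have "norm (g n * a l) * norm (h (s l) n) \<le> norm (g n * a l) * (C * C)"
        by (intro mult_left_mono hC) auto
      thus "norm (case x of (n, l) \<Rightarrow> g n * (a l * h (s l) n)) \<le> norm (case x of (n, l) \<Rightarrow> g n * a l) * (C * C)"
        by (simp add: x norm_mult)
    qed
    thus ?thesis by (simp add: case_prod_unfold)
  qed
  have "((\<lambda>n. g n * \<beta> n) has_sum (K * T)) UNIV"
  proof (rule has_sum_exchange)
    have "(\<lambda>(n, l). norm (g n * (\<alpha> l * h (s l) n)) + norm (g n * (\<alpha>' l * h (s' l) n))) summable_on UNIV \<times> UNIV"
      using summable_on_add[OF s1[OF \<alpha>(1), of s] s1[OF \<alpha>(2), of s']] by (simp add: case_prod_unfold)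
    hence "(\<lambda>x. norm (case x of (n, l) \<Rightarrow> g n * (\<alpha> l * h (s l) n - \<alpha>' l * h (s' l) n))) summable_on UNIV \<times> UNIV"
      by (rule Infinite_Sum.abs_summable_on_comparison_test')
         (auto simp: right_diff_distrib intro: norm_triangle_ineq4)
    thus "(\<lambda>(n, l). norm (g n * (\<alpha> l * h (s l) n - \<alpha>' l * h (s' l) n))) summable_on UNIV \<times> UNIV"
      by (simp add: case_prod_unfold)
    show "((\<lambda>l. g n * (\<alpha> l * h (s l) n - \<alpha>' l * h (s' l) n)) has_sum g n * \<beta> n) UNIV" for n
      unfolding h_def by (rule has_sum_cmult_right[OF \<beta>])
    show "((\<lambda>n. g n * (\<alpha> l * h (s l) n - \<alpha>' l * h (s' l) n)) has_sum
        K * (\<alpha> l * p powi ((s l)\<^sup>2 + int d * s l) - \<alpha>' l * p powi ((s' l)\<^sup>2 + int d * s' l))) UNIV" for l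
    proof -
      have *: "((\<lambda>n. a * (g n * h s n)) has_sum a * (p powi (s\<^sup>2 + int d * s) * K)) UNIV" for a s
        unfolding g_def h_def K_def by (rule has_sum_cmult_right[OF has_sum_conjugate_bailey[OF p d]])
      from has_sum_add[OF *[of "\<alpha> l" "s l"] *[of "- \<alpha>' l" "s' l"]] show ?thesis
        by (simp add: algebra_simps)
    qed
    show "((\<lambda>l. K * (\<alpha> l * p powi ((s l)\<^sup>2 + int d * s l) - \<alpha>' l * p powi ((s' l)\<^sup>2 + int d * s' l))) has_sum K * T) UNIV"
      by (rule has_sum_cmult_right[OF T])
  qed
  thus ?thesis by (simp add: g_def K_def)
qed

lemma abs_summable_gaussian_exponent:
  fixes x :: complex
  assumes "0 < norm x" "norm x < 1" "a > 0"
  shows "(\<lambda>l::int. norm (x powi (int a * l\<^sup>2 + b * l + c))) summable_on UNIV"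
proof -
  have "0 < norm (x ^ a)" "norm (x ^ a) < 1" "x powi b \<noteq> 0"
    using assms by (auto simp: norm_power power_less_one_iff)
  hence "(\<lambda>l. norm ((x ^ a) powi (l\<^sup>2) * (x powi b) powi l) * norm (x powi c)) summable_on UNIV"
    by (intro summable_on_cmult_left abs_summable_gaussian)
  also have "(\<lambda>l. norm ((x ^ a) powi (l\<^sup>2) * (x powi b) powi l) * norm (x powi c))
      = (\<lambda>l. norm (x powi (int a * l\<^sup>2 + b * l + c)))"
    using assms by (auto simp: power_int_power power_int_add norm_mult simp flip: power_int_mult)
  finally show ?thesis .
qed

lemma has_sum_reflect_powi:
  fixes x :: complex and a :: nat
  assumes "0 < norm x" "norm x < 1" "a > 0"
    and "((\<lambda>l::int. x powi (int a * l\<^sup>2 - b * l) - Y l) has_sum T) UNIV"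
  shows "((\<lambda>l::int. x powi (int a * l\<^sup>2 + b * l) - Y l) has_sum T) UNIV"
proof (rule has_sum_adjust_reflect[OF assms(4), where k = 0])
  have "(\<lambda>l::int. norm (x powi (int a * l\<^sup>2 + b * l + 0))) summable_on UNIV"
    by (rule abs_summable_gaussian_exponent[OF assms(1-3)])
  thus "(\<lambda>l. x powi (int a * l\<^sup>2 + b * l)) summable_on UNIV"
    by - (rule abs_summable_summable, simp)
qed simp

context
  fixes p :: complex
  assumes p: "0 < norm p" "norm p < 1"
begin

lemma p_nonzero: "p \<noteq> 0" "p\<^sup>2 \<noteq> 0" "norm (p\<^sup>2) < 1" "0 < norm (p\<^sup>2)"
  using p norm_square_less_1 by auto

lemma abs_summable_bailey_coeff: "(\<lambda>l::int. norm ((p\<^sup>2) powi (6 * l\<^sup>2 + b * l + c))) summable_on UNIV"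
   "(\<lambda>l::int. norm ((p\<^sup>2) powi (6 * l\<^sup>2 + b * l))) summable_on UNIV"
  "(\<lambda>l::int. norm ((p\<^sup>2) powi (6 * l\<^sup>2 + l))) summable_on UNIV"
  "(\<lambda>l::int. norm ((p\<^sup>2) powi (6 * l\<^sup>2 - l))) summable_on UNIV"
  using abs_summable_gaussian_exponent[OF p_nonzero(4,3), of 6 b c]
    abs_summable_gaussian_exponent[OF p_nonzero(4,3), of 6 b 0]
    abs_summable_gaussian_exponent[OF p_nonzero(4,3), of 6 1 0]
    abs_summable_gaussian_exponent[OF p_nonzero(4,3), of 6 "-1" 0]
  by simp_all

lemma square_powi_mult: "(p\<^sup>2) powi a * p powi b = p powi (2 * a + b)"
  using powi_mult_eq[OF p_nonzero(1), of "2 * a" b, OF refl] by (simp add: power_int_power)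

text \<open>The six single sums. In each case the square of the index map adds \<open>9 l\<^sup>2 + \<dots>\<close> to the exponent \<open>12 l\<^sup>2 + \<dots>\<close> of the
  Bailey pair, and the resulting theta series, with one or both of its halves reflected if necessary, is
  the series of \<open>quint_prod p k\<close>, up to a factor \<open>p\<close> in \<open>single_sum_odd_shifted\<close>. The value of \<open>k\<close> is read off from the linear terms \<open>(7 \<plusminus> 3 k) n\<close>.\<close>

lemma single_sum_even:
  "((\<lambda>n. p ^ (n\<^sup>2 + 0 * n) * qpoch (- (p ^ (1 + 0))) (p\<^sup>2) n * rqfact (p\<^sup>2) (2 * int n)) has_sum
     (qpoch_inf (- (p ^ (1 + 0))) (p\<^sup>2) / qpoch_inf (p\<^sup>2) (p\<^sup>2) * quint_prod p 3)) UNIV"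
proof (rule bailey_transform[OF p, of 0 "\<lambda>l. (p\<^sup>2) powi (6 * l\<^sup>2 + l)" "\<lambda>l. (p\<^sup>2) powi (6 * l\<^sup>2 + 5 * l + 1)"
    "\<lambda>l. 3 * l" "\<lambda>l. 3 * l + 1"])
  show "((\<lambda>l. (p\<^sup>2) powi (6 * l\<^sup>2 + l) * (rqfact (p\<^sup>2) (int n - 3 * l) * rqfact (p\<^sup>2) (int n + 3 * l + int 0))
      - (p\<^sup>2) powi (6 * l\<^sup>2 + 5 * l + 1) * (rqfact (p\<^sup>2) (int n - (3 * l + 1)) * rqfact (p\<^sup>2) (int n + (3 * l + 1) + int 0)))
      has_sum rqfact (p\<^sup>2) (2 * int n)) UNIV" for n
    using bailey_pair_even[OF p_nonzero(2,3), of "int n"] unfolding bailey_even_def[OF p_nonzero(2,3)]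
    by (simp add: algebra_simps)
  have "((\<lambda>n. p powi (21 * n\<^sup>2 - 2 * n) - p powi (21 * n\<^sup>2 + 16 * n + 3)) has_sum quint_prod p 3) UNIV"
    using has_sum_quint_prod[OF p, of 3] by simp
  from has_sum_reflect_powi[OF p, of 21 2, simplified, OF this]
  show "((\<lambda>l. (p\<^sup>2) powi (6 * l\<^sup>2 + l) * p powi ((3 * l)\<^sup>2 + int 0 * (3 * l)) -
         (p\<^sup>2) powi (6 * l\<^sup>2 + 5 * l + 1) * p powi ((3 * l + 1)\<^sup>2 + int 0 * (3 * l + 1))) has_sum quint_prod p 3) UNIV"
    unfolding square_powi_mult by (simp add: algebra_simps power2_eq_square)
qed (use abs_summable_bailey_coeff in auto)

lemma single_sum_even_weighted:
  "((\<lambda>n. p ^ (n\<^sup>2 + 0 * n) * qpoch (- (p ^ (1 + 0))) (p\<^sup>2) n * ((p\<^sup>2) powi int n * rqfact (p\<^sup>2) (2 * int n))) has_sum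
     (qpoch_inf (- (p ^ (1 + 0))) (p\<^sup>2) / qpoch_inf (p\<^sup>2) (p\<^sup>2) * quint_prod p 1)) UNIV"
proof (rule bailey_transform[OF p, of 0 "\<lambda>l. (p\<^sup>2) powi (6 * l\<^sup>2 + 2 * l)" "\<lambda>l. (p\<^sup>2) powi (6 * l\<^sup>2 + 2 * l)"
    "\<lambda>l. 3 * l" "\<lambda>l. 3 * l + 1"])
  show "((\<lambda>l. (p\<^sup>2) powi (6 * l\<^sup>2 + 2 * l) * (rqfact (p\<^sup>2) (int n - 3 * l) * rqfact (p\<^sup>2) (int n + 3 * l + int 0))
      - (p\<^sup>2) powi (6 * l\<^sup>2 + 2 * l) * (rqfact (p\<^sup>2) (int n - (3 * l + 1)) * rqfact (p\<^sup>2) (int n + (3 * l + 1) + int 0)))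
      has_sum (p\<^sup>2) powi int n * rqfact (p\<^sup>2) (2 * int n)) UNIV" for n
    using bailey_pair_even_weighted[OF p_nonzero(2,3), of "int n"] by (simp add: algebra_simps)
  have "((\<lambda>n. p powi (21 * n\<^sup>2 + 4 * n) - p powi (21 * n\<^sup>2 + 10 * n + 1)) has_sum quint_prod p 1) UNIV"
    using has_sum_quint_prod[OF p, of 1] by simp
  thus "((\<lambda>l. (p\<^sup>2) powi (6 * l\<^sup>2 + 2 * l) * p powi ((3 * l)\<^sup>2 + int 0 * (3 * l)) -
         (p\<^sup>2) powi (6 * l\<^sup>2 + 2 * l) * p powi ((3 * l + 1)\<^sup>2 + int 0 * (3 * l + 1))) has_sum quint_prod p 1) UNIV"
    unfolding square_powi_mult by (simp add: algebra_simps power2_eq_square)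
qed (use abs_summable_bailey_coeff in auto)

lemma single_sum_odd_shifted:
  "((\<lambda>n. p ^ (n\<^sup>2 + 0 * n) * qpoch (- (p ^ (1 + 0))) (p\<^sup>2) n * rqfact (p\<^sup>2) (2 * int n - 1)) has_sum
     (qpoch_inf (- (p ^ (1 + 0))) (p\<^sup>2) / qpoch_inf (p\<^sup>2) (p\<^sup>2) * (p * quint_prod p 5))) UNIV"
proof (rule bailey_transform[OF p, of 0 "\<lambda>l. (p\<^sup>2) powi (6 * l\<^sup>2 + l)" "\<lambda>l. (p\<^sup>2) powi (6 * l\<^sup>2 + 5 * l + 1)"
    "\<lambda>l. 3 * l + 1" "\<lambda>l. 3 * l + 2"])
  show "((\<lambda>l. (p\<^sup>2) powi (6 * l\<^sup>2 + l) * (rqfact (p\<^sup>2) (int n - (3 * l + 1)) * rqfact (p\<^sup>2) (int n + (3 * l + 1) + int 0))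
      - (p\<^sup>2) powi (6 * l\<^sup>2 + 5 * l + 1) * (rqfact (p\<^sup>2) (int n - (3 * l + 2)) * rqfact (p\<^sup>2) (int n + (3 * l + 2) + int 0)))
      has_sum rqfact (p\<^sup>2) (2 * int n - 1)) UNIV" for n
    using bailey_pair_odd_shifted[OF p_nonzero(2,3), of "int n - 1"] by (simp add: algebra_simps)
  have "((\<lambda>n. p powi (21 * n\<^sup>2 - 8 * n) - p powi (21 * n\<^sup>2 + 22 * n + 5)) has_sum quint_prod p 5) UNIV"
    using has_sum_quint_prod[OF p, of 5] by simp
  from has_sum_reflect_powi[OF p, of 21 8, simplified, OF this]
  have "((\<lambda>n. p * (p powi (21 * n\<^sup>2 + 8 * n) - p powi (21 * n\<^sup>2 + 22 * n + 5))) has_sum p * quint_prod p 5) UNIV"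
    by (rule has_sum_cmult_right)
  also have "(\<lambda>n. p * (p powi (21 * n\<^sup>2 + 8 * n) - p powi (21 * n\<^sup>2 + 22 * n + 5)))
     = (\<lambda>n. p powi (21 * n\<^sup>2 + 8 * n + 1) - p powi (21 * n\<^sup>2 + 22 * n + 6))"
  proof
    fix n :: int
    have "p * p powi (21 * n\<^sup>2 + 8 * n) = p powi (21 * n\<^sup>2 + 8 * n + 1)"
      "p * p powi (21 * n\<^sup>2 + 22 * n + 5) = p powi (21 * n\<^sup>2 + 22 * n + 6)"
      using powi_mult_eq[OF p_nonzero(1), of 1, OF refl] by (simp_all add: algebra_simps)
    thus "p * (p powi (21 * n\<^sup>2 + 8 * n) - p powi (21 * n\<^sup>2 + 22 * n + 5))
      = p powi (21 * n\<^sup>2 + 8 * n + 1) - p powi (21 * n\<^sup>2 + 22 * n + 6)"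
      by (simp add: right_diff_distrib)
  qed
  finally show "((\<lambda>l. (p\<^sup>2) powi (6 * l\<^sup>2 + l) * p powi ((3 * l + 1)\<^sup>2 + int 0 * (3 * l + 1)) -
         (p\<^sup>2) powi (6 * l\<^sup>2 + 5 * l + 1) * p powi ((3 * l + 2)\<^sup>2 + int 0 * (3 * l + 2))) has_sum p * quint_prod p 5) UNIV"
    unfolding square_powi_mult by (simp add: algebra_simps power2_eq_square)
qed (use abs_summable_bailey_coeff in auto)

lemma single_sum_odd:
  "((\<lambda>n. p ^ (n\<^sup>2 + 1 * n) * qpoch (- (p ^ (1 + 1))) (p\<^sup>2) n * rqfact (p\<^sup>2) (2 * int n + 1)) has_sum
     (qpoch_inf (- (p ^ (1 + 1))) (p\<^sup>2) / qpoch_inf (p\<^sup>2) (p\<^sup>2) * quint_prod p 4)) UNIV"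
proof (rule bailey_transform[OF p, of 1 "\<lambda>l. (p\<^sup>2) powi (6 * l\<^sup>2 + l)" "\<lambda>l. (p\<^sup>2) powi (6 * l\<^sup>2 + 7 * l + 2)"
    "\<lambda>l. 3 * l" "\<lambda>l. 3 * l + 1"])
  show "((\<lambda>l. (p\<^sup>2) powi (6 * l\<^sup>2 + l) * (rqfact (p\<^sup>2) (int n - 3 * l) * rqfact (p\<^sup>2) (int n + 3 * l + int 1))
      - (p\<^sup>2) powi (6 * l\<^sup>2 + 7 * l + 2) * (rqfact (p\<^sup>2) (int n - (3 * l + 1)) * rqfact (p\<^sup>2) (int n + (3 * l + 1) + int 1)))
      has_sum rqfact (p\<^sup>2) (2 * int n + 1)) UNIV" for n
    using bailey_pair_odd[OF p_nonzero(2,3), of "int n"] unfolding bailey_odd_def[OF p_nonzero(2,3)]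
    by (simp add: algebra_simps)
  have "((\<lambda>n. p powi (21 * n\<^sup>2 - 5 * n) - p powi (21 * n\<^sup>2 + 19 * n + 4)) has_sum quint_prod p 4) UNIV"
    using has_sum_quint_prod[OF p, of 4] by simp
  from has_sum_reflect_powi[OF p, of 21 5, simplified, OF this]
  have *: "((\<lambda>n. p powi (21 * n\<^sup>2 + 5 * n) - p powi (21 * n\<^sup>2 + 19 * n + 4)) has_sum quint_prod p 4) UNIV" .
  have "((\<lambda>n. p powi (21 * n\<^sup>2 + 5 * n) - p powi (21 * n\<^sup>2 + 23 * n + 6)) has_sum quint_prod p 4) UNIV"
  proof (rule has_sum_adjust_reflect[OF *, where k = "-1"])
    show "(\<lambda>n. p powi (21 * n\<^sup>2 + 19 * n + 4)) summable_on UNIV"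
      by (rule abs_summable_summable) (use abs_summable_gaussian_exponent[OF p, of 21 19 4] in simp)
  qed (simp add: algebra_simps power2_eq_square)
  thus "((\<lambda>l. (p\<^sup>2) powi (6 * l\<^sup>2 + l) * p powi ((3 * l)\<^sup>2 + int 1 * (3 * l)) -
         (p\<^sup>2) powi (6 * l\<^sup>2 + 7 * l + 2) * p powi ((3 * l + 1)\<^sup>2 + int 1 * (3 * l + 1))) has_sum quint_prod p 4) UNIV"
    unfolding square_powi_mult by (simp add: algebra_simps power2_eq_square)
qed (use abs_summable_bailey_coeff in auto)

lemma single_sum_odd_weighted:
  "((\<lambda>n. p ^ (n\<^sup>2 + 1 * n) * qpoch (- (p ^ (1 + 1))) (p\<^sup>2) n * ((p\<^sup>2) powi int n * rqfact (p\<^sup>2) (2 * int n + 1))) has_sum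
     (qpoch_inf (- (p ^ (1 + 1))) (p\<^sup>2) / qpoch_inf (p\<^sup>2) (p\<^sup>2) * quint_prod p 6)) UNIV"
proof (rule bailey_transform[OF p, of 1 "\<lambda>l. (p\<^sup>2) powi (6 * l\<^sup>2 + 4 * l)" "\<lambda>l. (p\<^sup>2) powi (6 * l\<^sup>2 + 8 * l + 2)"
    "\<lambda>l. 3 * l" "\<lambda>l. 3 * l + 1"])
  show "((\<lambda>l. (p\<^sup>2) powi (6 * l\<^sup>2 + 4 * l) * (rqfact (p\<^sup>2) (int n - 3 * l) * rqfact (p\<^sup>2) (int n + 3 * l + int 1))
      - (p\<^sup>2) powi (6 * l\<^sup>2 + 8 * l + 2) * (rqfact (p\<^sup>2) (int n - (3 * l + 1)) * rqfact (p\<^sup>2) (int n + (3 * l + 1) + int 1)))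
      has_sum (p\<^sup>2) powi int n * rqfact (p\<^sup>2) (2 * int n + 1)) UNIV" for n
    using bailey_pair_odd_weighted[OF p_nonzero(2,3), of "int n"] by (simp add: algebra_simps)
  have "((\<lambda>n. p powi (21 * n\<^sup>2 - 11 * n) - p powi (21 * n\<^sup>2 + 25 * n + 6)) has_sum quint_prod p 6) UNIV"
    using has_sum_quint_prod[OF p, of 6] by simp
  from has_sum_reflect_powi[OF p, of 21 11, simplified, OF this]
  show "((\<lambda>l. (p\<^sup>2) powi (6 * l\<^sup>2 + 4 * l) * p powi ((3 * l)\<^sup>2 + int 1 * (3 * l)) -
         (p\<^sup>2) powi (6 * l\<^sup>2 + 8 * l + 2) * p powi ((3 * l + 1)\<^sup>2 + int 1 * (3 * l + 1))) has_sum quint_prod p 6) UNIV"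
    unfolding square_powi_mult by (simp add: algebra_simps power2_eq_square)
qed (use abs_summable_bailey_coeff in auto)

lemma single_sum_even_shifted:
  "((\<lambda>n. p ^ (n\<^sup>2 + 1 * n) * qpoch (- (p ^ (1 + 1))) (p\<^sup>2) n * rqfact (p\<^sup>2) (2 * int n)) has_sum
     (qpoch_inf (- (p ^ (1 + 1))) (p\<^sup>2) / qpoch_inf (p\<^sup>2) (p\<^sup>2) * quint_prod p 2)) UNIV"
proof (rule bailey_transform[OF p, of 1 "\<lambda>l. (p\<^sup>2) powi (6 * l\<^sup>2 - l)" "\<lambda>l. (p\<^sup>2) powi (6 * l\<^sup>2 + 5 * l + 1)"
    "\<lambda>l. 3 * l" "\<lambda>l. 3 * l"])
  show "((\<lambda>l. (p\<^sup>2) powi (6 * l\<^sup>2 - l) * (rqfact (p\<^sup>2) (int n - 3 * l) * rqfact (p\<^sup>2) (int n + 3 * l + int 1))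
      - (p\<^sup>2) powi (6 * l\<^sup>2 + 5 * l + 1) * (rqfact (p\<^sup>2) (int n - 3 * l) * rqfact (p\<^sup>2) (int n + 3 * l + int 1)))
      has_sum rqfact (p\<^sup>2) (2 * int n)) UNIV" for n
    using bailey_pair_even_shifted[OF p_nonzero(2,3), of "int n"] by (simp add: algebra_simps)
  have "((\<lambda>n. p powi (21 * n\<^sup>2 + n) - p powi (21 * n\<^sup>2 + 13 * n + 2)) has_sum quint_prod p 2) UNIV"
    using has_sum_quint_prod[OF p, of 2] by simp
  thus "((\<lambda>l. (p\<^sup>2) powi (6 * l\<^sup>2 - l) * p powi ((3 * l)\<^sup>2 + int 1 * (3 * l)) -
         (p\<^sup>2) powi (6 * l\<^sup>2 + 5 * l + 1) * p powi ((3 * l)\<^sup>2 + int 1 * (3 * l))) has_sum quint_prod p 2) UNIV"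
    unfolding square_powi_mult by (simp add: algebra_simps power2_eq_square)
qed (use abs_summable_bailey_coeff in auto)

text \<open>For fixed \<open>n\<close> the sum over \<open>i\<close> is Euler's product \<open>(-p\<^bsup>1-d-2n\<^esup>; p\<^sup>2)\<^sub>\<infinity>\<close>. Reversing its first \<open>n\<close> factors yields the
  power of \<open>p\<close> and the finite product that occur in the single sums.\<close>

lemma has_sum_double_from_single:
  fixes d :: nat
  assumes \<beta>: "\<And>n. n < 0 \<Longrightarrow> \<beta> n = 0" "\<And>n. norm (\<beta> n) \<le> C"
    and T: "((\<lambda>n. p ^ (n\<^sup>2 + d * n) * qpoch (- (p ^ (1 + d))) (p\<^sup>2) n * \<beta> (int n)) has_sum T) UNIV"
  shows "((\<lambda>(n, i). p powi (2 * n\<^sup>2 + 2 * int d * n + i\<^sup>2 - int d * i - 2 * i * n) * rqfact (p\<^sup>2) i * \<beta> n)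
    has_sum (qpoch_inf (- (p powi (1 - int d))) (p\<^sup>2) * T)) (UNIV \<times> UNIV)"
    (is "(?f has_sum _) _")
proof (rule has_sum_SigmaI)
  let ?Q = "p\<^sup>2" and ?A = "qpoch_inf (- (p powi (1 - int d))) (p\<^sup>2)"
  define g where "g = (\<lambda>n. p powi (n\<^sup>2 + int d * n) * qpoch (- (p ^ (1 + d))) ?Q (nat n) * \<beta> n)"
  have "((\<lambda>n. g (int n)) has_sum T) UNIV"
    using T by (simp add: g_def flip: of_nat_power of_nat_mult of_nat_add)
  hence "(g has_sum T) UNIV"
    by (rule has_sum_int_from_nat) (simp add: g_def \<beta>)
  thus "((\<lambda>n. ?A * g n) has_sum (?A * T)) UNIV"
    by (rule has_sum_cmult_right)
  show "((\<lambda>i. ?f (n, i)) has_sum (?A * g n)) UNIV" for n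
  proof (cases "n < 0")
    case True
    thus ?thesis by (simp add: \<beta> g_def)
  next
    case False
    then obtain m where m: "n = int m" by (metis nonneg_int_cases not_le)
    \<comment> \<open>\<open>p\<^bsup>i\<^sup>2\<^esup> x\<^sup>i\<close> is the part of the summand that depends on \<open>i\<close>, apart from \<open>rqfact\<close>.\<close>
    define x where "x = p powi (- int d - 2 * n)"
    have A: "qpoch_inf (- p * x) ?Q = p powi (- (n\<^sup>2 + int d * n)) * qpoch (- (p ^ (1 + d))) ?Q m * ?A"
    proof -
      have px: "- p * x = - (p powi (1 - int d - 2 * int m))"
        using p_nonzero(1) unfolding x_def m
        by (simp add: power_int_diff power_int_add power_int_minus field_simps)
      have s: "qpoch_inf (- (p powi (1 - int d - 2 * int m))) ?Q
        = p powi (- ((int m)\<^sup>2 + int d * int m)) * qpoch (- (p ^ (1 + d))) ?Q m * ?A"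
      proof (induction m)
        case (Suc m)
        let ?y = "p powi (1 - int d - 2 * int (Suc m))"
        have y: "- ?y * ?Q = - (p powi (1 - int d - 2 * int m))"
          using p_nonzero(1) by (simp add: power_int_diff power_int_add field_simps power2_eq_square)
        have z: "1 + ?y = ?y * (1 + p ^ (1 + d) * ?Q ^ m)"
        proof -
          have "?y * (p ^ (1 + d) * ?Q ^ m) = p powi (1 - int d - 2 * int (Suc m)) * p powi int (1 + d + 2 * m)"
            by (simp only: power_int_of_nat power_add power_mult)
          also have "\<dots> = 1"
            using p_nonzero(1) by (subst powi_mult_eq[where c = 0]) auto
          finally show ?thesis by (simp add: algebra_simps)
        qed
        have w: "p powi (- ((int (Suc m))\<^sup>2 + int d * int (Suc m))) = p powi (- ((int m)\<^sup>2 + int d * int m)) * ?y"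
          using p_nonzero(1) by (subst powi_mult_eq[OF _ refl]) (auto simp: power2_eq_square algebra_simps)
        have "qpoch_inf (- ?y) ?Q = (1 + ?y) * qpoch_inf (- (p powi (1 - int d - 2 * int m))) ?Q"
          using qpoch_inf_rec[OF p_nonzero(3), of "- ?y"] unfolding y by simp
        also have "\<dots> = p powi (- ((int (Suc m))\<^sup>2 + int d * int (Suc m))) * qpoch (- (p ^ (1 + d))) ?Q (Suc m) * ?A"
          unfolding Suc.IH w qpoch_Suc z by (simp add: mult_ac)
        finally show ?case .
      qed simp
      show ?thesis unfolding px s m ..
    qed
    have "((\<lambda>i. (p powi (i\<^sup>2) * x powi i * rqfact ?Q i) * (p powi (2 * (n\<^sup>2 + int d * n)) * \<beta> n))
        has_sum (qpoch_inf (- p * x) ?Q * (p powi (2 * (n\<^sup>2 + int d * n)) * \<beta> n))) UNIV"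
      by (rule has_sum_cmult_left[OF has_sum_euler_int(1)[OF p(2) p_nonzero(1)]])
    also have "qpoch_inf (- p * x) ?Q * (p powi (2 * (n\<^sup>2 + int d * n)) * \<beta> n) = ?A * g n"
    proof -
      have "p powi (- (n\<^sup>2 + int d * n)) * p powi (2 * (n\<^sup>2 + int d * n)) = p powi (n\<^sup>2 + int d * n)"
        using p_nonzero(1) by (rule powi_mult_eq) simp
      moreover have "g n = p powi (n\<^sup>2 + int d * n) * qpoch (- (p ^ (1 + d))) ?Q m * \<beta> n"
        by (simp add: g_def m)
      moreover have "u * X * a * (v * b) = a * (u * v * X * b)" for u X a v b :: complex
        by (simp only: mult_ac)
      ultimately show ?thesis unfolding A by metis
    qed
    also have "(\<lambda>i. (p powi (i\<^sup>2) * x powi i * rqfact ?Q i) * (p powi (2 * (n\<^sup>2 + int d * n)) * \<beta> n)) = (\<lambda>i. ?f (n, i))"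
    proof
      fix i
      have "p powi (i\<^sup>2) * x powi i * p powi (2 * (n\<^sup>2 + int d * n)) = p powi (2 * n\<^sup>2 + 2 * int d * n + i\<^sup>2 - int d * i - 2 * i * n)"
        unfolding x_def power_int_mult[symmetric] powi_mult_eq[OF p_nonzero(1) refl]
        by (simp add: algebra_simps)
      moreover have "u * X * r * (v * b) = u * X * v * r * b" for u X r v b :: complex
        by (simp only: mult_ac)
      ultimately show "(p powi (i\<^sup>2) * x powi i * rqfact ?Q i) * (p powi (2 * (n\<^sup>2 + int d * n)) * \<beta> n) = ?f (n, i)"
        unfolding prod.case by metis
    qed
    finally show ?thesis .
  qed
  show "?f summable_on UNIV \<times> UNIV"
  proof (rule abs_summable_summable)
    obtain D where D: "D > 0" "\<And>k. norm (rqfact ?Q k) \<le> D"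
      using rqfact_bounded[OF p_nonzero(3)] by blast
    have C: "C \<ge> 0" using \<beta>(2)[of 0] norm_ge_zero order_trans by blast
    have "(\<lambda>(n, t). norm (p powi (1 * n\<^sup>2 + int d * n + 0) * p powi (1 * t\<^sup>2 + - int d * t + 0))) summable_on UNIV \<times> UNIV"
      using abs_summable_gaussian_exponent[OF p, of 1 "int d" 0]
        abs_summable_gaussian_exponent[OF p, of 1 "- int d" 0]
      by (intro abs_summable_product) simp_all
    also have "?this \<longleftrightarrow> (\<lambda>(n, i). norm (p powi (2 * n\<^sup>2 + 2 * int d * n + i\<^sup>2 - int d * i - 2 * i * n))) summable_on UNIV \<times> UNIV"
    proof (rule summable_on_reindex_bij_witness[of _ "\<lambda>(n, i). (n, i - n)" "\<lambda>(n, t). (n, t + n)"])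
      fix a :: "int \<times> int" obtain n t where a: "a = (n, t)" by (cases a)
      have "p powi (n\<^sup>2 + int d * n) * p powi (t\<^sup>2 - int d * t) =
          p powi (2 * n\<^sup>2 + 2 * int d * n + (t + n)\<^sup>2 - int d * (t + n) - 2 * (t + n) * n)"
        using p_nonzero(1) by (rule powi_mult_eq) (simp add: power2_eq_square algebra_simps)
      thus "(case (case a of (n, t) \<Rightarrow> (n, t + n)) of (n, i) \<Rightarrow> norm (p powi (2 * n\<^sup>2 + 2 * int d * n + i\<^sup>2 - int d * i - 2 * i * n)))
        = (case a of (n, t) \<Rightarrow> norm (p powi (1 * n\<^sup>2 + int d * n + 0) * p powi (1 * t\<^sup>2 + - int d * t + 0)))"
        by (simp add: a)
    qed auto
    finally have "(\<lambda>x. (case x of (n, i) \<Rightarrow> norm (p powi (2 * n\<^sup>2 + 2 * int d * n + i\<^sup>2 - int d * i - 2 * i * n))) * (D * C)) summable_on UNIV \<times> UNIV"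
      by (rule summable_on_cmult_left)
    thus "(\<lambda>x. norm (?f x)) summable_on UNIV \<times> UNIV"
    proof (rule Infinite_Sum.abs_summable_on_comparison_test')
      fix x :: "int \<times> int" obtain n i where x: "x = (n, i)" by (cases x)
      have "norm (rqfact ?Q i) * norm (\<beta> n) \<le> D * C"
        using D \<beta>(2) C by (intro mult_mono) auto
      thus "norm (?f x) \<le> (case x of (n, i) \<Rightarrow> norm (p powi (2 * n\<^sup>2 + 2 * int d * n + i\<^sup>2 - int d * i - 2 * i * n))) * (D * C)"
        unfolding x by (simp add: norm_mult mult.assoc mult_left_mono)
    qed
  qed
qed

end

section \<open>Rank reduction\<close>

text \<open>For even \<open>t\<close> this is \<open>\<phi>(q\<^sup>4)\<close>, and for odd \<open>t\<close> it is \<open>2 q \<psi>(q\<^sup>8)\<close>, in terms of Ramanujan's theta functions.\<close>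

definition theta :: "complex \<Rightarrow> int \<Rightarrow> complex" where
  "theta q t = (\<Sum>\<^sub>\<infinity>d. q powi ((2 * d - t)\<^sup>2))"

lemma has_sum_theta:
  assumes "0 < norm q" "norm q < 1"
  shows "((\<lambda>d. q powi ((2 * d - t)\<^sup>2)) has_sum theta q t) UNIV"
proof -
  have "(\<lambda>d. norm (q powi ((2 * d - t)\<^sup>2))) summable_on UNIV"
    using abs_summable_gaussian_exponent[OF assms, of 4 "- 4 * t" "t\<^sup>2"]
    by (simp add: power2_eq_square algebra_simps)
  hence "(\<lambda>d. q powi ((2 * d - t)\<^sup>2)) summable_on UNIV"
    by (rule abs_summable_summable)
  thus ?thesis unfolding theta_def by (rule has_sum_infsum)
qed

lemma has_sum_product_complex:
  fixes f :: "'a \<Rightarrow> complex" and g :: "'b \<Rightarrow> complex"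
  assumes "(f has_sum a) A" "(g has_sum b) B"
  shows "((\<lambda>(x, y). f x * g y) has_sum (a * b)) (A \<times> B)"
  using assms by (intro has_sum_product)
    (auto simp: summable_on_iff_abs_summable_on_complex[symmetric] summable_on_def)

lemma abs_summable_fst_snd:
  fixes f :: "'a \<Rightarrow> complex" and g :: "'b \<Rightarrow> complex"
  assumes "(\<lambda>x. norm (f x)) summable_on UNIV" "(\<lambda>y. norm (g y)) summable_on UNIV"
  shows "(\<lambda>z. norm (f (fst z) * g (snd z))) summable_on UNIV"
  using abs_summable_product[OF assms] by (simp add: case_prod_unfold)

locale tadpole_sum =
  fixes q :: complex
  assumes q: "0 < norm q" "norm q < 1"
begin

lemma q_nonzero: "q \<noteq> 0" "q ^ 4 \<noteq> 0" "norm (q ^ 4) < 1" "(q\<^sup>2)\<^sup>2 = q ^ 4" "0 < norm (q\<^sup>2)" "norm (q\<^sup>2) < 1"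
  using q by (auto simp: norm_power power_less_one_iff)

text \<open>The summand of \<open>S q a b (c / 4)\<close>, extended by zero to \<open>\<int>\<^sup>5\<close>. The last parameter is counted in quarters so that it
  is an integer.\<close>

definition tadpole_term :: "int \<Rightarrow> int \<Rightarrow> int \<Rightarrow> int \<times> int \<times> int \<times> int \<times> int \<Rightarrow> complex" where
  "tadpole_term a b c = (\<lambda>(n1, n2, n3, n4, n5).
     q powi (2 * (n1\<^sup>2 + (n1 - n2)\<^sup>2 + (n2 - n3)\<^sup>2 + (n3 - n4)\<^sup>2 + (n4 - n5)\<^sup>2)
        + 4 * a * (n1 - n2) + 4 * b * (n3 - n4) + c * n5)
     * (rqfact (q ^ 4) n1 * rqfact (q ^ 4) n2 * rqfact (q ^ 4) n3 * rqfact (q ^ 4) n4 * rqfact (q ^ 4) n5))"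

text \<open>The seven-fold summand after both applications of Durfee's identity, in the coordinates
  \<open>d = n\<^sub>1 - n\<^sub>2 + i\<close>, \<open>u = n\<^sub>2 - i\<close>, \<open>e = n\<^sub>3 - n\<^sub>4 - i + j\<close>, \<open>v = n\<^sub>4 - j\<close> and \<open>w = n\<^sub>5 - j\<close>.\<close>

definition reduced_term :: "int \<Rightarrow> int \<Rightarrow> int \<Rightarrow> int \<Rightarrow> int \<Rightarrow> int \<Rightarrow> int \<Rightarrow> int \<Rightarrow> int \<Rightarrow> int \<Rightarrow> complex" where
  "reduced_term a b c i j d e u v w =
     q powi (2 * (d + u)\<^sup>2 + 2 * u\<^sup>2 + 2 * (d - i)\<^sup>2 + 4 * a * (d - i)
           + 2 * (e + v)\<^sup>2 + 2 * v\<^sup>2 + 2 * (e + i - j)\<^sup>2 + 4 * b * (e + i - j)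
           + 2 * w\<^sup>2 + c * w + c * j)
     * ((rqfact (q ^ 4) i * rqfact (q ^ 4) j * rqfact (q ^ 4) w) * (rqfact (q ^ 4) (u + d) * rqfact (q ^ 4) u)
        * (rqfact (q ^ 4) (v + e) * rqfact (q ^ 4) v))"

text \<open>The exponent is a sum of seven squares \<open>n\<^sup>2, u\<^sup>2, x\<^sup>2, m\<^sup>2, v\<^sup>2, y\<^sup>2, w\<^sup>2\<close> with coefficient \<open>2\<close>, where
  \<open>n = d + u\<close>, \<open>x = d - i\<close>, \<open>m = e + v\<close> and \<open>y = e + i - j\<close>, plus a linear form in these variables. They are
  coordinates of the lattice \<open>\<int>\<^sup>7\<close>, so the sum is dominated by a product of seven Gaussian sums.\<close>

lemma summable_reduced_term:
  "(\<lambda>((i, j), (d, e), (u, v, w)). reduced_term a b c i j d e u v w) summable_on UNIV"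
  (is "?F summable_on _")
proof (rule abs_summable_summable)
  let ?r = "rqfact (q ^ 4)"
  obtain D where D: "D > 0" "\<And>k. norm (?r k) \<le> D"
    using rqfact_bounded[OF q_nonzero(3)] by blast
  define g where "g = (\<lambda>b n. q powi (int 2 * n\<^sup>2 + b * n + 0))"
  have s: "(\<lambda>n. norm (g b n)) summable_on UNIV" for b
    unfolding g_def by (rule abs_summable_gaussian_exponent[OF q]) simp
  define h where "h = (\<lambda>((i, j), (d, e), (u, v, w)).
     q powi (2 * (d + u)\<^sup>2 + 2 * u\<^sup>2 + 2 * (d - i)\<^sup>2 + 4 * a * (d - i)
           + 2 * (e + v)\<^sup>2 + 2 * v\<^sup>2 + 2 * (e + i - j)\<^sup>2 + 4 * b * (e + i - j)
           + 2 * w\<^sup>2 + c * w + c * j))"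
  have "(\<lambda>z. norm (g c (fst z) * (g (- c) (fst (snd z)) * (g (4 * a - c) (fst (snd (snd z)))
        * (g c (fst (snd (snd (snd z)))) * (g (- c) (fst (snd (snd (snd (snd z)))))
        * (g (4 * b - c) (fst (snd (snd (snd (snd (snd z)))))) * g c (snd (snd (snd (snd (snd (snd z)))))))))))))
      summable_on UNIV"
    by (intro abs_summable_fst_snd s)
  also have "?this \<longleftrightarrow> (\<lambda>z. norm (h z)) summable_on UNIV"
  proof (rule summable_on_reindex_bij_witness[of _
      "\<lambda>((i, j), (d, e), (u, v, w)). (d + u, u, d - i, e + v, v, e + i - j, w)"
      "\<lambda>(n, u, x, m, v, y, w). ((n - u - x, m - v + (n - u - x) - y), (n - u, m - v), (u, v, w))"])
    fix z :: "int \<times> int \<times> int \<times> int \<times> int \<times> int \<times> int"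
    obtain n u x m v y w where z: "z = (n, u, x, m, v, y, w)" by (cases z) auto
    have "g c n * (g (- c) u * (g (4 * a - c) x * (g c m * (g (- c) v * (g (4 * b - c) y * g c w)))))
       = h ((n - u - x, m - v + (n - u - x) - y), (n - u, m - v), (u, v, w))"
      unfolding g_def h_def prod.case powi_mult_eq[OF q_nonzero(1) refl]
      by (rule arg_cong[where f = "power_int q"]) (simp add: power2_eq_square algebra_simps)
    thus "norm (h (case z of (n, u, x, m, v, y, w) \<Rightarrow> ((n - u - x, m - v + (n - u - x) - y), (n - u, m - v), (u, v, w)))) =
      norm (g c (fst z) * (g (- c) (fst (snd z)) * (g (4 * a - c) (fst (snd (snd z)))
        * (g c (fst (snd (snd (snd z)))) * (g (- c) (fst (snd (snd (snd (snd z)))))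
        * (g (4 * b - c) (fst (snd (snd (snd (snd (snd z)))))) * g c (snd (snd (snd (snd (snd (snd z))))))))))))"
      by (simp add: z)
  qed auto
  finally have "(\<lambda>z. norm (h z) * ((D * D * D) * (D * D) * (D * D))) summable_on UNIV"
    by (rule summable_on_cmult_left)
  thus "(\<lambda>z. norm (?F z)) summable_on UNIV"
  proof (rule Infinite_Sum.abs_summable_on_comparison_test')
    fix z :: "(int \<times> int) \<times> (int \<times> int) \<times> int \<times> int \<times> int"
    obtain i j d e u v w where z: "z = ((i, j), (d, e), (u, v, w))" by (cases z) auto
    have "norm ((?r i * ?r j * ?r w) * (?r (u + d) * ?r u) * (?r (v + e) * ?r v)) \<le> (D * D * D) * (D * D) * (D * D)"
      unfolding norm_mult using D by (intro mult_mono) auto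
    thus "norm (?F z) \<le> norm (h z) * ((D * D * D) * (D * D) * (D * D))"
      unfolding z h_def reduced_term_def prod.case by (subst norm_mult) (rule mult_left_mono, auto)
  qed
qed

text \<open>The absolutely convergent seven-fold sum is evaluated in two ways: summing over \<open>(i, j)\<close> first gives back the
  five-fold sum by Durfee's identity, and summing over \<open>(u, v, w)\<close> and then over \<open>(d, e)\<close> gives
  the right-hand side by the identities of Cauchy and Euler and the definition of \<open>theta\<close>.\<close>

theorem rank_reduction:
  assumes M: "((\<lambda>(i, j). q powi (i\<^sup>2 - 2 * a * i + (j - i)\<^sup>2 - 2 * b * (j - i) + c * j)
       * (rqfact (q ^ 4) i * rqfact (q ^ 4) j) * (theta q (i - a) * theta q (j - i - b))) has_sum M) UNIV"
  shows "(tadpole_term a b c has_sum (qpoch_inf (- (q powi (2 + c))) (q ^ 4) / (qpoch_inf (q ^ 4) (q ^ 4))\<^sup>2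
           * q powi (- (a\<^sup>2 + b\<^sup>2)) * M)) UNIV"
proof -
  let ?r = "rqfact (q ^ 4)" and ?P = "qpoch_inf (q ^ 4) (q ^ 4)" and ?A = "qpoch_inf (- (q powi (2 + c))) (q ^ 4)"
  let ?K = "\<lambda>i j. q powi (i\<^sup>2 - 2 * a * i + (j - i)\<^sup>2 - 2 * b * (j - i) + c * j)
       * (?r i * ?r j) * (theta q (i - a) * theta q (j - i - b))"
  have Q: "q ^ 4 \<noteq> 0" "norm (q ^ 4) < 1" by (rule q_nonzero)+
  define F where "F = (\<lambda>((i, j), (d, e), (u, v, w)). reduced_term a b c i j d e u v w)"
  obtain T where T: "(F has_sum T) (UNIV \<times> UNIV \<times> UNIV)"
    using summable_reduced_term[of a b c] unfolding summable_on_def F_def by auto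
  define F' where "F' = (\<lambda>((n1, n2, n3, n4, n5), (i, j)).
    reduced_term a b c i j (n1 - n2 + i) (n3 - n4 - i + j) (n2 - i) (n4 - j) (n5 - j))"
  have "(F' has_sum T) (UNIV \<times> UNIV)"
    unfolding F'_def
    by (subst has_sum_reindex_bij_witness[where T = "UNIV \<times> UNIV \<times> UNIV" and h = F and s' = T,
        of _ "\<lambda>((i, j), (d, e), (u, v, w)). ((d + u, u + i, v + e + i, v + j, w + j), (i, j))"
           "\<lambda>((n1, n2, n3, n4, n5), (i, j)). ((i, j), (n1 - n2 + i, n3 - n4 - i + j), (n2 - i, n4 - j, n5 - j))"])
       (use T in \<open>auto simp: F_def\<close>)
  hence left: "(tadpole_term a b c has_sum T) UNIV"
  proof (rule has_sum_SigmaD)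
    fix n :: "int \<times> int \<times> int \<times> int \<times> int"
    obtain n1 n2 n3 n4 n5 where n: "n = (n1, n2, n3, n4, n5)" by (cases n)
    \<comment> \<open>The part of the exponent that involves neither \<open>i\<close> nor \<open>j\<close>; the linear term \<open>c j\<close> has been absorbed in \<open>c n5\<close>.\<close>
    define X where "X = 2 * n1\<^sup>2 + 2 * (n1 - n2)\<^sup>2 + 4 * a * (n1 - n2) + 2 * (n2 - n3)\<^sup>2 + 2 * (n3 - n4)\<^sup>2
       + 4 * b * (n3 - n4) + 2 * (n4 - n5)\<^sup>2 + c * n5"
    have "((\<lambda>(i, j). (q powi X * ?r n1 * (?r i * ?r (n2 - i) * ?r (n3 - i) * (q ^ 4) powi ((n2 - i) * (n3 - i))))
          * (?r j * ?r (n4 - j) * ?r (n5 - j) * (q ^ 4) powi ((n4 - j) * (n5 - j))))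
        has_sum (q powi X * ?r n1 * (?r n2 * ?r n3)) * (?r n4 * ?r n5)) (UNIV \<times> UNIV)"
      by (intro has_sum_product_complex has_sum_cmult_right rqfact_durfee Q)
    also have "(q powi X * ?r n1 * (?r n2 * ?r n3)) * (?r n4 * ?r n5) = tadpole_term a b c n"
      unfolding n tadpole_term_def X_def prod.case by (simp add: algebra_simps)
    also have "(\<lambda>(i, j). (q powi X * ?r n1 * (?r i * ?r (n2 - i) * ?r (n3 - i) * (q ^ 4) powi ((n2 - i) * (n3 - i))))
          * (?r j * ?r (n4 - j) * ?r (n5 - j) * (q ^ 4) powi ((n4 - j) * (n5 - j)))) =
        (\<lambda>(i, j). reduced_term a b c i j (n1 - n2 + i) (n3 - n4 - i + j) (n2 - i) (n4 - j) (n5 - j))"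
    proof (intro ext, clarify)
      fix i j
      have e: "q powi X * (q ^ 4) powi ((n2 - i) * (n3 - i)) * (q ^ 4) powi ((n4 - j) * (n5 - j))
         = q powi (2 * (n1 - n2 + i + (n2 - i))\<^sup>2 + 2 * (n2 - i)\<^sup>2 + 2 * (n1 - n2 + i - i)\<^sup>2 + 4 * a * (n1 - n2 + i - i)
           + 2 * (n3 - n4 - i + j + (n4 - j))\<^sup>2 + 2 * (n4 - j)\<^sup>2 + 2 * (n3 - n4 - i + j + i - j)\<^sup>2
           + 4 * b * (n3 - n4 - i + j + i - j) + 2 * (n5 - j)\<^sup>2 + c * (n5 - j) + c * j)"
        unfolding power_int_power powi_mult_eq[OF q_nonzero(1) refl] X_def
        by (rule arg_cong[where f = "power_int q"]) (simp add: power2_eq_square algebra_simps)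
      have f: "n2 - i + (n1 - n2 + i) = n1" "n4 - j + (n3 - n4 - i + j) = n3 - i" by simp_all
      show "q powi X * ?r n1 * (?r i * ?r (n2 - i) * ?r (n3 - i) * (q ^ 4) powi ((n2 - i) * (n3 - i)))
          * (?r j * ?r (n4 - j) * ?r (n5 - j) * (q ^ 4) powi ((n4 - j) * (n5 - j))) =
        reduced_term a b c i j (n1 - n2 + i) (n3 - n4 - i + j) (n2 - i) (n4 - j) (n5 - j)"
        unfolding reduced_term_def e[symmetric] f by (simp only: mult_ac)
    qed
    finally show "((\<lambda>y. F' (n, y)) has_sum tadpole_term a b c n) UNIV"
      by (simp add: n F'_def)
  qed
  define B where "B = (\<lambda>((i, j), (d, e)). ?r i * ?r j * q powi (c * j) * (inverse ?P * inverse ?P * ?A)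
     * (q powi (2 * d\<^sup>2 + 2 * (d - i)\<^sup>2 + 4 * a * (d - i)) * q powi (2 * e\<^sup>2 + 2 * (e + i - j)\<^sup>2 + 4 * b * (e + i - j))))"
  define F'' where "F'' = (\<lambda>(((i, j), (d, e)), (u, v, w)). reduced_term a b c i j d e u v w)"
  have BT: "(B has_sum T) (UNIV \<times> UNIV)"
  proof (rule has_sum_SigmaD[where B = "\<lambda>_. UNIV"])
    have "(F'' has_sum T) (UNIV \<times> UNIV)"
      unfolding F''_def
      by (subst has_sum_reindex_bij_witness[where T = "UNIV \<times> UNIV \<times> UNIV" and h = F and s' = T,
        of _ "\<lambda>(x, y, z). ((x, y), z)" "\<lambda>((x, y), z). (x, y, z)"]) (use T in \<open>auto simp: F_def\<close>)
    thus "(F'' has_sum T) ((UNIV \<times> UNIV) \<times> UNIV)"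
      by simp
    fix x :: "(int \<times> int) \<times> int \<times> int"
    obtain i j d e where x: "x = ((i, j), (d, e))" by (cases x) auto
    define Y where "Y = 2 * d\<^sup>2 + 2 * (d - i)\<^sup>2 + 4 * a * (d - i)"
    define Z where "Z = 2 * e\<^sup>2 + 2 * (e + i - j)\<^sup>2 + 4 * b * (e + i - j)"
    define k where "k = ?r i * ?r j * q powi (c * j) * (q powi Y * q powi Z)"
    have eu: "((\<lambda>w. (q\<^sup>2) powi (w\<^sup>2) * (q powi c) powi w * ?r w) has_sum ?A) UNIV"
    proof -
      have "- (q\<^sup>2) * q powi c = - (q powi (2 + c))"
        using q_nonzero(1) by (simp add: power_int_add)
      thus ?thesis
        using has_sum_euler_int(1)[of "q\<^sup>2" "q powi c"] q_nonzero by simp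
    qed
    have "((\<lambda>(u, v, w). (k * (?r u * ?r (u + d) * (q ^ 4) powi (u * (u + d))))
         * ((?r v * ?r (v + e) * (q ^ 4) powi (v * (v + e))) * ((q\<^sup>2) powi (w\<^sup>2) * (q powi c) powi w * ?r w)))
       has_sum (k * inverse ?P) * (inverse ?P * ?A)) (UNIV \<times> UNIV \<times> UNIV)"
      using has_sum_product_complex[OF has_sum_cmult_right[OF rqfact_cauchy[OF Q]] has_sum_product_complex[OF rqfact_cauchy[OF Q] eu]]
      by (simp add: case_prod_unfold)
    also have "(k * inverse ?P) * (inverse ?P * ?A) = B x"
      by (simp add: B_def x k_def Y_def Z_def mult_ac)
    also have "(\<lambda>(u, v, w). (k * (?r u * ?r (u + d) * (q ^ 4) powi (u * (u + d))))
         * ((?r v * ?r (v + e) * (q ^ 4) powi (v * (v + e))) * ((q\<^sup>2) powi (w\<^sup>2) * (q powi c) powi w * ?r w)))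
       = (\<lambda>(u, v, w). reduced_term a b c i j d e u v w)"
    proof (intro ext, clarify)
      fix u v w
      have ex: "q powi (c * j) * q powi Y * q powi Z * (q ^ 4) powi (u * (u + d)) * (q ^ 4) powi (v * (v + e))
          * (q\<^sup>2) powi (w\<^sup>2) * (q powi c) powi w =
         q powi (2 * (d + u)\<^sup>2 + 2 * u\<^sup>2 + 2 * (d - i)\<^sup>2 + 4 * a * (d - i)
           + 2 * (e + v)\<^sup>2 + 2 * v\<^sup>2 + 2 * (e + i - j)\<^sup>2 + 4 * b * (e + i - j)
           + 2 * w\<^sup>2 + c * w + c * j)"
        unfolding power_int_power power_int_mult[symmetric] powi_mult_eq[OF q_nonzero(1) refl] Y_def Z_def
        by (rule arg_cong[where f = "power_int q"]) (simp add: power2_eq_square algebra_simps)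
      show "(k * (?r u * ?r (u + d) * (q ^ 4) powi (u * (u + d))))
         * ((?r v * ?r (v + e) * (q ^ 4) powi (v * (v + e))) * ((q\<^sup>2) powi (w\<^sup>2) * (q powi c) powi w * ?r w))
        = reduced_term a b c i j d e u v w"
        unfolding reduced_term_def ex[symmetric] k_def by (simp only: mult_ac)
    qed
    finally show "((\<lambda>y. F'' (x, y)) has_sum B x) UNIV"
      by (simp add: x F''_def)
  qed
  define C where "C = ?A / ?P\<^sup>2 * q powi (- (a\<^sup>2 + b\<^sup>2))"
  have "((\<lambda>(i, j). C * (?K i j)) has_sum T) UNIV"
  proof (rule has_sum_SigmaD[OF BT])
    fix x :: "int \<times> int" obtain i j where x: "x = (i, j)" by (cases x)
    have th: "((\<lambda>d. q powi (2 * d\<^sup>2 + 2 * (d - t)\<^sup>2 + 4 * a * (d - t))) has_sum q powi (t\<^sup>2 - 2 * a * t - a\<^sup>2) * theta q (t - a)) UNIV" for t a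
    proof -
      have "q powi (t\<^sup>2 - 2 * a * t - a\<^sup>2) * q powi ((2 * d - (t - a))\<^sup>2) = q powi (2 * d\<^sup>2 + 2 * (d - t)\<^sup>2 + 4 * a * (d - t))" for d
        using q_nonzero(1) by (rule powi_mult_eq) (simp add: power2_eq_square algebra_simps)
      thus ?thesis
        using has_sum_cmult_right[OF has_sum_theta[OF q, of "t - a"], of "q powi (t\<^sup>2 - 2 * a * t - a\<^sup>2)"] by simp
    qed
    have "((\<lambda>(d, e). (?r i * ?r j * q powi (c * j) * (inverse ?P * inverse ?P * ?A)
       * q powi (2 * d\<^sup>2 + 2 * (d - i)\<^sup>2 + 4 * a * (d - i))) * q powi (2 * e\<^sup>2 + 2 * (e - (j - i))\<^sup>2 + 4 * b * (e - (j - i))))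
      has_sum (?r i * ?r j * q powi (c * j) * (inverse ?P * inverse ?P * ?A) * (q powi (i\<^sup>2 - 2 * a * i - a\<^sup>2) * theta q (i - a)))
         * (q powi ((j - i)\<^sup>2 - 2 * b * (j - i) - b\<^sup>2) * theta q (j - i - b))) (UNIV \<times> UNIV)"
      by (intro has_sum_product_complex has_sum_cmult_right th)
    also have "(?r i * ?r j * q powi (c * j) * (inverse ?P * inverse ?P * ?A) * (q powi (i\<^sup>2 - 2 * a * i - a\<^sup>2) * theta q (i - a)))
         * (q powi ((j - i)\<^sup>2 - 2 * b * (j - i) - b\<^sup>2) * theta q (j - i - b))
      = C * (?K i j)"
    proof -
      have e: "q powi (- (a\<^sup>2 + b\<^sup>2)) * q powi (i\<^sup>2 - 2 * a * i + (j - i)\<^sup>2 - 2 * b * (j - i) + c * j) =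
         q powi (c * j) * q powi (i\<^sup>2 - 2 * a * i - a\<^sup>2) * q powi ((j - i)\<^sup>2 - 2 * b * (j - i) - b\<^sup>2)"
        unfolding powi_mult_eq[OF q_nonzero(1) refl] by (simp add: algebra_simps)
      have v: "inverse ?P * inverse ?P * ?A = ?A / ?P\<^sup>2"
        by (simp add: power2_eq_square divide_inverse mult_ac)
      have g: "r * s * u1 * k * (u2 * t1) * (u3 * t2) = k * (u1 * u2 * u3) * (r * s) * (t1 * t2)"
        for r s u1 k u2 t1 u3 t2 :: complex by (simp only: mult_ac)
      show ?thesis
        unfolding v g e[symmetric] C_def by (simp only: mult_ac)
    qed
    finally show "((\<lambda>y. B (x, y)) has_sum (case x of (i, j) \<Rightarrow> C * (?K i j))) UNIV"
      by (simp add: B_def x case_prod_unfold algebra_simps)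
  qed
  moreover have "((\<lambda>(i, j). C * (?K i j)) has_sum C * M) UNIV"
    using has_sum_cmult_right[OF M, of C] by (simp add: case_prod_unfold)
  ultimately have "T = C * M"
    by (rule has_sum_unique)
  thus ?thesis using left by (simp add: C_def)
qed

end

section \<open>Parity dissection\<close>

lemma has_sum_parity_split:
  fixes f :: "int \<times> int \<Rightarrow> complex"
  assumes "((\<lambda>(n, i). f (i, 2 * n)) has_sum A) UNIV" "((\<lambda>(n, i). f (i, 2 * n + 1)) has_sum B) UNIV"
  shows "(f has_sum (A + B)) UNIV"
proof -
  have "(f has_sum A) {(i, j). even j} \<longleftrightarrow> ((\<lambda>(n, i). f (i, 2 * n)) has_sum A) UNIV"
    by (rule has_sum_reindex_bij_witness[of _ "\<lambda>(n, i). (i, 2 * n)" "\<lambda>(i, j). (j div 2, i)"]) auto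
  moreover have "(f has_sum B) {(i, j). odd j} \<longleftrightarrow> ((\<lambda>(n, i). f (i, 2 * n + 1)) has_sum B) UNIV"
    by (rule has_sum_reindex_bij_witness[of _ "\<lambda>(n, i). (i, 2 * n + 1)" "\<lambda>(i, j). (j div 2, i)"]) auto
  ultimately have "(f has_sum (A + B)) ({(i, j). even j} \<union> {(i, j). odd j})"
    using assms by (intro has_sum_Un_disjoint) auto
  also have "{(i, j). even j} \<union> {(i, j). odd j} = (UNIV :: (int \<times> int) set)" by auto
  finally show ?thesis .
qed

lemma theta_parity: "theta q t = theta q (t mod 2)"
proof -
  have "(\<Sum>\<^sub>\<infinity>d. q powi ((2 * d - t)\<^sup>2)) = (\<Sum>\<^sub>\<infinity>d. q powi ((2 * d - t mod 2)\<^sup>2))"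
    by (rule infsum_reindex_bij_witness[of _ "\<lambda>d. d + t div 2" "\<lambda>d. d - t div 2"])
       (auto simp: algebra_simps minus_mult_div_eq_mod[symmetric])
  thus ?thesis by (simp add: theta_def)
qed

lemma theta_even_odd: "theta q t = (if even t then theta q 0 else theta q 1)"
  by (subst theta_parity) (auto simp: even_iff_mod_2_eq_zero odd_iff_mod_2_eq_one)

text \<open>Closed forms of the double sums with \<open>d = 0\<close> and \<open>d = 1\<close>. The inner Euler product then has arguments that are
  half-integral and integral powers of \<open>Q = p\<^sup>2\<close>, respectively.\<close>

definition half_val :: "complex \<Rightarrow> nat \<Rightarrow> complex" where
  "half_val p k = qpoch_inf (- p) (p\<^sup>2) * (qpoch_inf (- p) (p\<^sup>2) / qpoch_inf (p\<^sup>2) (p\<^sup>2) * quint_prod p k)"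

definition int_val :: "complex \<Rightarrow> nat \<Rightarrow> complex" where
  "int_val p k = qpoch_inf (- 1) (p\<^sup>2) * (qpoch_inf (- (p\<^sup>2)) (p\<^sup>2) / qpoch_inf (p\<^sup>2) (p\<^sup>2) * quint_prod p k)"

context
  fixes p :: complex
  assumes p: "0 < norm p" "norm p < 1"
begin

lemma base_facts: "norm (p\<^sup>2) < 1" "p \<noteq> 0"
  using p norm_square_less_1 by auto

lemma bounded_weight:
  assumes "\<And>n. n < 0 \<Longrightarrow> rqfact (p\<^sup>2) (m n) = 0"
  obtains C where "\<And>n. norm (rqfact (p\<^sup>2) (m n)) \<le> C" "\<And>n. norm ((p\<^sup>2) powi n * rqfact (p\<^sup>2) (m n)) \<le> C"
proof -
  obtain C where C: "C > 0" "\<And>k. norm (rqfact (p\<^sup>2) k) \<le> C"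
    using rqfact_bounded[OF base_facts(1)] by blast
  have "norm ((p\<^sup>2) powi n * rqfact (p\<^sup>2) (m n)) \<le> C" for n
  proof (cases "n < 0")
    case True
    thus ?thesis using C assms by simp
  next
    case False
    have "norm ((p\<^sup>2) powi n) \<le> 1"
    proof -
      have "norm ((p\<^sup>2) powi n) = norm (p\<^sup>2) ^ nat n"
        using False by (simp add: power_int_def norm_power)
      thus ?thesis using base_facts(1) by (simp only: power_le_one norm_ge_zero less_imp_le)
    qed
    hence "norm ((p\<^sup>2) powi n) * norm (rqfact (p\<^sup>2) (m n)) \<le> 1 * C"
      using C by (intro mult_mono) auto
    thus ?thesis by (simp add: norm_mult)
  qed
  thus ?thesis using C that by blast
qed

lemma double_sum_even: "((\<lambda>(n, i). p powi (2 * n\<^sup>2 + i\<^sup>2 - 2 * i * n) * rqfact (p\<^sup>2) i * rqfact (p\<^sup>2) (2 * n)) has_sum half_val p 3) UNIV"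
proof -
  obtain C where "\<And>n. norm (rqfact (p\<^sup>2) (2 * n)) \<le> C"
    using rqfact_bounded[OF base_facts(1)] by metis
  from has_sum_double_from_single[OF p _ this single_sum_even[OF p]] base_facts(2) show ?thesis by (simp add: half_val_def)
qed

lemma double_sum_even_weighted: "((\<lambda>(n, i). p powi (2 * n\<^sup>2 + i\<^sup>2 - 2 * i * n) * rqfact (p\<^sup>2) i * ((p\<^sup>2) powi n * rqfact (p\<^sup>2) (2 * n))) has_sum half_val p 1) UNIV"
proof -
  obtain C where "\<And>n. norm ((p\<^sup>2) powi n * rqfact (p\<^sup>2) (2 * n)) \<le> C"
    by (rule bounded_weight[of "\<lambda>n. 2 * n"]) auto
  from has_sum_double_from_single[OF p _ this single_sum_even_weighted[OF p]] base_facts(2) show ?thesis by (simp add: half_val_def)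
qed

lemma double_sum_odd_shifted: "((\<lambda>(n, i). p powi (2 * n\<^sup>2 + i\<^sup>2 - 2 * i * n) * rqfact (p\<^sup>2) i * rqfact (p\<^sup>2) (2 * n - 1)) has_sum p * half_val p 5) UNIV"
proof -
  obtain C where "\<And>n. norm (rqfact (p\<^sup>2) (2 * n - 1)) \<le> C"
    using rqfact_bounded[OF base_facts(1)] by metis
  from has_sum_double_from_single[OF p _ this single_sum_odd_shifted[OF p]] base_facts(2) show ?thesis by (simp add: half_val_def mult_ac)
qed

lemma double_sum_odd: "((\<lambda>(n, i). p powi (2 * n\<^sup>2 + 2 * n + i\<^sup>2 - i - 2 * i * n) * rqfact (p\<^sup>2) i * rqfact (p\<^sup>2) (2 * n + 1)) has_sum int_val p 4) UNIV"
proof -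
  obtain C where "\<And>n. norm (rqfact (p\<^sup>2) (2 * n + 1)) \<le> C"
    using rqfact_bounded[OF base_facts(1)] by metis
  from has_sum_double_from_single[OF p _ this single_sum_odd[OF p]] base_facts(2) show ?thesis by (simp add: int_val_def power2_eq_square)
qed

lemma double_sum_odd_weighted: "((\<lambda>(n, i). p powi (2 * n\<^sup>2 + 2 * n + i\<^sup>2 - i - 2 * i * n) * rqfact (p\<^sup>2) i * ((p\<^sup>2) powi n * rqfact (p\<^sup>2) (2 * n + 1))) has_sum int_val p 6) UNIV"
proof -
  obtain C where "\<And>n. norm ((p\<^sup>2) powi n * rqfact (p\<^sup>2) (2 * n + 1)) \<le> C"
    by (rule bounded_weight[of "\<lambda>n. 2 * n + 1"]) auto
  from has_sum_double_from_single[OF p _ this single_sum_odd_weighted[OF p]] base_facts(2) show ?thesis by (simp add: int_val_def power2_eq_square)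
qed

lemma double_sum_even_shifted: "((\<lambda>(n, i). p powi (2 * n\<^sup>2 + 2 * n + i\<^sup>2 - i - 2 * i * n) * rqfact (p\<^sup>2) i * rqfact (p\<^sup>2) (2 * n)) has_sum int_val p 2) UNIV"
proof -
  obtain C where "\<And>n. norm (rqfact (p\<^sup>2) (2 * n)) \<le> C"
    using rqfact_bounded[OF base_facts(1)] by metis
  from has_sum_double_from_single[OF p _ this single_sum_even_shifted[OF p]] base_facts(2) show ?thesis by (simp add: int_val_def power2_eq_square)
qed

end

context tadpole_sum
begin

abbreviation "r \<equiv> rqfact (q ^ 4)"
abbreviation "th0 \<equiv> theta q 0"
abbreviation "th1 \<equiv> theta q 1"
abbreviation "th_mean \<equiv> (th0\<^sup>2 + th1\<^sup>2) / 2"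
abbreviation "th_diff a \<equiv> (-1) powi a * ((th0\<^sup>2 - th1\<^sup>2) / 2)"

text \<open>The double sum over all \<open>(i, j)\<close>: \<open>x\<close> is the part belonging to the parity of \<open>j\<close> for which the theta factors are
  \<open>\<theta>(0) \<theta>(1)\<close>, and \<open>y\<close>, \<open>z\<close> are the other part at \<open>p = q\<^sup>2\<close> and at \<open>p = -q\<^sup>2\<close>.\<close>

definition combined :: "int \<Rightarrow> complex \<Rightarrow> complex \<Rightarrow> complex \<Rightarrow> complex" where
  "combined a x y z = th0 * th1 * x + th_mean * y + th_diff a * z"

text \<open>The two factors have arguments of equal parity, hence their product is \<open>th0\<^sup>2\<close> or \<open>th1\<^sup>2\<close>. It is written as mean value plus
  sign times half difference in order to expose the sign \<open>(-1)\<^sup>i\<close>.\<close>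

lemma theta_square_split:
  "theta q (i - a) * theta q (2 * n - i - a) = th_mean + th_diff a * (-1) powi i"
  "theta q (i - a) * theta q (2 * n - 1 - i - (a - 1)) = th_mean + th_diff a * (-1) powi i"
  by (subst (1 2) theta_even_odd, simp add: minus_one_powi power2_eq_square field_simps)+

lemma theta_mixed:
  "theta q (i - a) * theta q (2 * n + 1 - i - a) = th0 * th1"
  "theta q (i - a) * theta q (2 * n - i - (a - 1)) = th0 * th1"
  by (subst (1 2) theta_even_odd, simp)+

text \<open>Replacing \<open>p\<close> by \<open>-p\<close> in \<open>p\<^bsup>2n\<^sup>2+i\<^sup>2-2in\<^esup>\<close> produces the sign \<open>(-1)\<^sup>i\<close>, so that the signed sum is the unsigned one
  evaluated at \<open>-q\<^sup>2\<close>.\<close>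

lemma has_sum_theta_squares_split:
  assumes "\<And>x. 0 < norm x \<Longrightarrow> norm x < 1 \<Longrightarrow>
     ((\<lambda>(n, i). x powi (2 * n\<^sup>2 + i\<^sup>2 - 2 * i * n) * rqfact (x\<^sup>2) i * w (x\<^sup>2) n) has_sum v x) UNIV"
  shows "((\<lambda>(n, i). (q\<^sup>2) powi (2 * n\<^sup>2 + i\<^sup>2 - 2 * i * n) * (r i * w (q ^ 4) n)
            * (th_mean + th_diff a * (-1) powi i)) has_sum
          (th_mean * v (q\<^sup>2) + th_diff a * v (- (q\<^sup>2)))) UNIV"
proof -
  have n: "0 < norm (- (q\<^sup>2))" "norm (- (q\<^sup>2)) < 1"
    using q_nonzero by auto
  have s: "(- (q\<^sup>2)) powi (2 * n\<^sup>2 + i\<^sup>2 - 2 * i * n) = (-1) powi i * (q\<^sup>2) powi (2 * n\<^sup>2 + i\<^sup>2 - 2 * i * n)" for n i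
    by (subst minus_powi) (simp add: minus_one_powi)
  have "A * ((q\<^sup>2) powi (2 * n\<^sup>2 + i\<^sup>2 - 2 * i * n) * r i * w (q ^ 4) n)
      + B * ((- (q\<^sup>2)) powi (2 * n\<^sup>2 + i\<^sup>2 - 2 * i * n) * r i * w (q ^ 4) n)
      = (q\<^sup>2) powi (2 * n\<^sup>2 + i\<^sup>2 - 2 * i * n) * (r i * w (q ^ 4) n) * (A + B * (-1) powi i)" for A B n i
    unfolding s by (simp only: distrib_left distrib_right mult_ac)
  thus ?thesis
    using has_sum_add[OF has_sum_cmult_right[OF assms[OF q_nonzero(5,6)], of "th_mean"]
       has_sum_cmult_right[OF assms[OF n], of "th_diff a"]]
    by (simp only: power2_minus q_nonzero(4) case_prod_unfold)
qed

text \<open>The three inner double sums, one for each family of parameters. Even and odd values of \<open>j\<close> are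
  \<open>2 n\<close> and \<open>2 n + 1\<close>, or \<open>2 n - 1\<close> in \<open>reduced_sum_weight_2j_2i\<close>, where completing the square
  in the exponent calls for the latter.\<close>

lemma reduced_sum_plain:
  "((\<lambda>(i, j). q powi (i\<^sup>2 + (j - i)\<^sup>2) * (r i * r j) * (theta q (i - a) * theta q (j - i - a)))
     has_sum combined a (q * int_val (q\<^sup>2) 4) (half_val (q\<^sup>2) 3) (half_val (- (q\<^sup>2)) 3)) UNIV"
proof -
  have e: "q powi (i\<^sup>2 + (2 * n - i)\<^sup>2) = (q\<^sup>2) powi (2 * n\<^sup>2 + i\<^sup>2 - 2 * i * n)" for i n
    unfolding power_int_power by (rule arg_cong[where f = "power_int q"]) (simp add: power2_eq_square algebra_simps)
  have o: "q powi (i\<^sup>2 + (2 * n + 1 - i)\<^sup>2) = q * (q\<^sup>2) powi (2 * n\<^sup>2 + 2 * n + i\<^sup>2 - i - 2 * i * n)" for i n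
  proof -
    have "q powi 1 * (q\<^sup>2) powi (2 * n\<^sup>2 + 2 * n + i\<^sup>2 - i - 2 * i * n) = q powi (i\<^sup>2 + (2 * n + 1 - i)\<^sup>2)"
      unfolding power_int_power using q_nonzero(1) by (rule powi_mult_eq) (simp add: power2_eq_square algebra_simps)
    thus ?thesis by simp
  qed
  define f where "f = (\<lambda>(i, j). q powi (i\<^sup>2 + (j - i)\<^sup>2) * (r i * r j) * (theta q (i - a) * theta q (j - i - a)))"
  have E: "f (i, 2 * n) = (q\<^sup>2) powi (2 * n\<^sup>2 + i\<^sup>2 - 2 * i * n) * (r i * r (2 * n))
      * (th_mean + th_diff a * (-1) powi i)" for i n
    unfolding f_def prod.case e theta_square_split by (simp only: mult_ac)
  have O: "f (i, 2 * n + 1) = th0 * th1 * q * ((q\<^sup>2) powi (2 * n\<^sup>2 + 2 * n + i\<^sup>2 - i - 2 * i * n) * r i * r (2 * n + 1))" for i n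
    unfolding f_def prod.case o theta_mixed by (simp only: mult_ac)
  have "((\<lambda>(n, i). f (i, 2 * n)) has_sum (th_mean * half_val (q\<^sup>2) 3 + th_diff a * half_val (- (q\<^sup>2)) 3)) UNIV"
    unfolding E by (rule has_sum_theta_squares_split[of "\<lambda>Q n. rqfact Q (2 * n)" "\<lambda>x. half_val x 3"]) (rule double_sum_even)
  moreover have "((\<lambda>(n, i). f (i, 2 * n + 1)) has_sum th0 * th1 * q * int_val (q\<^sup>2) 4) UNIV"
    unfolding O using has_sum_cmult_right[OF double_sum_odd[OF q_nonzero(5,6)], of "th0 * th1 * q"]
    by (simp only: q_nonzero(4) case_prod_unfold)
  ultimately have "(f has_sum (th_mean * half_val (q\<^sup>2) 3
      + th_diff a * half_val (- (q\<^sup>2)) 3 + th0 * th1 * q * int_val (q\<^sup>2) 4)) UNIV"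
    by (rule has_sum_parity_split)
  thus ?thesis by (simp add: combined_def f_def algebra_simps)
qed

lemma reduced_sum_weight_2j:
  "((\<lambda>(i, j). q powi (i\<^sup>2 + (j - i)\<^sup>2 + 2 * j) * (r i * r j) * (theta q (i - a) * theta q (j - i - a)))
     has_sum combined a (q ^ 3 * int_val (q\<^sup>2) 6) (half_val (q\<^sup>2) 1) (half_val (- (q\<^sup>2)) 1)) UNIV"
proof -
  have e: "q powi (i\<^sup>2 + (2 * n - i)\<^sup>2 + 2 * (2 * n)) = (q\<^sup>2) powi (2 * n\<^sup>2 + i\<^sup>2 - 2 * i * n) * (q ^ 4) powi n" for i n
    unfolding power_int_power by (rule powi_mult_eq[OF q_nonzero(1), symmetric]) (simp add: power2_eq_square algebra_simps)
  have o: "q powi (i\<^sup>2 + (2 * n + 1 - i)\<^sup>2 + 2 * (2 * n + 1)) =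
      q ^ 3 * (q\<^sup>2) powi (2 * n\<^sup>2 + 2 * n + i\<^sup>2 - i - 2 * i * n) * (q ^ 4) powi n" for i n
  proof -
    have "q powi 3 * (q\<^sup>2) powi (2 * n\<^sup>2 + 2 * n + i\<^sup>2 - i - 2 * i * n) * (q ^ 4) powi n
        = q powi (i\<^sup>2 + (2 * n + 1 - i)\<^sup>2 + 2 * (2 * n + 1))"
      unfolding power_int_power powi_mult_eq[OF q_nonzero(1) refl]
      by (rule arg_cong[where f = "power_int q"]) (simp add: power2_eq_square algebra_simps)
    thus ?thesis by simp
  qed
  define f where "f = (\<lambda>(i, j). q powi (i\<^sup>2 + (j - i)\<^sup>2 + 2 * j) * (r i * r j) * (theta q (i - a) * theta q (j - i - a)))"
  have E: "f (i, 2 * n) = (q\<^sup>2) powi (2 * n\<^sup>2 + i\<^sup>2 - 2 * i * n) * (r i * ((q ^ 4) powi n * r (2 * n)))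
      * (th_mean + th_diff a * (-1) powi i)" for i n
    unfolding f_def prod.case e theta_square_split by (simp only: mult_ac)
  have O: "f (i, 2 * n + 1) = th0 * th1 * q ^ 3 * ((q\<^sup>2) powi (2 * n\<^sup>2 + 2 * n + i\<^sup>2 - i - 2 * i * n) * r i * ((q ^ 4) powi n * r (2 * n + 1)))" for i n
    unfolding f_def prod.case o theta_mixed by (simp only: mult_ac)
  have "((\<lambda>(n, i). f (i, 2 * n)) has_sum (th_mean * half_val (q\<^sup>2) 1 + th_diff a * half_val (- (q\<^sup>2)) 1)) UNIV"
    unfolding E by (rule has_sum_theta_squares_split[of "\<lambda>Q n. Q powi n * rqfact Q (2 * n)" "\<lambda>x. half_val x 1"]) (rule double_sum_even_weighted)
  moreover have "((\<lambda>(n, i). f (i, 2 * n + 1)) has_sum th0 * th1 * q ^ 3 * int_val (q\<^sup>2) 6) UNIV"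
    unfolding O using has_sum_cmult_right[OF double_sum_odd_weighted[OF q_nonzero(5,6)], of "th0 * th1 * q ^ 3"]
    by (simp only: q_nonzero(4) case_prod_unfold)
  ultimately have "(f has_sum (th_mean * half_val (q\<^sup>2) 1
      + th_diff a * half_val (- (q\<^sup>2)) 1 + th0 * th1 * q ^ 3 * int_val (q\<^sup>2) 6)) UNIV"
    by (rule has_sum_parity_split)
  thus ?thesis by (simp add: combined_def f_def algebra_simps)
qed

lemma reduced_sum_weight_2j_2i:
  "((\<lambda>(i, j). q powi (i\<^sup>2 + (j - i)\<^sup>2 + 2 * (j - i)) * (r i * r j) * (theta q (i - a) * theta q (j - i - (a - 1))))
     has_sum combined a (int_val (q\<^sup>2) 2) (q * half_val (q\<^sup>2) 5) (- q * half_val (- (q\<^sup>2)) 5)) UNIV"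
proof -
  have e: "q powi (i\<^sup>2 + (2 * n - i)\<^sup>2 + 2 * (2 * n - i)) = (q\<^sup>2) powi (2 * n\<^sup>2 + 2 * n + i\<^sup>2 - i - 2 * i * n)" for i n
    unfolding power_int_power by (rule arg_cong[where f = "power_int q"]) (simp add: power2_eq_square algebra_simps)
  have o: "q powi (i\<^sup>2 + (2 * n - 1 - i)\<^sup>2 + 2 * (2 * n - 1 - i)) = inverse q * (q\<^sup>2) powi (2 * n\<^sup>2 + i\<^sup>2 - 2 * i * n)" for i n
  proof -
    have "q powi (-1) * (q\<^sup>2) powi (2 * n\<^sup>2 + i\<^sup>2 - 2 * i * n) = q powi (i\<^sup>2 + (2 * n - 1 - i)\<^sup>2 + 2 * (2 * n - 1 - i))"
      unfolding power_int_power using q_nonzero(1) by (rule powi_mult_eq) (simp add: power2_eq_square algebra_simps)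
    thus ?thesis by simp
  qed
  define f where "f = (\<lambda>(i, j). q powi (i\<^sup>2 + (j - i)\<^sup>2 + 2 * (j - i)) * (r i * r j) * (theta q (i - a) * theta q (j - i - (a - 1))))"
  let ?V = "th_mean * (q\<^sup>2 * half_val (q\<^sup>2) 5) + th_diff a * (- (q\<^sup>2) * half_val (- (q\<^sup>2)) 5)"
  have E: "f (i, 2 * n) = th0 * th1 * ((q\<^sup>2) powi (2 * n\<^sup>2 + 2 * n + i\<^sup>2 - i - 2 * i * n) * r i * r (2 * n))" for i n
    unfolding f_def prod.case e theta_mixed by (simp only: mult_ac)
  have O: "f (i, 2 * n - 1) = inverse q * ((q\<^sup>2) powi (2 * n\<^sup>2 + i\<^sup>2 - 2 * i * n) * (r i * r (2 * n - 1))
      * (th_mean + th_diff a * (-1) powi i))" for i n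
    unfolding f_def prod.case o theta_square_split by (simp only: mult_ac)
  have "((\<lambda>(n, i). (q\<^sup>2) powi (2 * n\<^sup>2 + i\<^sup>2 - 2 * i * n) * (r i * r (2 * n - 1))
      * (th_mean + th_diff a * (-1) powi i)) has_sum ?V) UNIV"
    by (rule has_sum_theta_squares_split[of "\<lambda>Q n. rqfact Q (2 * n - 1)" "\<lambda>x. x * half_val x 5"]) (rule double_sum_odd_shifted)
  hence "((\<lambda>(n, i). f (i, 2 * n - 1)) has_sum inverse q * ?V) UNIV"
    unfolding O by (simp only: case_prod_unfold has_sum_cmult_right)
  also have "?this \<longleftrightarrow> ((\<lambda>(n, i). f (i, 2 * n + 1)) has_sum inverse q * ?V) UNIV"
    by (rule has_sum_reindex_bij_witness[of _ "\<lambda>(n, i). (n + 1, i)" "\<lambda>(n, i). (n - 1, i)"])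
       (auto simp: algebra_simps)
  finally have "((\<lambda>(n, i). f (i, 2 * n + 1)) has_sum inverse q * ?V) UNIV" .
  moreover have "((\<lambda>(n, i). f (i, 2 * n)) has_sum th0 * th1 * int_val (q\<^sup>2) 2) UNIV"
    unfolding E using has_sum_cmult_right[OF double_sum_even_shifted[OF q_nonzero(5,6)], of "th0 * th1"]
    by (simp only: q_nonzero(4) case_prod_unfold)
  ultimately have "(f has_sum (th0 * th1 * int_val (q\<^sup>2) 2 + inverse q * ?V)) UNIV"
    using has_sum_parity_split by blast
  moreover have "th0 * th1 * int_val (q\<^sup>2) 2 + inverse q * ?V =
      combined a (int_val (q\<^sup>2) 2) (q * half_val (q\<^sup>2) 5) (- q * half_val (- (q\<^sup>2)) 5)"
    using q_nonzero(1) by (simp add: combined_def field_simps power2_eq_square)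
  ultimately show ?thesis by (simp add: f_def)
qed

definition prefactor :: "int \<Rightarrow> complex" where
  "prefactor c = qpoch_inf (- (q powi (2 + c))) (q ^ 4) / (qpoch_inf (q ^ 4) (q ^ 4))\<^sup>2"

text \<open>The definition of \<open>S\<close> sums over functions on \<open>{..<5}\<close>; these are identified with quintuples of integers, and the terms
  with a negative entry vanish.\<close>

lemma S_eq_infsum:
  "S q (of_int a) (of_int b) (of_int c / 4) = infsum (tadpole_term a b c) UNIV"
proof -
  let ?x = "(!) [q powr of_real (4 * of_int a), q powr of_real (- 4 * of_int a),
          q powr of_real (4 * of_int b), q powr of_real (- 4 * of_int b), q powr of_real (4 * (of_int c / 4))]"
  let ?f = "\<lambda>n. (q\<^sup>2) powi tadpole_form 5 n * (\<Prod>i<5. ?x i ^ n i) / (\<Prod>i<5. qpoch ((q\<^sup>2)\<^sup>2) ((q\<^sup>2)\<^sup>2) (n i))"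
  have pw: "q powr of_real (of_int k) = q powi k" for k
    using complex_powr_of_int[of q k] q_nonzero(1) by simp
  have five: "{..<5} = {0, 1, 2, 3, 4 :: nat}" by auto
  let ?B = "{(n1, n2, n3, n4, n5). n1 \<ge> (0::int) \<and> n2 \<ge> (0::int) \<and> n3 \<ge> (0::int) \<and> n4 \<ge> (0::int) \<and> n5 \<ge> (0::int)}"
  have "S q (of_int a) (of_int b) (of_int c / 4) = infsum ?f ({..<5} \<rightarrow>\<^sub>E UNIV)"
    unfolding S_def tadpole_nahm_def ..
  also have "\<dots> = infsum (tadpole_term a b c) ?B"
  proof (rule infsum_reindex_bij_witness[of _
        "\<lambda>(n1, n2, n3, n4, n5). \<lambda>i\<in>{..<5}. nat ([n1, n2, n3, n4, n5] ! i)"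
        "\<lambda>n. (int (n 0), int (n 1), int (n 2), int (n 3), int (n 4))"])
    fix n :: "nat \<Rightarrow> nat" assume n: "n \<in> {..<5} \<rightarrow>\<^sub>E UNIV"
    show "(case (int (n 0), int (n 1), int (n 2), int (n 3), int (n 4)) of (n1, n2, n3, n4, n5) \<Rightarrow>
             \<lambda>i\<in>{..<5}. nat ([n1, n2, n3, n4, n5] ! i)) = n"
    proof
      fix i show "(case (int (n 0), int (n 1), int (n 2), int (n 3), int (n 4)) of (n1, n2, n3, n4, n5) \<Rightarrow>
             \<lambda>i\<in>{..<5}. nat ([n1, n2, n3, n4, n5] ! i)) i = n i"
      proof (cases "i < 5")
        case True
        hence "i \<in> {0, 1, 2, 3, 4}" by auto
        thus ?thesis by auto
      next
        case False
        thus ?thesis using PiE_arb[OF n, of i] by simp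
      qed
    qed
    have form: "tadpole_form 5 n = (int (n 0))\<^sup>2 + (int (n 0) - int (n 1))\<^sup>2 + (int (n 1) - int (n 2))\<^sup>2
        + (int (n 2) - int (n 3))\<^sup>2 + (int (n 3) - int (n 4))\<^sup>2"
      unfolding tadpole_form_def five by (simp add: tadpole_def power2_eq_square algebra_simps)
    have "?f n = tadpole_term a b c (int (n 0), int (n 1), int (n 2), int (n 3), int (n 4))"
    proof -
      have "(\<Prod>i<5. ?x i ^ n i) = q powi (4 * a * (int (n 0) - int (n 1)) + 4 * b * (int (n 2) - int (n 3)) + c * int (n 4))"
      proof -
        have "(\<Prod>i<5. ?x i ^ n i) = (q powi (4 * a)) ^ n 0 * ((q powi (- 4 * a)) ^ n 1 * ((q powi (4 * b)) ^ n 2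
           * ((q powi (- 4 * b)) ^ n 3 * (q powi c) ^ n 4)))"
          unfolding five using pw[of "4 * a"] pw[of "- 4 * a"] pw[of "4 * b"] pw[of "- 4 * b"] pw[of c]
          by simp
        also have "\<dots> = q powi (4 * a * (int (n 0) - int (n 1)) + 4 * b * (int (n 2) - int (n 3)) + c * int (n 4))"
          unfolding power_int_power' powi_mult_eq[OF q_nonzero(1) refl]
          by (rule arg_cong[where f = "power_int q"]) (simp add: algebra_simps)
        finally show ?thesis .
      qed
      moreover have "1 / (\<Prod>i<5. qpoch ((q\<^sup>2)\<^sup>2) ((q\<^sup>2)\<^sup>2) (n i)) =
          r (int (n 0)) * r (int (n 1)) * r (int (n 2)) * r (int (n 3)) * r (int (n 4))"
        unfolding five q_nonzero(4) by (simp add: rqfact_of_nat field_simps)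
      moreover have "(q\<^sup>2) powi tadpole_form 5 n * q powi (4 * a * (int (n 0) - int (n 1)) + 4 * b * (int (n 2) - int (n 3)) + c * int (n 4))
         = q powi (2 * ((int (n 0))\<^sup>2 + (int (n 0) - int (n 1))\<^sup>2 + (int (n 1) - int (n 2))\<^sup>2 + (int (n 2) - int (n 3))\<^sup>2 + (int (n 3) - int (n 4))\<^sup>2)
            + 4 * a * (int (n 0) - int (n 1)) + 4 * b * (int (n 2) - int (n 3)) + c * int (n 4))"
        unfolding form power_int_power powi_mult_eq[OF q_nonzero(1) refl]
        by (rule arg_cong[where f = "power_int q"]) simp
      ultimately show ?thesis
        unfolding tadpole_term_def prod.case by (simp only: divide_inverse mult_1_left)
    qed
    thus "tadpole_term a b c (int (n 0), int (n 1), int (n 2), int (n 3), int (n 4)) = ?f n" ..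
  qed (auto split: if_splits)
  also have "\<dots> = infsum (tadpole_term a b c) UNIV"
  proof (rule infsum_cong_neutral)
    fix x assume B: "x \<in> UNIV - ?B"
    obtain n1 n2 n3 n4 n5 where x: "x = (n1, n2, n3, n4, n5)"
      by (cases x)
    have "n1 < 0 \<or> n2 < 0 \<or> n3 < 0 \<or> n4 < 0 \<or> n5 < 0"
      using B by (simp add: x not_le)
    thus "tadpole_term a b c x = 0" by (elim disjE) (simp_all add: x tadpole_term_def)
  qed auto
  finally show ?thesis .
qed

text \<open>In the family \<open>(a, a, a/2)\<close> the linear terms \<open>-2 a i - 2 a (j - i) + 2 a j\<close> of the exponent cancel. In the next two
  families they reduce to \<open>2 j\<close> and to \<open>2 (j - i)\<close>.\<close>

lemma S_diagonal: "S q (of_int a) (of_int a) (of_int a / 2) = prefactor (2 * a) * q powi (- (2 * a\<^sup>2))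
    * combined a (q * int_val (q\<^sup>2) 4) (half_val (q\<^sup>2) 3) (half_val (- (q\<^sup>2)) 3)"
proof -
  have "i\<^sup>2 - 2 * a * i + (j - i)\<^sup>2 - 2 * a * (j - i) + 2 * a * j = i\<^sup>2 + (j - i)\<^sup>2" for i j
    by (simp add: algebra_simps)
  from rank_reduction[of a a "2 * a", unfolded this, OF reduced_sum_plain] S_eq_infsum[of a a "2 * a"]
  show ?thesis by (simp add: prefactor_def infsumI)
qed

lemma S_diagonal_shifted: "S q (of_int a) (of_int a) ((of_int a + 1) / 2) = prefactor (2 * a + 2) * q powi (- (2 * a\<^sup>2))
    * combined a (q ^ 3 * int_val (q\<^sup>2) 6) (half_val (q\<^sup>2) 1) (half_val (- (q\<^sup>2)) 1)"
proof -
  have "i\<^sup>2 - 2 * a * i + (j - i)\<^sup>2 - 2 * a * (j - i) + (2 * a + 2) * j = i\<^sup>2 + (j - i)\<^sup>2 + 2 * j" for i j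
    by (simp add: algebra_simps)
  from rank_reduction[of a a "2 * a + 2", unfolded this, OF reduced_sum_weight_2j] S_eq_infsum[of a a "2 * a + 2"]
  show ?thesis by (simp add: prefactor_def infsumI add_divide_distrib)
qed

lemma S_off_diagonal: "S q (of_int a) (of_int a - 1) (of_int a / 2) = prefactor (2 * a) * q powi (- (a\<^sup>2 + (a - 1)\<^sup>2))
    * combined a (int_val (q\<^sup>2) 2) (q * half_val (q\<^sup>2) 5) (- q * half_val (- (q\<^sup>2)) 5)"
proof -
  have "i\<^sup>2 - 2 * a * i + (j - i)\<^sup>2 - 2 * (a - 1) * (j - i) + 2 * a * j = i\<^sup>2 + (j - i)\<^sup>2 + 2 * (j - i)" for i j
    by (simp add: algebra_simps)
  from rank_reduction[of a "a - 1" "2 * a", unfolded this, OF reduced_sum_weight_2j_2i] S_eq_infsum[of a "a - 1" "2 * a"]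
  show ?thesis by (simp add: prefactor_def infsumI)
qed

end

section \<open>Evaluation in terms of eta quotients\<close>

lemma qpoch_inf_odd:
  assumes "norm x < 1"
  shows "qpoch_inf x (x\<^sup>2) = qpoch_inf x x / qpoch_inf (x\<^sup>2) (x\<^sup>2)"
  using qpoch_inf_split[OF assms, of x] qpoch_inf_nonzero[of "x\<^sup>2" "x\<^sup>2"] norm_square_less_1[OF assms]
  by (simp add: power2_eq_square)

lemma qpoch_inf_minus_same:
  assumes "norm x < 1"
  shows "qpoch_inf (- x) x = qpoch_inf (x\<^sup>2) (x\<^sup>2) / qpoch_inf x x"
  using qpoch_inf_plus_minus[OF assms, of x] qpoch_inf_nonzero[OF assms assms]
  by (simp add: field_simps)

lemma qpoch_inf_minus_odd:
  assumes "norm x < 1"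
  shows "qpoch_inf (- x) (x\<^sup>2) = (qpoch_inf (x\<^sup>2) (x\<^sup>2))\<^sup>2 / (qpoch_inf x x * qpoch_inf (x ^ 4) (x ^ 4))"
proof -
  have n2: "norm (x\<^sup>2) < 1" by (rule norm_square_less_1[OF assms])
  have n4: "norm (x ^ 4) < 1" using norm_square_less_1[OF n2] by (simp flip: power_mult)
  note nz = qpoch_inf_nonzero[OF assms assms] qpoch_inf_nonzero[OF n2 n2] qpoch_inf_nonzero[OF n4 n4]
  have "qpoch_inf x (x\<^sup>2) * qpoch_inf (- x) (x\<^sup>2) = qpoch_inf (x\<^sup>2) (x\<^sup>2) / qpoch_inf (x ^ 4) (x ^ 4)"
    using qpoch_inf_plus_minus[OF n2, of x] qpoch_inf_odd[OF n2] by (simp flip: power_mult)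
  thus ?thesis
    unfolding qpoch_inf_odd[OF assms] using nz by (simp add: field_simps power2_eq_square)
qed

context tadpole_sum
begin

lemma norm_q_power: "m > 0 \<Longrightarrow> norm (q ^ m) < 1"
  using q by (simp add: norm_power power_less_one_iff)

lemma J_nonzero: "m > 0 \<Longrightarrow> J q m \<noteq> 0"
  unfolding J_def by (intro qpoch_inf_nonzero norm_q_power)

lemma qpoch_q_nonzero: "a > 0 \<Longrightarrow> m > 0 \<Longrightarrow> qpoch_inf (q ^ a) (q ^ m) \<noteq> 0"
  by (rule qpoch_inf_nonzero[OF norm_q_power norm_q_power])

lemma qpoch_eq_J:
  "qpoch_inf (- q) (q\<^sup>2) = (J q 2)\<^sup>2 / (J q 1 * J q 4)"
  "qpoch_inf q (q\<^sup>2) = J q 1 / J q 2"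
  "qpoch_inf (- (q\<^sup>2)) (q ^ 4) = (J q 4)\<^sup>2 / (J q 2 * J q 8)"
  "qpoch_inf (q\<^sup>2) (q ^ 4) = J q 2 / J q 4"
  "qpoch_inf (- (q ^ 4)) (q ^ 4) = J q 8 / J q 4"
  "qpoch_inf (- 1) (q ^ 4) = 2 * (J q 8 / J q 4)"
proof -
  note n = norm_q_power[of 1] norm_q_power[of 2] norm_q_power[of 4]
  show "qpoch_inf (- q) (q\<^sup>2) = (J q 2)\<^sup>2 / (J q 1 * J q 4)" "qpoch_inf q (q\<^sup>2) = J q 1 / J q 2"
    using qpoch_inf_minus_odd[of q] qpoch_inf_odd[of q] q by (simp_all add: J_def)
  show "qpoch_inf (- (q\<^sup>2)) (q ^ 4) = (J q 4)\<^sup>2 / (J q 2 * J q 8)" "qpoch_inf (q\<^sup>2) (q ^ 4) = J q 2 / J q 4"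
    using qpoch_inf_minus_odd[of "q\<^sup>2"] qpoch_inf_odd[of "q\<^sup>2"] n by (simp_all add: J_def flip: power_mult)
  show m: "qpoch_inf (- (q ^ 4)) (q ^ 4) = J q 8 / J q 4"
    using qpoch_inf_minus_same[of "q ^ 4"] n by (simp add: J_def flip: power_mult)
  show "qpoch_inf (- 1) (q ^ 4) = 2 * (J q 8 / J q 4)"
    unfolding m[symmetric] using qpoch_inf_rec[of "q ^ 4" "-1"] n by simp
qed

lemma theta_product_eq_J: "th0 * th1 = 2 * q * (J q 8 ^ 4 / J q 4 ^ 2)"
proof -
  have n: "0 < norm (q ^ 4)" "norm (q ^ 4) < 1" "norm (q ^ 8) < 1" "q powi (-4) \<noteq> 0"
    using q by (auto simp: norm_power power_less_one_iff)
  have "((\<lambda>d. (q ^ 4) powi (d\<^sup>2) * 1 powi d) has_sum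
      (qpoch_inf (- (q ^ 4)) (q ^ 8) * qpoch_inf (- (q ^ 4)) (q ^ 8) * qpoch_inf (q ^ 8) (q ^ 8))) UNIV"
    using jacobi_triple_product[OF n(1,2), of 1] by (simp flip: power_mult)
  moreover have "(q ^ 4) powi (d\<^sup>2) * 1 powi d = q powi ((2 * d - 0)\<^sup>2)" for d
    by (simp add: power_int_power power2_eq_square)
  ultimately have t0: "th0 = qpoch_inf (- (q ^ 4)) (q ^ 8) * qpoch_inf (- (q ^ 4)) (q ^ 8) * qpoch_inf (q ^ 8) (q ^ 8)"
    using has_sum_unique[OF has_sum_theta[OF q, of 0]] by simp
  have z: "q ^ 4 * q powi (-4) = 1" "q ^ 4 / q powi (-4) = q ^ 8"
    using q_nonzero(1) by (simp_all add: power_int_minus field_simps flip: power_add)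
  have "((\<lambda>d. (q ^ 4) powi (d\<^sup>2) * (q powi (-4)) powi d) has_sum
      (qpoch_inf (- 1) (q ^ 8) * qpoch_inf (- (q ^ 8)) (q ^ 8) * qpoch_inf (q ^ 8) (q ^ 8))) UNIV"
    using jacobi_triple_product[OF n(1,2,4)] z by (simp flip: power_mult)
  from has_sum_cmult_right[OF this, of "q powi 1"]
  have "((\<lambda>d. q powi 1 * ((q ^ 4) powi (d\<^sup>2) * (q powi (-4)) powi d)) has_sum
      q * (qpoch_inf (- 1) (q ^ 8) * qpoch_inf (- (q ^ 8)) (q ^ 8) * qpoch_inf (q ^ 8) (q ^ 8))) UNIV"
    by simp
  moreover have "q powi 1 * ((q ^ 4) powi (d\<^sup>2) * (q powi (-4)) powi d) = q powi ((2 * d - 1)\<^sup>2)" for d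
    unfolding power_int_power power_int_mult[symmetric] powi_mult_eq[OF q_nonzero(1) refl]
    by (rule arg_cong[where f = "power_int q"]) (simp add: power2_eq_square algebra_simps)
  ultimately have "th1 = q * (qpoch_inf (- 1) (q ^ 8) * qpoch_inf (- (q ^ 8)) (q ^ 8) * qpoch_inf (q ^ 8) (q ^ 8))"
    using has_sum_unique[OF has_sum_theta[OF q, of 1]] by simp
  also have "qpoch_inf (- 1) (q ^ 8) = 2 * qpoch_inf (- (q ^ 8)) (q ^ 8)"
    using qpoch_inf_rec[OF n(3), of "-1"] by simp
  finally have t1: "th1 = q * (2 * qpoch_inf (- (q ^ 8)) (q ^ 8) * qpoch_inf (- (q ^ 8)) (q ^ 8) * qpoch_inf (q ^ 8) (q ^ 8))" .
  have "qpoch_inf (- (q ^ 4)) (q ^ 8) * qpoch_inf (- (q ^ 8)) (q ^ 8) = J q 8 / J q 4"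
    using qpoch_inf_split[OF n(2), of "- (q ^ 4)"] by (simp add: qpoch_eq_J(5) flip: power_mult power_add)
  moreover have "th0 * th1 = 2 * q * ((qpoch_inf (- (q ^ 4)) (q ^ 8) * qpoch_inf (- (q ^ 8)) (q ^ 8)) ^ 2 * J q 8 ^ 2)"
    unfolding t0 t1 J_def by (simp only: power2_eq_square mult_ac)
  ultimately have "th0 * th1 = 2 * q * ((J q 8 / J q 4) ^ 2 * J q 8 ^ 2)"
    by simp
  thus ?thesis
    by (simp add: power_divide flip: power_add)
qed

text \<open>Even and odd \<open>n\<close> in \<open>\<Sum>\<^sub>n (\<plusminus>1)\<^sup>n q\<^bsup>n\<^sup>2\<^esup>\<close> contribute \<open>th0\<close> and \<open>\<plusminus>th1\<close>; the triple product evaluates both series.\<close>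

lemma theta_sum_diff_eq_J:
  "th0 + th1 = J q 2 ^ 5 / (J q 1 ^ 2 * J q 4 ^ 2)"
  "th0 - th1 = J q 1 ^ 2 / J q 2"
proof -
  have split: "(g has_sum (A + B)) UNIV"
    if "((\<lambda>d. g (2 * d - 0)) has_sum A) UNIV" "((\<lambda>d. g (2 * d - 1)) has_sum B) UNIV" for g :: "int \<Rightarrow> complex" and A B
  proof -
    have "((\<lambda>d. g (2 * d - 0)) has_sum A) UNIV \<longleftrightarrow> (g has_sum A) {n. even n}"
      by (rule has_sum_reindex_bij_witness[of _ "\<lambda>n. n div 2" "\<lambda>d. 2 * d"]) auto
    moreover have "((\<lambda>d. g (2 * d - 1)) has_sum B) UNIV \<longleftrightarrow> (g has_sum B) {n. odd n}"
      by (rule has_sum_reindex_bij_witness[of _ "\<lambda>n. (n + 1) div 2" "\<lambda>d. 2 * d - 1"]) (auto elim!: oddE)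
    ultimately have "(g has_sum (A + B)) ({n. even n} \<union> {n. odd n})"
      using that by (intro has_sum_Un_disjoint) auto
    also have "{n. even n} \<union> {n. odd n} = (UNIV :: int set)" by auto
    finally show ?thesis .
  qed
  have J: "J q 1 \<noteq> 0" "J q 2 \<noteq> 0" "J q 4 \<noteq> 0" by (intro J_nonzero; simp)+
  have "((\<lambda>n. q powi (n\<^sup>2) * 1 powi n) has_sum (th0 + th1)) UNIV"
    by (rule split) (use has_sum_theta[OF q, of 0] has_sum_theta[OF q, of 1] in simp_all)
  moreover have "((\<lambda>n. q powi (n\<^sup>2) * 1 powi n) has_sum
       (qpoch_inf (- q) (q\<^sup>2) * qpoch_inf (- q) (q\<^sup>2) * J q 2)) UNIV"
    using jacobi_triple_product[OF q, of 1] by (simp add: J_def)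
  ultimately have "th0 + th1 = qpoch_inf (- q) (q\<^sup>2) * qpoch_inf (- q) (q\<^sup>2) * J q 2"
    by (rule has_sum_unique)
  moreover have "B\<^sup>2 / (A * C) * (B\<^sup>2 / (A * C)) * B = B ^ 5 / (A\<^sup>2 * C\<^sup>2)" for A B C :: complex
    by (simp add: eval_nat_numeral mult_ac)
  ultimately show "th0 + th1 = J q 2 ^ 5 / (J q 1 ^ 2 * J q 4 ^ 2)"
    unfolding qpoch_eq_J by simp
  have "((\<lambda>n. q powi (n\<^sup>2) * (-1) powi n) has_sum (th0 + - th1)) UNIV"
    by (rule split) (use has_sum_theta[OF q, of 0] has_sum_theta[OF q, of 1] in \<open>simp_all add: minus_one_powi has_sum_uminusI\<close>)
  moreover have "((\<lambda>n. q powi (n\<^sup>2) * (-1) powi n) has_sum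
       (qpoch_inf q (q\<^sup>2) * qpoch_inf q (q\<^sup>2) * J q 2)) UNIV"
    using jacobi_triple_product[OF q, of "-1"] by (simp add: J_def)
  ultimately have "th0 + - th1 = qpoch_inf q (q\<^sup>2) * qpoch_inf q (q\<^sup>2) * J q 2"
    by (rule has_sum_unique)
  thus "th0 - th1 = J q 1 ^ 2 / J q 2"
    using J unfolding qpoch_eq_J by (simp add: power2_eq_square)
qed

text \<open>The values of \<open>quint_prod\<close> at \<open>q\<^sup>2\<close> and at \<open>-q\<^sup>2\<close>, expressed by \<open>J\<close> and \<open>JJ\<close>.\<close>

definition quint_J where "quint_J k = JJ q (2 * k) 28 * JJ q (28 - 4 * k) 56 / J q 56"
definition quint_J_neg where
  "quint_J_neg k = J q 28 ^ 2 * JJ q (4 * k) 56 * JJ q (28 - 4 * k) 56 / (J q 56 ^ 2 * JJ q (2 * k) 28)"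

lemma quint_prod_eq_J:
  assumes "k \<le> 7"
  shows "quint_prod (q\<^sup>2) k = quint_J k"
proof -
  have e: "2 * (14 - k) = 28 - 2 * k" "2 * (14 + 2 * k) = 56 - (28 - 4 * k)" "2 * (14 - 2 * k) = 28 - 4 * k"
    using assms by auto
  have pw: "(q\<^sup>2) ^ k = q ^ (2 * k)" "(q\<^sup>2) ^ (14 - k) = q ^ (28 - 2 * k)"
    "(q\<^sup>2) ^ 14 = q ^ 28" "(q\<^sup>2) ^ 28 = q ^ 56"
    "(q\<^sup>2) ^ (14 + 2 * k) = q ^ (56 - (28 - 4 * k))" "(q\<^sup>2) ^ (14 - 2 * k) = q ^ (28 - 4 * k)"
    unfolding power_mult[symmetric] e by simp_all
  have "a * b * c * (s * t) = a * b * c * (t * s * x) / x" if "x \<noteq> 0" for a b c s t x :: complex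
    using that by simp
  from this[OF qpoch_q_nonzero[of 56 56]] show ?thesis
    unfolding quint_prod_def pw quint_J_def JJ_def J_def by simp
qed

text \<open>For odd \<open>k\<close> only the factors with arguments \<open>p\<^sup>k\<close> and \<open>p\<^bsup>14-k\<^esup>\<close> change sign at \<open>p = -q\<^sup>2\<close>, and
  \<open>(-x; q\<^bsup>28\<^esup>)\<^sub>\<infinity> = (x\<^sup>2; q\<^bsup>56\<^esup>)\<^sub>\<infinity> / (x; q\<^bsup>28\<^esup>)\<^sub>\<infinity>\<close>.\<close>

lemma quint_prod_neg_eq_J:
  assumes "k \<le> 7" "odd k"
  shows "quint_prod (- (q\<^sup>2)) k = quint_J_neg k"
proof -
  have k: "0 < k" "k < 14" using assms by (auto intro: Nat.gr0I)
  have e: "2 * (14 - k) = 28 - 2 * k" "2 * (14 + 2 * k) = 56 - (28 - 4 * k)" "2 * (14 - 2 * k) = 28 - 4 * k"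
    using assms by auto
  have pw: "(- (q\<^sup>2)) ^ k = - (q ^ (2 * k))" "(- (q\<^sup>2)) ^ (14 - k) = - (q ^ (28 - 2 * k))"
    "(- (q\<^sup>2)) ^ 14 = q ^ 28" "(- (q\<^sup>2)) ^ 28 = q ^ 56"
    "(- (q\<^sup>2)) ^ (14 + 2 * k) = q ^ (56 - (28 - 4 * k))" "(- (q\<^sup>2)) ^ (14 - 2 * k) = q ^ (28 - 4 * k)"
    using assms unfolding power_minus[of "q\<^sup>2"] power_mult[symmetric] e by simp_all
  have dbl: "qpoch_inf (- (q ^ a)) (q ^ 28) = qpoch_inf (q ^ (2 * a)) (q ^ 56) / qpoch_inf (q ^ a) (q ^ 28)" if "a > 0" for a
  proof -
    have "qpoch_inf (q ^ a) (q ^ 28) * qpoch_inf (- (q ^ a)) (q ^ 28) = qpoch_inf (q ^ (2 * a)) (q ^ 56)"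
      using qpoch_inf_plus_minus[OF norm_q_power[of 28], of "q ^ a"] by (simp flip: power_mult add: mult.commute)
    thus ?thesis
      using qpoch_inf_nonzero[OF norm_q_power[of 28] norm_q_power[OF that]] by (simp add: field_simps)
  qed
  have f: "2 * (2 * k) = 4 * k" "2 * (28 - 2 * k) = 56 - 4 * k" by auto
  have nz: "qpoch_inf (q ^ (2 * k)) (q ^ 28) \<noteq> 0" "qpoch_inf (q ^ (28 - 2 * k)) (q ^ 28) \<noteq> 0"
    "qpoch_inf (q ^ 28) (q ^ 28) \<noteq> 0" "qpoch_inf (q ^ 56) (q ^ 56) \<noteq> 0"
    using k by (simp_all add: qpoch_q_nonzero)
  have d: "qpoch_inf (- (q ^ (2 * k))) (q ^ 28) = qpoch_inf (q ^ (4 * k)) (q ^ 56) / qpoch_inf (q ^ (2 * k)) (q ^ 28)"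
    "qpoch_inf (- (q ^ (28 - 2 * k))) (q ^ 28) = qpoch_inf (q ^ (56 - 4 * k)) (q ^ 56) / qpoch_inf (q ^ (28 - 2 * k)) (q ^ 28)"
    using dbl[of "2 * k", unfolded f] dbl[of "28 - 2 * k", unfolded f] k by auto
  have "u / a * (v / b) * w * (s * t) = w\<^sup>2 * (u * v * x) * (t * s * x) / (x\<^sup>2 * (a * b * w))"
    if "a \<noteq> 0" "b \<noteq> 0" "w \<noteq> 0" "x \<noteq> 0" for a b w x u v s t :: complex
    using that by (simp add: field_simps power2_eq_square)
  from this[OF nz] show ?thesis
    unfolding quint_prod_def pw quint_J_neg_def JJ_def J_def d by simp
qed

lemma half_val_int_val_eq_J:
  assumes "k \<le> 7"
  shows "half_val (q\<^sup>2) k = J q 4 ^ 3 / (J q 2 ^ 2 * J q 8 ^ 2) * quint_J k"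
    and "int_val (q\<^sup>2) k = 2 * (J q 8 ^ 2 / J q 4 ^ 3) * quint_J k"
    and "odd k \<Longrightarrow> half_val (- (q\<^sup>2)) k = J q 2 ^ 2 / J q 4 ^ 3 * quint_J_neg k"
proof -
  have J: "J q 2 \<noteq> 0" "J q 4 \<noteq> 0" "J q 8 \<noteq> 0" by (intro J_nonzero; simp)+
  have J4: "qpoch_inf (q ^ 4) (q ^ 4) = J q 4" by (simp add: J_def)
  have ar: "C\<^sup>2 / (B * D) * (C\<^sup>2 / (B * D) / C * R) = C ^ 3 / (B\<^sup>2 * D\<^sup>2) * R"
    "2 * (D / C) * (D / C / C * R) = 2 * (D\<^sup>2 / C ^ 3) * R"
    "B / C * (B / C / C * R) = B\<^sup>2 / C ^ 3 * R"
    if "B \<noteq> 0" "C \<noteq> 0" "D \<noteq> 0" for B C D R :: complex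
    using that by (simp_all add: field_simps eval_nat_numeral)
  show "half_val (q\<^sup>2) k = J q 4 ^ 3 / (J q 2 ^ 2 * J q 8 ^ 2) * quint_J k"
    unfolding half_val_def quint_prod_eq_J[OF assms] q_nonzero(4) qpoch_eq_J J4 by (rule ar(1)[OF J])
  show "int_val (q\<^sup>2) k = 2 * (J q 8 ^ 2 / J q 4 ^ 3) * quint_J k"
    unfolding int_val_def quint_prod_eq_J[OF assms] q_nonzero(4) qpoch_eq_J J4 by (rule ar(2)[OF J])
  assume "odd k"
  thus "half_val (- (q\<^sup>2)) k = J q 2 ^ 2 / J q 4 ^ 3 * quint_J_neg k"
    unfolding half_val_def quint_prod_neg_eq_J[OF assms \<open>odd k\<close>] minus_minus power2_minus q_nonzero(4) qpoch_eq_J J4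
    by (intro ar(3)[OF J])
qed

lemma prefactor_eq_J:
  "prefactor 0 = 1 / (J q 2 * J q 8)"
  "prefactor 2 = J q 8 / J q 4 ^ 3"
  "prefactor (-2) = 2 * prefactor 2"
proof -
  have J: "J q 2 \<noteq> 0" "J q 4 \<noteq> 0" "J q 8 \<noteq> 0" by (intro J_nonzero; simp)+
  have J4: "qpoch_inf (q ^ 4) (q ^ 4) = J q 4" by (simp add: J_def)
  have p: "prefactor 0 = qpoch_inf (- (q\<^sup>2)) (q ^ 4) / (J q 4)\<^sup>2"
    "prefactor 2 = qpoch_inf (- (q ^ 4)) (q ^ 4) / (J q 4)\<^sup>2"
    "prefactor (-2) = qpoch_inf (- 1) (q ^ 4) / (J q 4)\<^sup>2"
    by (simp_all add: prefactor_def J4)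
  show "prefactor 0 = 1 / (J q 2 * J q 8)"
    unfolding p qpoch_eq_J using J by simp
  show "prefactor 2 = J q 8 / J q 4 ^ 3" "prefactor (-2) = 2 * prefactor 2"
    unfolding p qpoch_eq_J by (simp_all add: power2_eq_square power3_eq_cube)
qed

text \<open>The four-term shape of the theorem: \<open>th0\<^sup>2 + th1\<^sup>2\<close> is \<open>(th0 + th1)\<^sup>2 - 2 th0 th1\<close> and contributes the second and third
  terms, while \<open>th0\<^sup>2 - th1\<^sup>2 = (th0 + th1) (th0 - th1)\<close> contributes the last.\<close>

lemma combined_eq_J:
  assumes "k \<le> 7" "m \<le> 7" "odd m"
  shows "prefactor 0 * combined a (x * int_val (q\<^sup>2) k) (y * half_val (q\<^sup>2) m) (z * half_val (- (q\<^sup>2)) m) =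
      4 * q * x * (J q 8 ^ 5 / (J q 2 * J q 4 ^ 5) * quint_J k)
      - 2 * q * y * (J q 4 * J q 8 / J q 2 ^ 3 * quint_J m)
      + 1/2 * y * (J q 2 ^ 7 / (J q 1 ^ 4 * J q 4 * J q 8 ^ 3) * quint_J m)
      + (-1) powi a * (1/2 * z * (J q 2 ^ 5 / (J q 4 ^ 5 * J q 8) * quint_J_neg m))" (is ?th0)
    and "prefactor 2 * combined a (x * int_val (q\<^sup>2) k) (y * half_val (q\<^sup>2) m) (z * half_val (- (q\<^sup>2)) m) =
      4 * q * x * (J q 8 ^ 7 / J q 4 ^ 8 * quint_J k)
      - 2 * q * y * (J q 8 ^ 3 / (J q 2 ^ 2 * J q 4 ^ 2) * quint_J m)
      + 1/2 * y * (J q 2 ^ 8 / (J q 1 ^ 4 * J q 4 ^ 4 * J q 8) * quint_J m)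
      + (-1) powi a * (1/2 * z * (J q 2 ^ 6 * J q 8 / J q 4 ^ 8 * quint_J_neg m))" (is ?th2)
proof -
  have J: "J q 1 \<noteq> 0" "J q 2 \<noteq> 0" "J q 4 \<noteq> 0" "J q 8 \<noteq> 0" by (intro J_nonzero; simp)+
  have "th0\<^sup>2 + th1\<^sup>2 = (th0 + th1)\<^sup>2 - 2 * (th0 * th1)" "th0\<^sup>2 - th1\<^sup>2 = (th0 + th1) * (th0 - th1)"
    by (simp_all add: power2_eq_square algebra_simps)
  hence s: "th0\<^sup>2 + th1\<^sup>2 = (J q 2 ^ 5 / (J q 1 ^ 2 * J q 4 ^ 2))\<^sup>2 - 2 * (2 * q * (J q 8 ^ 4 / J q 4 ^ 2))"
    and d: "th0\<^sup>2 - th1\<^sup>2 = (J q 2 ^ 5 / (J q 1 ^ 2 * J q 4 ^ 2)) * (J q 1 ^ 2 / J q 2)"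
    by (simp_all only: theta_sum_diff_eq_J theta_product_eq_J)
  have e: "combined a (x * int_val (q\<^sup>2) k) (y * half_val (q\<^sup>2) m) (z * half_val (- (q\<^sup>2)) m) =
     4 * q * x * (J q 8 ^ 6 / J q 4 ^ 5 * quint_J k)
      - 2 * q * y * (J q 4 * J q 8 ^ 2 / J q 2 ^ 2 * quint_J m)
      + 1/2 * y * (J q 2 ^ 8 / (J q 1 ^ 4 * J q 4 * J q 8 ^ 2) * quint_J m)
      + (-1) powi a * (1/2 * z * (J q 2 ^ 6 / J q 4 ^ 5 * quint_J_neg m))"
  proof -
    have "2 * q * (D ^ 4 / C ^ 2) * (x * (2 * (D\<^sup>2 / C ^ 3) * P)) = 4 * q * x * (D ^ 6 / C ^ 5 * P)"
      "((B ^ 5 / (A ^ 2 * C ^ 2))\<^sup>2 - 2 * (2 * q * (D ^ 4 / C ^ 2))) / 2 * (y * (C ^ 3 / (B ^ 2 * D ^ 2) * M))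
        = - (2 * q * y * (C * D ^ 2 / B ^ 2 * M)) + 1/2 * y * (B ^ 8 / (A ^ 4 * C * D ^ 2) * M)"
      "w * (B ^ 5 / (A ^ 2 * C ^ 2) * (A\<^sup>2 / B) / 2) * (z * (B\<^sup>2 / C ^ 3 * N)) = w * (1/2 * z * (B ^ 6 / C ^ 5 * N))"
      if "A \<noteq> 0" "B \<noteq> 0" "C \<noteq> 0" "D \<noteq> 0" for A B C D P M N w :: complex
      using that by (simp_all add: field_simps eval_nat_numeral)
    note ar = this[OF J]
    show ?thesis
      unfolding combined_def theta_product_eq_J s d half_val_int_val_eq_J(1,2)[OF assms(1)] half_val_int_val_eq_J(1,2)[OF assms(2)]
        half_val_int_val_eq_J(3)[OF assms(2,3)] ar by simp
  qed
  have ar: "1 / (B * D) * (4 * q * x * (D ^ 6 / C ^ 5 * P) - 2 * q * y * (C * D ^ 2 / B ^ 2 * M)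
      + 1/2 * y * (B ^ 8 / (A ^ 4 * C * D ^ 2) * M) + w * (1/2 * z * (B ^ 6 / C ^ 5 * N))) =
      4 * q * x * (D ^ 5 / (B * C ^ 5) * P) - 2 * q * y * (C * D / B ^ 3 * M)
      + 1/2 * y * (B ^ 7 / (A ^ 4 * C * D ^ 3) * M) + w * (1/2 * z * (B ^ 5 / (C ^ 5 * D) * N))"
    "D / C ^ 3 * (4 * q * x * (D ^ 6 / C ^ 5 * P) - 2 * q * y * (C * D ^ 2 / B ^ 2 * M)
      + 1/2 * y * (B ^ 8 / (A ^ 4 * C * D ^ 2) * M) + w * (1/2 * z * (B ^ 6 / C ^ 5 * N))) =
      4 * q * x * (D ^ 7 / C ^ 8 * P) - 2 * q * y * (D ^ 3 / (B ^ 2 * C ^ 2) * M)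
      + 1/2 * y * (B ^ 8 / (A ^ 4 * C ^ 4 * D) * M) + w * (1/2 * z * (B ^ 6 * D / C ^ 8 * N))"
    if "A \<noteq> 0" "B \<noteq> 0" "C \<noteq> 0" "D \<noteq> 0" for A B C D P M N w :: complex
    unfolding right_diff_distrib distrib_left
    by (intro arg_cong2[where f = "(+)"] arg_cong2[where f = "(-)"];
        use that in \<open>simp add: field_simps eval_nat_numeral\<close>)+
  show ?th0 unfolding e prefactor_eq_J ar[OF J] ..
  show ?th2 unfolding e prefactor_eq_J ar[OF J] ..
qed

end

theorem theorem5p2:
  fixes q :: complex
  assumes "0 < norm q" and "norm q < 1"
  shows "S q 0 0 0 =
       4 * q ^ 2 * ((J q 8 ^ 6 * JJ q 8 28 * JJ q 12 56) / (J q 2 * J q 4 ^ 5 * J q 8 * J q 56))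
     - 2 * q * ((J q 4 * J q 8 * JJ q 6 28 * JJ q 16 56) / (J q 2 ^ 3 * J q 56))
     + 1/2 * ((J q 2 ^ 7 * JJ q 6 28 * JJ q 16 56) / (J q 1 ^ 4 * J q 4 * J q 8 ^ 3 * J q 56))
     + 1/2 * ((J q 2 ^ 5 * J q 28 ^ 2 * JJ q 12 56 * JJ q 16 56) / (J q 4 ^ 5 * J q 8 * J q 56 ^ 2 * JJ q 6 28)) \<and>
    S q 1 1 (1/2) =
       4 * ((J q 8 ^ 7 * JJ q 8 28 * JJ q 12 56) / (J q 4 ^ 8 * J q 56))
     - 2 * q powi (-1) * ((J q 8 ^ 3 * JJ q 6 28 * JJ q 16 56) / (J q 2 ^ 2 * J q 4 ^ 2 * J q 56))
     + 1/2 * q powi (-2) * ((J q 2 ^ 8 * JJ q 6 28 * JJ q 16 56) / (J q 1 ^ 4 * J q 4 ^ 4 * J q 8 * J q 56))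
     - 1/2 * q powi (-2) * ((J q 2 ^ 6 * J q 8 * J q 28 ^ 2 * JJ q 12 56 * JJ q 16 56) / (J q 4 ^ 8 * J q 56 ^ 2 * JJ q 6 28)) \<and>
    S q (-1) (-1) 0 =
       4 * q ^ 2 * ((J q 8 ^ 5 * JJ q 12 28 * JJ q 4 56) / (J q 2 * J q 4 ^ 5 * J q 56))
     - 2 * q powi (-1) * ((J q 4 * J q 8 * JJ q 2 28 * JJ q 24 56) / (J q 2 ^ 3 * J q 56))
     + 1/2 * q powi (-2) * ((J q 2 ^ 7 * JJ q 2 28 * JJ q 24 56) / (J q 1 ^ 4 * J q 4 * J q 8 ^ 3 * J q 56))
     - 1/2 * q powi (-2) * ((J q 2 ^ 5 * J q 28 ^ 2 * JJ q 4 56 * JJ q 24 56) / (J q 4 ^ 5 * J q 8 * J q 56 ^ 2 * JJ q 2 28)) \<and>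
    S q 0 0 (1/2) =
       4 * q ^ 4 * ((J q 8 ^ 7 * JJ q 12 28 * JJ q 4 56) / (J q 4 ^ 8 * J q 56))
     - 2 * q * ((J q 8 ^ 3 * JJ q 2 28 * JJ q 24 56) / (J q 2 ^ 2 * J q 4 ^ 2 * J q 56))
     + 1/2 * ((J q 2 ^ 8 * JJ q 2 28 * JJ q 24 56) / (J q 1 ^ 4 * J q 4 ^ 4 * J q 8 * J q 56))
     + 1/2 * ((J q 2 ^ 6 * J q 8 * J q 28 ^ 2 * JJ q 4 56 * JJ q 24 56) / (J q 4 ^ 8 * J q 56 ^ 2 * JJ q 2 28)) \<and>
    S q 0 (-1) 0 =
       4 * ((J q 8 ^ 5 * JJ q 4 28 * JJ q 20 56) / (J q 2 * J q 4 ^ 5 * J q 56))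
     - 2 * q * ((J q 4 * J q 8 * JJ q 10 28 * JJ q 8 56) / (J q 2 ^ 3 * J q 56))
     + 1/2 * ((J q 2 ^ 7 * JJ q 10 28 * JJ q 8 56) / (J q 1 ^ 4 * J q 4 * J q 8 ^ 3 * J q 56))
     - 1/2 * ((J q 2 ^ 5 * J q 28 ^ 2 * JJ q 8 56 * JJ q 20 56) / (J q 4 ^ 5 * J q 8 * J q 56 ^ 2 * JJ q 10 28)) \<and>
    S q 1 0 (1/2) =
       4 * ((J q 8 ^ 7 * JJ q 4 28 * JJ q 20 56) / (J q 4 ^ 8 * J q 56))
     - 2 * q * ((J q 8 ^ 3 * JJ q 10 28 * JJ q 8 56) / (J q 2 ^ 2 * J q 4 ^ 2 * J q 56))
     + 1/2 * ((J q 2 ^ 8 * JJ q 10 28 * JJ q 8 56) / (J q 1 ^ 4 * J q 4 ^ 4 * J q 8 * J q 56))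
     + 1/2 * ((J q 2 ^ 6 * J q 8 * J q 28 ^ 2 * JJ q 8 56 * JJ q 20 56) / (J q 4 ^ 8 * J q 56 ^ 2 * JJ q 10 28)) \<and>
    S q (-1) (-1) (-1/2) = 2 * S q 1 1 (1/2) \<and>
    S q (-2) (-2) (-1/2) = 2 * q powi (-8) * S q 0 0 (1/2) \<and>
    S q (-1) (-2) (-1/2) = 2 * q powi (-4) * S q 1 0 (1/2)"
proof -
  interpret tadpole_sum q
    by standard (use assms in auto)
  have q0: "q \<noteq> 0" by (rule q_nonzero)
  have J8: "J q 8 \<noteq> 0" by (rule J_nonzero) simp
  have pw: "q powi (-1) = 1 / q" "q powi (-2) = 1 / q ^ 2"
    by (simp_all add: power_int_minus divide_inverse)
  have j6: "J q 8 ^ 6 = J q 8 * J q 8 ^ 5"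
    by (simp flip: power_Suc)
  have sign: "combined (-1) = combined 1" "combined (-2) = combined 0"
    by (intro ext, simp add: combined_def)+
  have "q powi (-5) = q powi (-4) * q powi (-1)"
    using q0 by (subst powi_mult_eq) auto
  \<comment> \<open>The last three sums share their inner double sum with earlier ones; only the factor in front differs.\<close>
  hence minus_half: "S q (-1) (-1) (-1/2) = 2 * S q 1 1 (1/2)"
    "S q (-2) (-2) (-1/2) = 2 * q powi (-8) * S q 0 0 (1/2)"
    "S q (-1) (-2) (-1/2) = 2 * q powi (-4) * S q 1 0 (1/2)"
    using S_diagonal[of "-1"] S_diagonal[of 1] S_diagonal_shifted[of "-2"] S_diagonal_shifted[of 0] S_off_diagonal[of "-1"] S_off_diagonal[of 1]
    by (simp_all add: prefactor_eq_J(3) sign)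
  show ?thesis
  proof (intro conjI, goal_cases)
    case 1
    have arith: "q powi 0 * (4 * q * q * T1 - 2 * q * 1 * T2 + 1/2 * 1 * T3 + (-1) powi 0 * (1/2 * 1 * T4))
      = 4 * q ^ 2 * T1 - 2 * q * T2 + 1/2 * T3 + 1/2 * T4" for T1 T2 T3 T4
      using q0 by (simp add: pw field_simps eval_nat_numeral)
    have "S q 0 0 0 = q powi 0 * (prefactor 0 * combined 0 (q * int_val (q\<^sup>2) 4) (1 * half_val (q\<^sup>2) 3) (1 * half_val (- (q\<^sup>2)) 3))"
      using S_diagonal[of "0"] by simp
    also note combined_eq_J(1)[of 4 3 "0" "q" "1" "1", simplified numeral_le_iff odd_numeral]
    finally show ?case
      unfolding arith quint_J_def quint_J_neg_def using J8 by (simp add: j6 mult_ac)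
  next
    case 2
    have arith: "q powi (-2) * (4 * q * q * T1 - 2 * q * 1 * T2 + 1/2 * 1 * T3 + (-1) powi 1 * (1/2 * 1 * T4))
      = 4 * T1 - 2 * q powi (-1) * T2 + 1/2 * q powi (-2) * T3 - 1/2 * q powi (-2) * T4" for T1 T2 T3 T4
      using q0 by (simp add: pw field_simps eval_nat_numeral)
    have "S q 1 1 (1/2) = q powi (-2) * (prefactor 2 * combined 1 (q * int_val (q\<^sup>2) 4) (1 * half_val (q\<^sup>2) 3) (1 * half_val (- (q\<^sup>2)) 3))"
      using S_diagonal[of "1"] by simp
    also note combined_eq_J(2)[of 4 3 "1" "q" "1" "1", simplified numeral_le_iff odd_numeral]
    finally show ?case
      unfolding arith quint_J_def quint_J_neg_def using J8 by (simp add: j6 mult_ac)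
  next
    case 3
    have arith: "q powi (-2) * (4 * q * (q ^ 3) * T1 - 2 * q * 1 * T2 + 1/2 * 1 * T3 + (-1) powi (-1) * (1/2 * 1 * T4))
      = 4 * q ^ 2 * T1 - 2 * q powi (-1) * T2 + 1/2 * q powi (-2) * T3 - 1/2 * q powi (-2) * T4" for T1 T2 T3 T4
      using q0 by (simp add: pw field_simps eval_nat_numeral)
    have "S q (-1) (-1) 0 = q powi (-2) * (prefactor 0 * combined (-1) (q ^ 3 * int_val (q\<^sup>2) 6) (1 * half_val (q\<^sup>2) 1) (1 * half_val (- (q\<^sup>2)) 1))"
      using S_diagonal_shifted[of "-1"] by simp
    also note combined_eq_J(1)[of 6 1 "-1" "q ^ 3" "1" "1", simplified numeral_le_iff odd_numeral]
    finally show ?case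
      unfolding arith quint_J_def quint_J_neg_def using J8 by (simp add: j6 mult_ac)
  next
    case 4
    have arith: "q powi 0 * (4 * q * (q ^ 3) * T1 - 2 * q * 1 * T2 + 1/2 * 1 * T3 + (-1) powi 0 * (1/2 * 1 * T4))
      = 4 * q ^ 4 * T1 - 2 * q * T2 + 1/2 * T3 + 1/2 * T4" for T1 T2 T3 T4
      using q0 by (simp add: pw field_simps eval_nat_numeral)
    have "S q 0 0 (1/2) = q powi 0 * (prefactor 2 * combined 0 (q ^ 3 * int_val (q\<^sup>2) 6) (1 * half_val (q\<^sup>2) 1) (1 * half_val (- (q\<^sup>2)) 1))"
      using S_diagonal_shifted[of "0"] by simp
    also note combined_eq_J(2)[of 6 1 "0" "q ^ 3" "1" "1", simplified numeral_le_iff odd_numeral]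
    finally show ?case
      unfolding arith quint_J_def quint_J_neg_def using J8 by (simp add: j6 mult_ac)
  next
    case 5
    have arith: "q powi (-1) * (4 * q * 1 * T1 - 2 * q * q * T2 + 1/2 * q * T3 + (-1) powi 0 * (1/2 * (- q) * T4))
      = 4 * T1 - 2 * q * T2 + 1/2 * T3 - 1/2 * T4" for T1 T2 T3 T4
      using q0 by (simp add: pw field_simps eval_nat_numeral)
    have "S q 0 (-1) 0 = q powi (-1) * (prefactor 0 * combined 0 (1 * int_val (q\<^sup>2) 2) (q * half_val (q\<^sup>2) 5) (- q * half_val (- (q\<^sup>2)) 5))"
      using S_off_diagonal[of "0"] by simp
    also note combined_eq_J(1)[of 2 5 "0" "1" "q" "- q", simplified numeral_le_iff odd_numeral]
    finally show ?case
      unfolding arith quint_J_def quint_J_neg_def using J8 by (simp add: j6 mult_ac)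
  next
    case 6
    have arith: "q powi (-1) * (4 * q * 1 * T1 - 2 * q * q * T2 + 1/2 * q * T3 + (-1) powi 1 * (1/2 * (- q) * T4))
      = 4 * T1 - 2 * q * T2 + 1/2 * T3 + 1/2 * T4" for T1 T2 T3 T4
      using q0 by (simp add: pw field_simps eval_nat_numeral)
    have "S q 1 0 (1/2) = q powi (-1) * (prefactor 2 * combined 1 (1 * int_val (q\<^sup>2) 2) (q * half_val (q\<^sup>2) 5) (- q * half_val (- (q\<^sup>2)) 5))"
      using S_off_diagonal[of "1"] by simp
    also note combined_eq_J(2)[of 2 5 "1" "1" "q" "- q", simplified numeral_le_iff odd_numeral]
    finally show ?case
      unfolding arith quint_J_def quint_J_neg_def using J8 by (simp add: j6 mult_ac)
  qed (fact minus_half)+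
qed

end
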